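(* Let $\{X_t^i\}_{1\le i\le N}$ be a solution of the consensus-based optimization system $$dX_t^i=-\lambda(X_t^i-\bar X_t^* )\,dt+\sigma\sum_{l=1}^d(x_t^{i,l}-\bar x_t^{*,l})\,dW_t^l\,e_l,\quad t>0,\ i=1,\dots,N,$$ where $X_t^i=(x_t^{i,1},\dots,x_t^{i,d})\in\mathbb R^d$ and $$\bar X_t^*=(\bar x_t^{*,1},\dots,\bar x_t^{*,d}):=\frac{\sum_{k=1}^NX_t^ke^{-\beta L(X_t^k)}}{\sum_{k=1}^Ne^{-\beta L(X_t^k)}} .$$ Let $\bar x_0^l:=\frac1N\sum_{i=1}^Nx_0^{i,l}$. Then: (i) for all $t\ge0$, $$\frac1N\sum_{i=1}^N\mathbb E|X_t^i-\bar X_t^*|^2\le 2e^{-(2\lambda-\sigma^2)t}\sum_{l=1}^d\mathbb E\Big[\max_{1\le i\le N}(x_0^{i,l}-\bar x_0^l)^2\Big];$$ (ii) if $2\lambda>\sigma^2$, then there exists a random vector $X_\infty$ such that $\lim_{t\to\infty}X_t^i=X_\infty$ almost surely for every $1\le i\le N$.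
   Context: $N,d\ge1$, $\lambda>0$ (drift rate), $\sigma\ge0$ (noise intensity), $\beta>0$; $L:\mathbb R^d\to\mathbb R$ is locally Lipschitz continuous. $W^1,\dots,W^d$ are independent standard one-dimensional Brownian motions on a probability space $(\Omega,\mathcal F,\mathbb P)$, the same ones for all particles $i$; $\{e_l\}$ is the standard basis of $\mathbb R^d$; $|\cdot|$ is the Euclidean norm. The initial data $(X_0^1,\dots,X_0^N)$ are random vectors independent of the Brownian motions. Solutions are strong solutions with continuous paths on $[0,\infty)$. *)

theory Defs
  imports "HOL-Probability.Probability"
begin

text \<open>Processes are functions of time and outcome, \<open>real \<Rightarrow> 'w \<Rightarrow> _\<close>; only times \<open>t \<ge> 0\<close> matter.\<close>

definition standard_brownian_motion :: "'w measure \<Rightarrow> (real \<Rightarrow> 'w \<Rightarrow> real) \<Rightarrow> bool" where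
  "standard_brownian_motion M B \<longleftrightarrow>
     (\<forall>t\<ge>0. B t \<in> borel_measurable M) \<and>
     (\<forall>\<omega>\<in>space M. B 0 \<omega> = 0) \<and>
     (\<forall>\<omega>\<in>space M. continuous_on {0..} (\<lambda>t. B t \<omega>)) \<and>
     (\<forall>s t. 0 \<le> s \<and> s < t \<longrightarrow>
        distributed M lborel (\<lambda>\<omega>. B t \<omega> - B s \<omega>) (normal_density 0 (sqrt (t - s)))) \<and>
     (\<forall>(n::nat) \<tau>. 0 \<le> \<tau> 0 \<and> mono \<tau> \<longrightarrow>
        prob_space.indep_vars M (\<lambda>_. borel) (\<lambda>k \<omega>. B (\<tau> (Suc k)) \<omega> - B (\<tau> k) \<omega>) {..<n})"

text \<open>A whole path on \<open>[0,\<infinity>)\<close> is a random element of the product space over the index set \<open>{0..}\<close>,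
  so independence of processes is independence of these random elements.\<close>

definition independent_brownian_motions ::
    "'w measure \<Rightarrow> ('d \<Rightarrow> real \<Rightarrow> 'w \<Rightarrow> real) \<Rightarrow> bool" where
  "independent_brownian_motions M W \<longleftrightarrow>
     (\<forall>l. standard_brownian_motion M (W l)) \<and>
     prob_space.indep_vars M (\<lambda>_. \<Pi>\<^sub>M t\<in>{0..}. borel) (\<lambda>l \<omega>. \<lambda>t\<in>{0..}. W l t \<omega>) UNIV"

definition initial_data_independent ::
    "'w measure \<Rightarrow> ('d \<Rightarrow> real \<Rightarrow> 'w \<Rightarrow> real) \<Rightarrow> ('n \<Rightarrow> 'w \<Rightarrow> 'a::topological_space) \<Rightarrow> bool" where
  "initial_data_independent M W X0 \<longleftrightarrow>
     (\<forall>i. X0 i \<in> borel_measurable M) \<and>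
     prob_space.indep_set M
       (sets (vimage_algebra (space M) (\<lambda>\<omega> i. X0 i \<omega>) (\<Pi>\<^sub>M i\<in>UNIV. borel)))
       (sets (vimage_algebra (space M) (\<lambda>\<omega>. \<lambda>(l, t)\<in>UNIV \<times> {0..}. W l t \<omega>)
          (\<Pi>\<^sub>M p\<in>UNIV \<times> {0..}. borel)))"

text \<open>The filtration of a strong solution: generated by the initial data and the driving
  Brownian motions up to time \<open>t\<close>, augmented by the null sets.\<close>

definition driving_filtration ::
    "'w measure \<Rightarrow> ('d \<Rightarrow> real \<Rightarrow> 'w \<Rightarrow> real) \<Rightarrow> ('n \<Rightarrow> 'w \<Rightarrow> 'a::topological_space)
      \<Rightarrow> real \<Rightarrow> 'w measure" where
  "driving_filtration M W X0 t = sigma (space M)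
     (null_sets M
      \<union> {X0 i -` A \<inter> space M | i A. A \<in> sets borel}
      \<union> {W l s -` A \<inter> space M | l s A. 0 \<le> s \<and> s \<le> t \<and> A \<in> sets borel})"

definition adapted :: "(real \<Rightarrow> 'w measure) \<Rightarrow> (real \<Rightarrow> 'w \<Rightarrow> 'a::topological_space) \<Rightarrow> bool" where
  "adapted F Y \<longleftrightarrow> (\<forall>t\<ge>0. Y t \<in> borel_measurable (F t))"

definition progressively_measurable ::
    "(real \<Rightarrow> 'w measure) \<Rightarrow> (real \<Rightarrow> 'w \<Rightarrow> real) \<Rightarrow> bool" where
  "progressively_measurable F H \<longleftrightarrow>
     (\<forall>t\<ge>0. case_prod H \<in> borel_measurable (restrict_space borel {0..t} \<Otimes>\<^sub>M F t))"

text \<open>The simple process \<open>\<Sum>j<k. \<xi> j \<cdot> 1\<close> on \<open>(\<tau> j, \<tau> (j+1)]\<close> and its stochastic integral.\<close>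

definition simple_process_data ::
    "'w measure \<Rightarrow> (real \<Rightarrow> 'w measure) \<Rightarrow> nat \<Rightarrow> (nat \<Rightarrow> real) \<Rightarrow> (nat \<Rightarrow> 'w \<Rightarrow> real) \<Rightarrow> bool" where
  "simple_process_data M F k \<tau> \<xi> \<longleftrightarrow>
     0 \<le> \<tau> 0 \<and> (\<forall>j<k. \<tau> j \<le> \<tau> (Suc j)) \<and>
     (\<forall>j<k. \<xi> j \<in> borel_measurable (F (\<tau> j))) \<and>
     (\<exists>C. \<forall>j<k. \<forall>\<omega>\<in>space M. \<bar>\<xi> j \<omega>\<bar> \<le> C)"

definition simple_process ::
    "nat \<Rightarrow> (nat \<Rightarrow> real) \<Rightarrow> (nat \<Rightarrow> 'w \<Rightarrow> real) \<Rightarrow> real \<Rightarrow> 'w \<Rightarrow> real" where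
  "simple_process k \<tau> \<xi> t \<omega> = (\<Sum>j<k. \<xi> j \<omega> * indicator {\<tau> j<..\<tau> (Suc j)} t)"

definition simple_integral ::
    "nat \<Rightarrow> (nat \<Rightarrow> real) \<Rightarrow> (nat \<Rightarrow> 'w \<Rightarrow> real) \<Rightarrow> (real \<Rightarrow> 'w \<Rightarrow> real) \<Rightarrow> real \<Rightarrow> 'w \<Rightarrow> real" where
  "simple_integral k \<tau> \<xi> B t \<omega> =
     (\<Sum>j<k. \<xi> j \<omega> * (B (min t (\<tau> (Suc j))) \<omega> - B (min t (\<tau> j)) \<omega>))"

text \<open>\<open>I\<close> is (a continuous version of) the It\^o integral process of \<open>H\<close> with respect to \<open>B\<close>:
  the limit in probability of the integrals of simple processes that converge to \<open>H\<close> in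
  \<open>L\<^sup>2([0,T])\<close> in probability for every \<open>T\<close>. The \<open>L\<^sup>2([0,T])\<close> distance is a nonnegative integral, so the
  convergence entails that \<open>H\<close> is almost surely square integrable on \<open>[0,T]\<close>.\<close>

definition ito_integral_process ::
    "'w measure \<Rightarrow> (real \<Rightarrow> 'w measure) \<Rightarrow> (real \<Rightarrow> 'w \<Rightarrow> real)
      \<Rightarrow> (real \<Rightarrow> 'w \<Rightarrow> real) \<Rightarrow> (real \<Rightarrow> 'w \<Rightarrow> real) \<Rightarrow> bool" where
  "ito_integral_process M F B H I \<longleftrightarrow>
     progressively_measurable F H \<and>
     adapted F I \<and> (\<forall>\<omega>\<in>space M. continuous_on {0..} (\<lambda>t. I t \<omega>)) \<and>
     (\<exists>k \<tau> \<xi>.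
        (\<forall>n::nat. simple_process_data M F (k n) (\<tau> n) (\<xi> n)) \<and>
        (\<forall>T\<ge>0. \<forall>\<epsilon>>0.
           (\<lambda>n. measure M {\<omega>\<in>space M.
              (\<integral>\<^sup>+s\<in>{0..T}. ennreal ((simple_process (k n) (\<tau> n) (\<xi> n) s \<omega> - H s \<omega>)\<^sup>2) \<partial>lborel)
                > ennreal \<epsilon>}) \<longlonglongrightarrow> 0) \<and>
        (\<forall>t\<ge>0. \<forall>\<epsilon>>0.
           (\<lambda>n. measure M {\<omega>\<in>space M.
              \<bar>simple_integral (k n) (\<tau> n) (\<xi> n) B t \<omega> - I t \<omega>\<bar> > \<epsilon>}) \<longlonglongrightarrow> 0))"

definition locally_lipschitz :: "('a::metric_space \<Rightarrow> 'b::metric_space) \<Rightarrow> bool" where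
  "locally_lipschitz f \<longleftrightarrow> (\<forall>x. \<exists>r>0. \<exists>C. C-lipschitz_on (ball x r) f)"

definition consensus_point ::
    "real \<Rightarrow> ('a::real_vector \<Rightarrow> real) \<Rightarrow> ('n::finite \<Rightarrow> 'a) \<Rightarrow> 'a" where
  "consensus_point \<beta> L x =
     (\<Sum>k\<in>UNIV. exp (- \<beta> * L (x k)) *\<^sub>R x k) /\<^sub>R (\<Sum>k\<in>UNIV. exp (- \<beta> * L (x k)))"

text \<open>Strong solutions with continuous paths of the consensus-based optimization system, in
  integral form; \<open>J i l\<close> is the It\^o integral of the \<open>l\<close>-th component of \<open>X\<^sup>i - X\<^sup>*\<close> against \<open>W\<^sup>l\<close>. By path
  continuity the drift is an integral of a continuous function.\<close>

definition cbo_strong_solution ::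
    "'w measure \<Rightarrow> ('d \<Rightarrow> real \<Rightarrow> 'w \<Rightarrow> real) \<Rightarrow> real \<Rightarrow> real \<Rightarrow> real \<Rightarrow> (real^'d \<Rightarrow> real)
      \<Rightarrow> ('n::finite \<Rightarrow> real \<Rightarrow> 'w \<Rightarrow> real^'d::finite) \<Rightarrow> bool" where
  "cbo_strong_solution M W lam \<sigma> \<beta> L X \<longleftrightarrow>
     (let F = driving_filtration M W (\<lambda>i. X i 0);
          Xc = (\<lambda>t \<omega>. consensus_point \<beta> L (\<lambda>k. X k t \<omega>))
      in (\<forall>i. adapted F (X i)) \<and>
         (\<forall>i. \<forall>\<omega>\<in>space M. continuous_on {0..} (\<lambda>t. X i t \<omega>)) \<and>
         (\<exists>J.
            (\<forall>i l. ito_integral_process M F (W l) (\<lambda>t \<omega>. X i t \<omega> $ l - Xc t \<omega> $ l) (J i l)) \<and>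
            (\<forall>i. AE \<omega> in M. \<forall>t\<ge>0.
               X i t \<omega> = X i 0 \<omega> - lam *\<^sub>R integral {0..t} (\<lambda>s. X i s \<omega> - Xc s \<omega>)
                 + \<sigma> *\<^sub>R (\<Sum>l\<in>UNIV. J i l t \<omega> *\<^sub>R axis l 1))))"

end

theory Submission
  imports Defs
begin

text \<open>Every difference of coordinates \<open>D = x\<^sup>i\<^sup>,\<^sup>l - x\<^sup>j\<^sup>,\<^sup>l\<close> solves the linear equation
  \<open>dD = - \<lambda> D dt + \<sigma> D dW\<^sup>l\<close>, because the consensus point cancels. Its unique solution is \<open>D\<^sub>t = D\<^sub>0 G\<^sub>t\<close> with
  \<open>G\<^sub>t = exp (- (\<lambda> + \<sigma>\<^sup>2/2) t + \<sigma> W\<^sup>l\<^sub>t)\<close>. So the deviations from the mean are those at time 0 multiplied by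
  \<open>G\<^sub>t\<close>, which is independent of the initial data and has second moment \<open>exp (- (2\<lambda> - \<sigma>\<^sup>2) t)\<close>; as the
  consensus point is a convex combination of the particles, (i) follows. For (ii), \<open>G\<close> decays
  exponentially almost surely because \<open>W\<^sub>t/t \<rightarrow> 0\<close>; hence the drift is integrable, and the stochastic
  integral oscillates on \<open>[n, n+1]\<close> by at most a summable amount.

  The analytic tool is a Lenglart inequality, \<open>P(\<bar>I\<^sub>t - I\<^sub>a\<bar> > \<epsilon> and \<integral>\<^sub>a\<^sup>t H\<^sup>2 \<le> \<delta> for some t) \<le> 3 \<delta> / \<epsilon>\<^sup>2\<close>,
  for Ito integrals \<open>I = \<integral> H dW\<close>. It needs no moments and passes to limits, so it replaces the
  isometry and localization; with Borel--Cantelli it gives \<open>W\<^sub>t/t \<rightarrow> 0\<close> and the convergence in (ii), and a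
  scaling argument derives from it the uniqueness for the linear equation.\<close>

section \<open>Brownian motion with respect to a filtration\<close>

text \<open>Two obstacles shape the development. No moments of the initial data are assumed, so
  \<open>D 0 * G t\<close> need not be square integrable; random coefficients known at time 0 must
  be allowed to be unbounded, and (i) is an inequality in the extended reals whose right-hand side
  may be infinite. Moreover, an Ito integral is given only as a limit in probability of simple
  integrals, without Ito's formula. That \<open>G\<close> solves its equation is therefore checked
  by hand, from an exact algebraic identity for dyadic sums; its remainder is a sum of orthogonal
  terms, each with variance of second order in the mesh. All particles feel the same noise
  \<open>W l\<close> in coordinate \<open>l\<close>, so a single factor \<open>G l\<close> serves
  all pairs, and the whole configuration of that coordinate shrinks by a common random factor. The 2
  in (i) adds two equal bounds: the variance about the mean and the squared distance from the mean
  to the consensus point are each at most the maximal squared deviation.\<close>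

lemma normal_density_mult_exp:
  assumes "0 < q"
  shows "normal_density 0 q x * exp (c * x) = exp (c\<^sup>2 * q\<^sup>2 / 2) * normal_density (c * q\<^sup>2) q x"
proof -
  \<comment> \<open>Completing the square: exponential tilting of a centred normal law only shifts
    its mean, by \<open>c * q\<^sup>2\<close>.\<close>
  have "- x\<^sup>2 / (2 * q\<^sup>2) + c * x = c\<^sup>2 * q\<^sup>2 / 2 + - (x - c * q\<^sup>2)\<^sup>2 / (2 * q\<^sup>2)"
    using assms by (simp add: field_simps power2_eq_square)
  then have "exp (- x\<^sup>2 / (2 * q\<^sup>2)) * exp (c * x) = exp (c\<^sup>2 * q\<^sup>2 / 2) * exp (- (x - c * q\<^sup>2)\<^sup>2 / (2 * q\<^sup>2))"
    by (metis exp_add)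
  then show ?thesis by (simp add: normal_density_def)
qed

text \<open>One coordinate of the noise together with the common filtration, reduced to what
  martingale arguments consume. \<open>B_indep\<close> speaks of one event of the past and one event
  of the increment, the form in which a pi-system argument delivers it. The locale is later used for
  each coordinate with the same \<open>F\<close>.\<close>

locale brownian_filtration = prob_space M for M :: "'w measure" +
  fixes F :: "real \<Rightarrow> 'w measure" and B :: "real \<Rightarrow> 'w \<Rightarrow> real"
  assumes space_F: "space (F t) = space M"
    and sets_F: "sets (F t) \<subseteq> sets M"
    and F_mono: "0 \<le> s \<Longrightarrow> s \<le> t \<Longrightarrow> sets (F s) \<subseteq> sets (F t)"
    and B_adapted: "0 \<le> t \<Longrightarrow> B t \<in> borel_measurable (F t)"
    and B_zero: "\<omega> \<in> space M \<Longrightarrow> B 0 \<omega> = 0"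
    and B_continuous: "\<omega> \<in> space M \<Longrightarrow> continuous_on {0..} (\<lambda>t. B t \<omega>)"
    and B_normal: "0 \<le> s \<Longrightarrow> s < t \<Longrightarrow>
      distributed M lborel (\<lambda>\<omega>. B t \<omega> - B s \<omega>) (normal_density 0 (sqrt (t - s)))"
    and B_indep: "0 \<le> s \<Longrightarrow> s < t \<Longrightarrow> A \<in> sets (F s) \<Longrightarrow> C \<in> sets borel \<Longrightarrow>
      prob (A \<inter> ((\<lambda>\<omega>. B t \<omega> - B s \<omega>) -` C \<inter> space M)) =
      prob A * prob ((\<lambda>\<omega>. B t \<omega> - B s \<omega>) -` C \<inter> space M)"
begin

lemma measurable_F: "f \<in> borel_measurable (F t) \<Longrightarrow> f \<in> borel_measurable M"
  by (rule measurable_from_subalg[of M "F t"]) (auto simp: subalgebra_def space_F sets_F)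

lemma measurable_F_mono:
  "f \<in> borel_measurable (F s) \<Longrightarrow> 0 \<le> s \<Longrightarrow> s \<le> t \<Longrightarrow> f \<in> borel_measurable (F t)"
  by (rule measurable_from_subalg[of "F t" "F s"]) (auto simp: subalgebra_def space_F F_mono)

lemma B_measurable: "0 \<le> t \<Longrightarrow> B t \<in> borel_measurable M"
  using B_adapted measurable_F by blast

lemma indep_increment:
  fixes \<xi> :: "'w \<Rightarrow> 'a::topological_space"
  assumes st: "0 \<le> s" "s \<le> t" and xi: "\<xi> \<in> borel_measurable (F s)" and phi: "\<phi> \<in> borel_measurable borel"
  shows "indep_var borel \<xi> borel (\<lambda>\<omega>. \<phi> (B t \<omega> - B s \<omega>))"
proof -
  have m: "(\<lambda>\<omega>. B t \<omega> - B s \<omega>) \<in> borel_measurable M"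
    using st B_measurable by auto
  have m': "(\<lambda>\<omega>. \<phi> (B t \<omega> - B s \<omega>)) \<in> borel_measurable M"
    using measurable_compose[OF m phi] .
  show ?thesis
    unfolding indep_var_eq
  proof (intro conjI indep_set_sigma_sets)
    show "random_variable borel \<xi>" using xi measurable_F by blast
    show "random_variable borel (\<lambda>\<omega>. \<phi> (B t \<omega> - B s \<omega>))" by fact
    show "Int_stable {\<xi> -` A \<inter> space M |A. A \<in> sets borel}"
      and "Int_stable {(\<lambda>\<omega>. \<phi> (B t \<omega> - B s \<omega>)) -` A \<inter> space M |A. A \<in> sets borel}"
      unfolding Int_stable_def by (safe, (rule_tac x="A \<inter> Aa" in exI, auto)+)
    show "indep_set {\<xi> -` A \<inter> space M |A. A \<in> sets borel}
        {(\<lambda>\<omega>. \<phi> (B t \<omega> - B s \<omega>)) -` A \<inter> space M |A. A \<in> sets borel}"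
    proof (rule indep_setI)
      show "{\<xi> -` A \<inter> space M |A. A \<in> sets borel} \<subseteq> events"
        using measurable_F[OF xi] by (auto simp: measurable_sets)
      show "{(\<lambda>\<omega>. \<phi> (B t \<omega> - B s \<omega>)) -` A \<inter> space M |A. A \<in> sets borel} \<subseteq> events"
        using m' by (auto simp: measurable_sets)
      fix a c assume a: "a \<in> {\<xi> -` A \<inter> space M |A. A \<in> sets borel}"
        and c: "c \<in> {(\<lambda>\<omega>. \<phi> (B t \<omega> - B s \<omega>)) -` A \<inter> space M |A. A \<in> sets borel}"
      from a have aF: "a \<in> sets (F s)"
        using xi by (auto simp: measurable_sets space_F[of s, symmetric])
      from c obtain C where "C \<in> sets borel" "c = (\<lambda>\<omega>. \<phi> (B t \<omega> - B s \<omega>)) -` C \<inter> space M" by auto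
      then have C: "\<phi> -` C \<in> sets borel" "c = (\<lambda>\<omega>. B t \<omega> - B s \<omega>) -` (\<phi> -` C) \<inter> space M"
        using measurable_sets[OF phi] by auto
      show "prob (a \<inter> c) = prob a * prob c"
      \<comment> \<open>\<open>B_indep\<close> covers only \<open>s < t\<close>. For
        \<open>s = t\<close> the increment is constantly 0, so its event is empty or the whole
        space.\<close>
      proof (cases "s = t")
        case True
        then have "c = {} \<or> c = space M" using C by auto
        moreover have "a \<subseteq> space M" using a by auto
        ultimately show ?thesis using prob_space by (auto simp: Int_absorb2)
      next
        case False
        then show ?thesis using B_indep[OF st(1) _ aF C(1), of t] C(2) st by simp
      qed
    qed
  qed
qed

text \<open>For nonnegative factors the product formula survives infinite integrals. The estimate
  (i) relies on this, since the expected maximal deviation at time 0 may be infinite.\<close>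

lemma nn_integral_indep_increment:
  fixes f :: "'w \<Rightarrow> ennreal"
  assumes st: "0 \<le> s" "s \<le> t"
    and f: "f \<in> borel_measurable (F s)" and \<phi>: "\<phi> \<in> borel_measurable borel"
  shows "(\<integral>\<^sup>+\<omega>. f \<omega> * \<phi> (B t \<omega> - B s \<omega>) \<partial>M) =
    (\<integral>\<^sup>+\<omega>. f \<omega> \<partial>M) * (\<integral>\<^sup>+\<omega>. \<phi> (B t \<omega> - B s \<omega>) \<partial>M)"
proof -
  have "indep_vars (\<lambda>_. borel) (case_bool f (\<lambda>\<omega>. \<phi> (B t \<omega> - B s \<omega>))) UNIV"
    using indep_increment[OF st f \<phi>] unfolding indep_var_def
    by (rule iffD1[OF indep_vars_cong, rotated -1]) (auto split: bool.splits)
  from indep_vars_nn_integral[OF _ this] show ?thesis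
    by (auto simp: UNIV_bool mult.commute split: bool.splits)
qed

text \<open>Each new summand is a mean-zero function of a fresh increment times a factor known at
  its left end, so the cross term in the expanded square integrates to 0. The function
  \<open>\<phi>\<close> is a parameter because two kinds of sums occur: the identity gives
  stochastic sums, an exponential remainder gives the error in the equation for \<open>geom\<close>.
  Measurability of the partial sum is part of the conclusion to keep the induction going.\<close>

lemma orthogonal_increments:
  fixes g :: "nat \<Rightarrow> real" and \<xi> :: "nat \<Rightarrow> 'w \<Rightarrow> real" and \<phi> :: "nat \<Rightarrow> real \<Rightarrow> real"
  assumes g: "0 \<le> g 0" "\<And>j. j < K \<Longrightarrow> g j \<le> g (Suc j)"
    and xi: "\<And>j. j < K \<Longrightarrow> \<xi> j \<in> borel_measurable (F (g j))"
    and xi2: "\<And>j. j < K \<Longrightarrow> integrable M (\<lambda>\<omega>. (\<xi> j \<omega>)\<^sup>2)"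
    and \<phi>: "\<And>j. \<phi> j \<in> borel_measurable borel"
    and \<phi>1: "\<And>j. j < K \<Longrightarrow> has_bochner_integral M (\<lambda>\<omega>. \<phi> j (B (g (Suc j)) \<omega> - B (g j) \<omega>)) 0"
    and \<phi>2: "\<And>j. j < K \<Longrightarrow> has_bochner_integral M (\<lambda>\<omega>. (\<phi> j (B (g (Suc j)) \<omega> - B (g j) \<omega>))\<^sup>2) (v j)"
  defines "S \<equiv> \<lambda>m \<omega>. (\<Sum>j<m. \<xi> j \<omega> * \<phi> j (B (g (Suc j)) \<omega> - B (g j) \<omega>))"
  shows "0 \<le> g K \<and> S K \<in> borel_measurable (F (g K)) \<and>
    has_bochner_integral M (\<lambda>\<omega>. (S K \<omega>)\<^sup>2) (\<Sum>j<K. expectation (\<lambda>\<omega>. (\<xi> j \<omega>)\<^sup>2) * v j)"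
  using g(2) xi xi2 \<phi>1 \<phi>2
proof (induction K)
  case 0
  then show ?case using g(1) by (simp add: S_def has_bochner_integral_iff)
next
  case (Suc K)
  let ?d = "\<lambda>\<omega>. \<phi> K (B (g (Suc K)) \<omega> - B (g K) \<omega>)"
  have IH: "0 \<le> g K" "S K \<in> borel_measurable (F (g K))"
    "has_bochner_integral M (\<lambda>\<omega>. (S K \<omega>)\<^sup>2) (\<Sum>j<K. expectation (\<lambda>\<omega>. (\<xi> j \<omega>)\<^sup>2) * v j)"
    using Suc.IH Suc.prems by auto
  have gK: "g K \<le> g (Suc K)" and x: "\<xi> K \<in> borel_measurable (F (g K))"
    and x2: "integrable M (\<lambda>\<omega>. (\<xi> K \<omega>)\<^sup>2)"
    and p1: "has_bochner_integral M ?d 0" and p2: "has_bochner_integral M (\<lambda>\<omega>. (?d \<omega>)\<^sup>2) (v K)"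
    using Suc.prems by auto
  have le: "0 \<le> g (Suc K)" using IH gK by simp
  have SE: "S (Suc K) = (\<lambda>\<omega>. S K \<omega> + \<xi> K \<omega> * ?d \<omega>)" by (simp add: S_def)
  note [measurable] = \<phi>[of K]
  have [measurable]: "B (g (Suc K)) \<in> borel_measurable (F (g (Suc K)))"
    "B (g K) \<in> borel_measurable (F (g (Suc K)))"
    "\<xi> K \<in> borel_measurable (F (g (Suc K)))" "S K \<in> borel_measurable (F (g (Suc K)))"
    using B_adapted[OF le] measurable_F_mono[OF B_adapted[OF IH(1)] IH(1) gK]
      measurable_F_mono[OF x IH(1) gK] measurable_F_mono[OF IH(2) IH(1) gK] by auto
  have m: "S (Suc K) \<in> borel_measurable (F (g (Suc K)))"
    unfolding SE by measurable
  have xM: "\<xi> K \<in> borel_measurable M" "S K \<in> borel_measurable M"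
    using measurable_F x IH(2) by auto
  \<comment> \<open>Square integrability of both factors is enough, by
    \<open>2 * \<bar>a * b\<bar> \<le> a\<^sup>2 + b\<^sup>2\<close>, which is read off from the
    squares of \<open>a - b\<close> and \<open>a + b\<close>.\<close>
  have int_xS: "integrable M (\<lambda>\<omega>. 2 * (S K \<omega> * \<xi> K \<omega>))"
  proof (rule Bochner_Integration.integrable_bound)
    show "integrable M (\<lambda>\<omega>. (S K \<omega>)\<^sup>2 + (\<xi> K \<omega>)\<^sup>2)"
      using IH(3) x2 by (auto simp: has_bochner_integral_iff)
    show "AE \<omega> in M. norm (2 * (S K \<omega> * \<xi> K \<omega>)) \<le> norm ((S K \<omega>)\<^sup>2 + (\<xi> K \<omega>)\<^sup>2)"
    proof (rule AE_I2)
      fix \<omega> 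
      have "0 \<le> (S K \<omega> - \<xi> K \<omega>)\<^sup>2" "0 \<le> (S K \<omega> + \<xi> K \<omega>)\<^sup>2" by simp_all
      then show "norm (2 * (S K \<omega> * \<xi> K \<omega>)) \<le> norm ((S K \<omega>)\<^sup>2 + (\<xi> K \<omega>)\<^sup>2)"
        by (simp add: power2_diff power2_sum abs_if)
    qed
  qed (use xM in measurable)
  have "indep_var borel (\<lambda>\<omega>. 2 * (S K \<omega> * \<xi> K \<omega>)) borel ?d"
    by (rule indep_increment) (use IH x gK \<phi> in auto)
  note i1 = indep_var_integrable[OF this int_xS] indep_var_lebesgue_integral[OF this int_xS]
  have b1: "has_bochner_integral M (\<lambda>\<omega>. 2 * (S K \<omega> * \<xi> K \<omega>) * ?d \<omega>) 0"
    using i1 p1 by (auto simp: has_bochner_integral_iff)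
  have "indep_var borel (\<lambda>\<omega>. (\<xi> K \<omega>)\<^sup>2) borel (\<lambda>\<omega>. (?d \<omega>)\<^sup>2)"
    by (rule indep_increment[of "g K" "g (Suc K)" _ "\<lambda>x. (\<phi> K x)\<^sup>2"]) (use IH x gK \<phi> in auto)
  note i2 = indep_var_integrable[OF this x2] indep_var_lebesgue_integral[OF this x2]
  have b2: "has_bochner_integral M (\<lambda>\<omega>. (\<xi> K \<omega>)\<^sup>2 * (?d \<omega>)\<^sup>2) (expectation (\<lambda>\<omega>. (\<xi> K \<omega>)\<^sup>2) * v K)"
    using i2 p2 by (auto simp: has_bochner_integral_iff)
  have "has_bochner_integral M (\<lambda>\<omega>. (S K \<omega>)\<^sup>2 + 2 * (S K \<omega> * \<xi> K \<omega>) * ?d \<omega> + (\<xi> K \<omega>)\<^sup>2 * (?d \<omega>)\<^sup>2)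
    ((\<Sum>j<K. expectation (\<lambda>\<omega>. (\<xi> j \<omega>)\<^sup>2) * v j) + 0 + expectation (\<lambda>\<omega>. (\<xi> K \<omega>)\<^sup>2) * v K)"
    by (intro has_bochner_integral_add IH(3) b1 b2)
  also have "(\<lambda>\<omega>. (S K \<omega>)\<^sup>2 + 2 * (S K \<omega> * \<xi> K \<omega>) * ?d \<omega> + (\<xi> K \<omega>)\<^sup>2 * (?d \<omega>)\<^sup>2) = (\<lambda>\<omega>. (S (Suc K) \<omega>)\<^sup>2)"
    by (auto simp: SE power2_eq_square algebra_simps)
  finally show ?case using m le by simp
qed

lemma increment_mean_variance:
  assumes "0 \<le> s" "s \<le> t"
  shows "has_bochner_integral M (\<lambda>\<omega>. B t \<omega> - B s \<omega>) 0"
    and "has_bochner_integral M (\<lambda>\<omega>. (B t \<omega> - B s \<omega>)\<^sup>2) (t - s)"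
proof -
  have "has_bochner_integral M (\<lambda>\<omega>. B t \<omega> - B s \<omega>) 0 \<and> has_bochner_integral M (\<lambda>\<omega>. (B t \<omega> - B s \<omega>)\<^sup>2) (t - s)"
  proof (cases "s = t")
    case False
    then have st: "s < t" using assms by simp
    note D = B_normal[OF assms(1) st]
    let ?q = "sqrt (t - s)"
    have q: "0 < ?q" using st by simp
    note n1 = normal_moment_odd[OF q, of 0 0] and n2 = normal_moment_even[OF q, of 0 1]
    have "integrable M (\<lambda>\<omega>. B t \<omega> - B s \<omega>)"
      by (subst distributed_integrable[OF D, of "\<lambda>x. x", symmetric])
        (use n1 in \<open>auto simp: has_bochner_integral_iff\<close>)
    moreover have "expectation (\<lambda>\<omega>. B t \<omega> - B s \<omega>) = 0"
      by (subst distributed_integral[OF D, of "\<lambda>x. x", symmetric])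
        (use n1 in \<open>auto simp: has_bochner_integral_iff\<close>)
    moreover have "integrable M (\<lambda>\<omega>. (B t \<omega> - B s \<omega>)\<^sup>2)"
      by (subst distributed_integrable[OF D, of "\<lambda>x. x\<^sup>2", symmetric])
        (use n2 in \<open>auto simp: has_bochner_integral_iff\<close>)
    moreover have "expectation (\<lambda>\<omega>. (B t \<omega> - B s \<omega>)\<^sup>2) = t - s"
      by (subst distributed_integral[OF D, of "\<lambda>x. x\<^sup>2", symmetric])
        (use n2 st in \<open>auto simp: has_bochner_integral_iff fact_numeral\<close>)
    ultimately show ?thesis by (simp add: has_bochner_integral_iff)
  qed (simp add: has_bochner_integral_zero)
  then show "has_bochner_integral M (\<lambda>\<omega>. B t \<omega> - B s \<omega>) 0"
    and "has_bochner_integral M (\<lambda>\<omega>. (B t \<omega> - B s \<omega>)\<^sup>2) (t - s)" by auto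
qed

text \<open>Tilting turns the density into a normal density with mean \<open>c * (t - s)\<close>,
  whose mass and mean give the two moments. The one with the additional factor
  \<open>B t - B s\<close> serves the cross term in the variance of the exponential
  remainder.\<close>

lemma increment_exp_moments:
  assumes "0 \<le> s" "s \<le> t"
  shows "has_bochner_integral M (\<lambda>\<omega>. exp (c * (B t \<omega> - B s \<omega>))) (exp (c\<^sup>2 * (t - s) / 2))"
    and "has_bochner_integral M (\<lambda>\<omega>. (B t \<omega> - B s \<omega>) * exp (c * (B t \<omega> - B s \<omega>)))
           (c * (t - s) * exp (c\<^sup>2 * (t - s) / 2))"
proof -
  have "has_bochner_integral M (\<lambda>\<omega>. exp (c * (B t \<omega> - B s \<omega>))) (exp (c\<^sup>2 * (t - s) / 2)) \<and>
    has_bochner_integral M (\<lambda>\<omega>. (B t \<omega> - B s \<omega>) * exp (c * (B t \<omega> - B s \<omega>)))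
           (c * (t - s) * exp (c\<^sup>2 * (t - s) / 2))"
  proof (cases "s = t")
    case False
    then have st: "s < t" using assms by simp
    note D = B_normal[OF assms(1) st]
    let ?q = "sqrt (t - s)"
    have q: "0 < ?q" using st by simp
    have q2: "?q\<^sup>2 = t - s" using st by simp
    have n0: "has_bochner_integral lborel (normal_density m ?q) 1" for m
      using integrable_normal_density[OF q] integral_normal_density[OF q] by (simp add: has_bochner_integral_iff)
    have n1: "has_bochner_integral lborel (\<lambda>x. normal_density 0 ?q x * exp (c * x)) (exp (c\<^sup>2 * (t - s) / 2))"
      unfolding normal_density_mult_exp[OF q]
      using has_bochner_integral_mult_right[OF n0[of "c * ?q\<^sup>2"], of "exp (c\<^sup>2 * ?q\<^sup>2 / 2)"] unfolding q2
      by simp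
    have e: "normal_density 0 ?q x * (x * exp (c * x)) = exp (c\<^sup>2 * ?q\<^sup>2 / 2) * (normal_density (c * ?q\<^sup>2) ?q x * x)" for x
      using normal_density_mult_exp[OF q, of x c] by (simp add: mult_ac)
    have n2: "has_bochner_integral lborel (\<lambda>x. normal_density 0 ?q x * (x * exp (c * x))) (c * (t - s) * exp (c\<^sup>2 * (t - s) / 2))"
      unfolding e
      using has_bochner_integral_mult_right[OF normal_moment_nz_1[OF q, of "c * ?q\<^sup>2"], of "exp (c\<^sup>2 * ?q\<^sup>2 / 2)"] unfolding q2
      by (simp add: mult_ac)
    have "integrable M (\<lambda>\<omega>. exp (c * (B t \<omega> - B s \<omega>)))"
      by (subst distributed_integrable[OF D, of "\<lambda>x. exp (c * x)", symmetric])
        (use n1 in \<open>auto simp: has_bochner_integral_iff\<close>)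
    moreover have "expectation (\<lambda>\<omega>. exp (c * (B t \<omega> - B s \<omega>))) = exp (c\<^sup>2 * (t - s) / 2)"
      by (subst distributed_integral[OF D, of "\<lambda>x. exp (c * x)", symmetric])
        (use n1 in \<open>auto simp: has_bochner_integral_iff\<close>)
    moreover have "integrable M (\<lambda>\<omega>. (B t \<omega> - B s \<omega>) * exp (c * (B t \<omega> - B s \<omega>)))"
      by (subst distributed_integrable[OF D, of "\<lambda>x. x * exp (c * x)", symmetric])
        (use n2 in \<open>auto simp: has_bochner_integral_iff\<close>)
    moreover have "expectation (\<lambda>\<omega>. (B t \<omega> - B s \<omega>) * exp (c * (B t \<omega> - B s \<omega>))) = c * (t - s) * exp (c\<^sup>2 * (t - s) / 2)"
      by (subst distributed_integral[OF D, of "\<lambda>x. x * exp (c * x)", symmetric])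
        (use n2 in \<open>auto simp: has_bochner_integral_iff\<close>)
    ultimately show ?thesis by (simp add: has_bochner_integral_iff)
  qed (auto simp: has_bochner_integral_iff prob_space)
  then show "has_bochner_integral M (\<lambda>\<omega>. exp (c * (B t \<omega> - B s \<omega>))) (exp (c\<^sup>2 * (t - s) / 2))"
    and "has_bochner_integral M (\<lambda>\<omega>. (B t \<omega> - B s \<omega>) * exp (c * (B t \<omega> - B s \<omega>)))
           (c * (t - s) * exp (c\<^sup>2 * (t - s) / 2))" by auto
qed

text \<open>The exponential in \<open>\<phi>\<close> is one step of the exponential martingale;
  removing its first-order part \<open>1 + \<sigma> * x\<close> leaves an error of mean 0 whose
  variance \<open>exp y - 1 - y\<close>, with \<open>y = \<sigma>\<^sup>2 * (t - s)\<close>, is of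
  second order in the step. Orthogonal errors over a grid of mesh \<open>h\<close> thus add up to a
  variance of order \<open>h\<close> only.\<close>

lemma exp_remainder_moments:
  fixes \<sigma> :: real
  assumes "0 \<le> s" "s \<le> t"
  defines "\<phi> \<equiv> \<lambda>x. exp (\<sigma> * x - \<sigma>\<^sup>2 * (t - s) / 2) - 1 - \<sigma> * x"
  shows "has_bochner_integral M (\<lambda>\<omega>. \<phi> (B t \<omega> - B s \<omega>)) 0"
    and "has_bochner_integral M (\<lambda>\<omega>. (\<phi> (B t \<omega> - B s \<omega>))\<^sup>2) (exp (\<sigma>\<^sup>2 * (t - s)) - 1 - \<sigma>\<^sup>2 * (t - s))"
proof -
  let ?d = "\<lambda>\<omega>. B t \<omega> - B s \<omega>" and ?e = "exp (- (\<sigma>\<^sup>2 * (t - s) / 2))"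
  have a: "exp (\<sigma> * x - \<sigma>\<^sup>2 * (t - s) / 2) = ?e * exp (\<sigma> * x)" for x
    by (simp flip: exp_add)
  note e1 = increment_exp_moments(1)[OF assms(1,2), of \<sigma>]
    and e2 = increment_exp_moments(1)[OF assms(1,2), of "2 * \<sigma>"]
    and e3 = increment_exp_moments(2)[OF assms(1,2), of \<sigma>]
    and m = increment_mean_variance[OF assms(1,2)]
  have c: "has_bochner_integral M (\<lambda>\<omega>. x) x" for x :: real
    by (simp add: has_bochner_integral_iff prob_space)
  have "has_bochner_integral M (\<lambda>\<omega>. ?e * exp (\<sigma> * ?d \<omega>) - 1 - \<sigma> * ?d \<omega>) (?e * exp (\<sigma>\<^sup>2 * (t - s) / 2) - 1 - \<sigma> * 0)"
    by (intro has_bochner_integral_diff has_bochner_integral_mult_right e1 c m)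
  then show "has_bochner_integral M (\<lambda>\<omega>. \<phi> (B t \<omega> - B s \<omega>)) 0"
    unfolding \<phi>_def a by (simp flip: exp_add)
  have "has_bochner_integral M (\<lambda>\<omega>. ?e * ?e * exp (2 * \<sigma> * ?d \<omega>) + 1 + \<sigma>\<^sup>2 * (?d \<omega>)\<^sup>2 - 2 * ?e * exp (\<sigma> * ?d \<omega>)
       - 2 * \<sigma> * ?e * (?d \<omega> * exp (\<sigma> * ?d \<omega>)) + 2 * \<sigma> * ?d \<omega>)
     (?e * ?e * exp ((2 * \<sigma>)\<^sup>2 * (t - s) / 2) + 1 + \<sigma>\<^sup>2 * (t - s) - 2 * ?e * exp (\<sigma>\<^sup>2 * (t - s) / 2)
       - 2 * \<sigma> * ?e * (\<sigma> * (t - s) * exp (\<sigma>\<^sup>2 * (t - s) / 2)) + 2 * \<sigma> * 0)" (is "has_bochner_integral M ?f ?x")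
    by (intro has_bochner_integral_add has_bochner_integral_diff has_bochner_integral_mult_right e1 e2 e3 c m)
  moreover have "?f = (\<lambda>\<omega>. (\<phi> (?d \<omega>))\<^sup>2)"
  proof
    fix \<omega>
    define x where "x = ?d \<omega>"
    have b: "exp (2 * \<sigma> * x) = exp (\<sigma> * x) * exp (\<sigma> * x)"
      by (simp flip: exp_add)
    show "?f \<omega> = (\<phi> (?d \<omega>))\<^sup>2"
      unfolding \<phi>_def x_def[symmetric] a b by (simp add: power2_eq_square algebra_simps)
  qed
  moreover have "?x = exp (\<sigma>\<^sup>2 * (t - s)) - 1 - \<sigma>\<^sup>2 * (t - s)"
  proof -
    have a: "?e * exp (\<sigma>\<^sup>2 * (t - s) / 2) = 1" by (simp flip: exp_add)
    have b: "?e * ?e * exp ((2 * \<sigma>)\<^sup>2 * (t - s) / 2) = exp (\<sigma>\<^sup>2 * (t - s))"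
      by (simp flip: exp_add)
    have "?x = exp (\<sigma>\<^sup>2 * (t - s)) + 1 + \<sigma>\<^sup>2 * (t - s) - 2 * (?e * exp (\<sigma>\<^sup>2 * (t - s) / 2))
       - 2 * \<sigma>\<^sup>2 * (t - s) * (?e * exp (\<sigma>\<^sup>2 * (t - s) / 2))"
      unfolding b by (simp add: power2_eq_square)
    then show ?thesis unfolding a by simp
  qed
  ultimately show "has_bochner_integral M (\<lambda>\<omega>. (\<phi> (B t \<omega> - B s \<omega>))\<^sup>2) (exp (\<sigma>\<^sup>2 * (t - s)) - 1 - \<sigma>\<^sup>2 * (t - s))"
    by (simp only:)
qed

end

section \<open>Elementary integrals and the Lenglart inequality\<close>

text \<open>Rounding time down to a dyadic grid leaves countably many time values, for which joint
  measurability is immediate; path continuity makes the rounded processes converge. The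
  \<open>max 0\<close> extends the process to negative times, about which nothing is
  assumed.\<close>

lemma continuous_process_jointly_measurable:
  fixes H :: "real \<Rightarrow> 'w \<Rightarrow> real"
  assumes m: "\<And>t. 0 \<le> t \<Longrightarrow> H t \<in> borel_measurable M"
    and c: "\<And>\<omega>. \<omega> \<in> space M \<Longrightarrow> continuous_on {0..} (\<lambda>t. H t \<omega>)"
  shows "(\<lambda>(s, \<omega>). H (max 0 s) \<omega>) \<in> borel_measurable (borel \<Otimes>\<^sub>M M)"
proof (rule borel_measurable_LIMSEQ_metric)
  define r where "r n s = max 0 (real_of_int \<lfloor>2 ^ n * s\<rfloor> / 2 ^ n)" for n :: nat and s :: real
  show "(\<lambda>(s, \<omega>). H (r n s) \<omega>) \<in> borel_measurable (borel \<Otimes>\<^sub>M M)" for n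
  proof -
    have "(\<lambda>x. H (max 0 (real_of_int i / 2 ^ n)) (snd x)) \<in> borel_measurable (borel \<Otimes>\<^sub>M M)" for i
      by (rule measurable_compose[OF measurable_snd m]) simp
    moreover have "(\<lambda>x. \<lfloor>2 ^ n * (fst x :: real)\<rfloor>) \<in> measurable (borel \<Otimes>\<^sub>M M) (count_space UNIV)"
      by measurable
    ultimately have "(\<lambda>x. H (max 0 (real_of_int \<lfloor>2 ^ n * (fst x :: real)\<rfloor> / 2 ^ n)) (snd x)) \<in> borel_measurable (borel \<Otimes>\<^sub>M M)"
      by (rule measurable_compose_countable[where f="\<lambda>i x. H (max 0 (real_of_int i / 2 ^ n)) (snd x)"])
    then show ?thesis by (simp add: r_def case_prod_beta')
  qed
  fix x :: "real \<times> 'w" assume x: "x \<in> space (borel \<Otimes>\<^sub>M M)"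
  obtain s \<omega> where [simp]: "x = (s, \<omega>)" by (cases x)
  have "\<omega> \<in> space M" using x by (simp add: space_pair_measure)
  from c[OF this] have c: "continuous_on {0..} (\<lambda>t. H t \<omega>)" .
  have "(\<lambda>n. real_of_int \<lfloor>2 ^ n * s\<rfloor> / 2 ^ n) \<longlonglongrightarrow> s"
  proof (rule tendsto_sandwich)
    show "\<forall>\<^sub>F n in sequentially. s - (1 / 2) ^ n \<le> real_of_int \<lfloor>2 ^ n * s\<rfloor> / 2 ^ n"
    proof (intro always_eventually allI)
      fix n :: nat
      have "2 ^ n * s - 1 \<le> real_of_int \<lfloor>2 ^ n * s\<rfloor>" by linarith
      then have "(2 ^ n * s - 1) / 2 ^ n \<le> real_of_int \<lfloor>2 ^ n * s\<rfloor> / 2 ^ n"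
        by (intro divide_right_mono) auto
      then show "s - (1 / 2) ^ n \<le> real_of_int \<lfloor>2 ^ n * s\<rfloor> / 2 ^ n"
        by (simp add: diff_divide_distrib power_one_over)
    qed
    show "\<forall>\<^sub>F n in sequentially. real_of_int \<lfloor>2 ^ n * s\<rfloor> / 2 ^ n \<le> s"
      by (intro always_eventually allI) (simp add: field_simps)
    have "(\<lambda>n. s - (1 / 2) ^ n) \<longlonglongrightarrow> s - 0"
      by (intro tendsto_diff tendsto_const LIMSEQ_power_zero) simp
    then show "(\<lambda>n. s - (1 / 2) ^ n) \<longlonglongrightarrow> s" by simp
  qed simp
  then have "(\<lambda>n. r n s) \<longlonglongrightarrow> max 0 s"
    unfolding r_def by (intro tendsto_max tendsto_const)
  then have "(\<lambda>n. H (r n s) \<omega>) \<longlonglongrightarrow> H (max 0 s) \<omega>"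
    by (rule continuous_on_tendsto_compose[OF c]) (auto simp: r_def)
  then show "(\<lambda>n. (case x of (s, \<omega>) \<Rightarrow> H (r n s) \<omega>)) \<longlonglongrightarrow> (case x of (s, \<omega>) \<Rightarrow> H (max 0 s) \<omega>)"
    by simp
qed

abbreviation sq_int :: "(real \<Rightarrow> 'w \<Rightarrow> real) \<Rightarrow> real \<Rightarrow> real \<Rightarrow> 'w \<Rightarrow> ennreal" where
  "sq_int H a b \<omega> \<equiv> (\<integral>\<^sup>+s\<in>{a..b}. ennreal ((H s \<omega>)\<^sup>2) \<partial>lborel)"

lemma sq_int_max:
  "0 \<le> a \<Longrightarrow> sq_int (\<lambda>s. H (max 0 s)) a b \<omega> = sq_int H a b \<omega>"
  by (intro nn_integral_cong) (auto split: split_indicator simp: max_absorb2)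

lemma sq_int_measurable:
  assumes "0 \<le> a" and "(\<lambda>(s, \<omega>). H (max 0 s) \<omega>) \<in> borel_measurable (borel \<Otimes>\<^sub>M M)"
  shows "sq_int H a b \<in> borel_measurable M"
proof -
  interpret sigma_finite_measure lborel by (rule sigma_finite_lborel)
  have [measurable]: "(\<lambda>(\<omega>, s). H (max 0 s) \<omega>) \<in> borel_measurable (M \<Otimes>\<^sub>M lborel)"
    using measurable_pair_swap[OF assms(2)] by (simp add: case_prod_beta')
  have "sq_int (\<lambda>s. H (max 0 s)) a b \<in> borel_measurable M"
    by measurable
  then show ?thesis by (simp add: sq_int_max[OF assms(1)])
qed

lemma jointly_measurable_path:
  assumes "(\<lambda>(s, \<omega>). H (max 0 s) \<omega>) \<in> borel_measurable (borel \<Otimes>\<^sub>M M)" "\<omega> \<in> space M"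
  shows "(\<lambda>s. H (max 0 s) \<omega>) \<in> borel_measurable borel"
proof -
  have "(\<lambda>s. (s, \<omega>)) \<in> measurable borel (borel \<Otimes>\<^sub>M M)"
    using assms(2) by measurable
  from measurable_compose[OF this assms(1)] show ?thesis by simp
qed

text \<open>The second process is integrated over the larger interval \<open>{0..b'}\<close>, so
  that one quantity bounds the brackets over all subintervals at once; later it is the approximation
  error up to a fixed integer horizon.\<close>

lemma sq_int_triangle:
  assumes a: "0 \<le> a" and b: "b \<le> b'"
    and h: "(\<lambda>s. h (max 0 s) \<omega>) \<in> borel_measurable borel" and h': "(\<lambda>s. h' (max 0 s) \<omega>) \<in> borel_measurable borel"
  shows "sq_int (\<lambda>s \<omega>. h s \<omega> + h' s \<omega>) a b \<omega> \<le> 2 * sq_int h a b \<omega> + 2 * sq_int h' 0 b' \<omega>"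
proof -
  let ?h = "\<lambda>s. h (max 0 s)" and ?h' = "\<lambda>s. h' (max 0 s)"
  have "sq_int (\<lambda>s \<omega>. ?h s \<omega> + ?h' s \<omega>) a b \<omega>
      \<le> (\<integral>\<^sup>+s. 2 * (ennreal ((?h s \<omega>)\<^sup>2) * indicator {a..b} s) + 2 * (ennreal ((?h' s \<omega>)\<^sup>2) * indicator {0..b'} s) \<partial>lborel)"
  proof (rule nn_integral_mono)
    fix s
    have "0 \<le> (?h s \<omega> - ?h' s \<omega>)\<^sup>2" by simp
    then have "(?h s \<omega> + ?h' s \<omega>)\<^sup>2 \<le> 2 * (?h s \<omega>)\<^sup>2 + 2 * (?h' s \<omega>)\<^sup>2"
      by (simp add: power2_eq_square algebra_simps)
    then have "ennreal ((?h s \<omega> + ?h' s \<omega>)\<^sup>2) \<le> ennreal (2 * (?h s \<omega>)\<^sup>2 + 2 * (?h' s \<omega>)\<^sup>2)"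
      by (rule ennreal_leI)
    also have "\<dots> = 2 * ennreal ((?h s \<omega>)\<^sup>2) + 2 * ennreal ((?h' s \<omega>)\<^sup>2)"
      by (simp add: ennreal_plus ennreal_mult)
    finally show "ennreal ((?h s \<omega> + ?h' s \<omega>)\<^sup>2) * indicator {a..b} s
        \<le> 2 * (ennreal ((?h s \<omega>)\<^sup>2) * indicator {a..b} s) + 2 * (ennreal ((?h' s \<omega>)\<^sup>2) * indicator {0..b'} s)"
      using a b by (auto split: split_indicator)
  qed
  also have "\<dots> = 2 * sq_int ?h a b \<omega> + 2 * sq_int ?h' 0 b' \<omega>"
    using h h' by (subst nn_integral_add) (auto simp: nn_integral_cmult)
  finally show ?thesis using a sq_int_max[OF a, of h] sq_int_max[of 0 h']
    by (simp add: sq_int_max[OF a, of "\<lambda>s \<omega>. h s \<omega> + h' s \<omega>"])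
qed

section \<open>Lenglart's inequality for elementary integrals\<close>

context brownian_filtration
begin

text \<open>Stopping the coefficients as soon as the sum reaches \<open>\<epsilon>\<close> or its bracket would exceed \<open>\<delta>\<close> makes them
  bounded, so no integrability of \<open>\<xi>\<close> is needed, and the stopped sum still exceeds \<open>\<epsilon>\<close> on the event;
  Chebyshev's inequality then applies without a maximal inequality.\<close>

lemma discrete_lenglart:
  fixes g :: "nat \<Rightarrow> real" and \<xi> :: "nat \<Rightarrow> 'w \<Rightarrow> real"
  assumes g: "0 \<le> g 0" "\<And>j. j < K \<Longrightarrow> g j \<le> g (Suc j)"
    and xi: "\<And>j. j < K \<Longrightarrow> \<xi> j \<in> borel_measurable (F (g j))"
    and pos: "0 < \<epsilon>" "0 \<le> \<delta>"
  defines "S \<equiv> \<lambda>m \<omega>. (\<Sum>j<m. \<xi> j \<omega> * (B (g (Suc j)) \<omega> - B (g j) \<omega>))"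
    and "Q \<equiv> \<lambda>m \<omega>. (\<Sum>j<m. (\<xi> j \<omega>)\<^sup>2 * (g (Suc j) - g j))"
  shows "ennreal (\<epsilon>\<^sup>2) * emeasure M {\<omega> \<in> space M. \<exists>m\<le>K. \<epsilon> \<le> \<bar>S m \<omega>\<bar> \<and> Q m \<omega> \<le> \<delta>}
    \<le> (\<integral>\<^sup>+\<omega>. ennreal (min (Q K \<omega>) \<delta>) \<partial>M)"
proof -
  define E where "E = {\<omega> \<in> space M. \<exists>m\<le>K. \<epsilon> \<le> \<bar>S m \<omega>\<bar> \<and> Q m \<omega> \<le> \<delta>}"
  \<comment> \<open>The stopping is predictable: \<open>Q (Suc j)\<close> involves only coefficients
    with index at most \<open>j\<close> and is known at time \<open>g j\<close>. The clause
    \<open>g j < g (Suc j)\<close> discards cells of length 0, on which a bounded bracket says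
    nothing about the size of \<open>\<xi> j\<close>.\<close>
  define \<zeta> where "\<zeta> j \<omega> = (if (\<forall>i\<le>j. \<bar>S i \<omega>\<bar> < \<epsilon>) \<and> Q (Suc j) \<omega> \<le> \<delta> \<and> g j < g (Suc j) then \<xi> j \<omega> else 0)" for j \<omega>
  define T where "T \<omega> = (\<Sum>j<K. \<zeta> j \<omega> * (B (g (Suc j)) \<omega> - B (g j) \<omega>))" for \<omega>
  have mono: "i \<le> j \<Longrightarrow> j \<le> K \<Longrightarrow> g i \<le> g j" for i j
  proof (induction rule: dec_induct)
    case (step n) then show ?case using g(2)[of n] by simp
  qed simp
  have gpos: "i \<le> K \<Longrightarrow> 0 \<le> g i" for i using mono[of 0 i] g(1) by simp
  have xiF: "\<xi> i \<in> borel_measurable (F (g j))" if "i \<le> j" "j < K" for i j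
    using that by (intro measurable_F_mono[OF xi]) (auto intro: mono gpos)
  have BF: "B (g i) \<in> borel_measurable (F (g j))" if "i \<le> j" "j \<le> K" for i j
    using that by (intro measurable_F_mono[OF B_adapted]) (auto intro: mono gpos)
  have SF: "S i \<in> borel_measurable (F (g j))" if "i \<le> j" "j < K" for i j
    unfolding S_def using that
    by (intro borel_measurable_sum borel_measurable_times borel_measurable_diff xiF BF) auto
  have QF: "Q (Suc j) \<in> borel_measurable (F (g j))" if "j < K" for j
    unfolding Q_def using that
    by (intro borel_measurable_sum borel_measurable_times borel_measurable_power borel_measurable_const xiF) auto
  have zF: "\<zeta> j \<in> borel_measurable (F (g j))" if "j < K" for j
  proof -
    note [measurable] = QF[OF that] xi[OF that]
    have [measurable]: "Measurable.pred (F (g j)) (\<lambda>\<omega>. \<forall>i\<in>{..j}. \<bar>S i \<omega>\<bar> < \<epsilon>)"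
      by (rule pred_intros_finite(3)) (use SF[OF _ that] in auto)
    have "\<zeta> j = (\<lambda>\<omega>. if (\<forall>i\<in>{..j}. \<bar>S i \<omega>\<bar> < \<epsilon>) \<and> Q (Suc j) \<omega> \<le> \<delta> \<and> g j < g (Suc j) then \<xi> j \<omega> else 0)"
      by (simp add: \<zeta>_def fun_eq_iff)
    then show ?thesis by simp
  qed
  have z_sum: "(\<Sum>j<m. (\<zeta> j \<omega>)\<^sup>2 * (g (Suc j) - g j)) \<le> Q m \<omega>" if "m \<le> K" for m \<omega>
    unfolding Q_def using that g(2) by (intro sum_mono) (auto simp: \<zeta>_def)
  \<comment> \<open>Either \<open>Q (Suc m)\<close> is still within \<open>\<delta>\<close> and
    dominates the stopped bracket, or the last coefficient has been stopped and adds
    nothing.\<close>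
  have z_delta: "(\<Sum>j<m. (\<zeta> j \<omega>)\<^sup>2 * (g (Suc j) - g j)) \<le> \<delta>" if "m \<le> K" for m \<omega>
    using that
  proof (induction m)
    case (Suc m)
    show ?case
    proof (cases "Q (Suc m) \<omega> \<le> \<delta>")
      case True then show ?thesis using z_sum[OF Suc.prems, of \<omega>] by simp
    next
      case False
      then have "\<zeta> m \<omega> = 0" by (simp add: \<zeta>_def)
      then show ?thesis using Suc by simp
    qed
  qed (simp add: pos)
  have zb: "(\<zeta> j \<omega>)\<^sup>2 \<le> \<delta> / (g (Suc j) - g j)" if j: "j < K" for j \<omega>
  proof (cases "g j < g (Suc j)")
    case True
    have "(\<zeta> j \<omega>)\<^sup>2 * (g (Suc j) - g j) \<le> (\<Sum>j<K. (\<zeta> j \<omega>)\<^sup>2 * (g (Suc j) - g j))"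
      using j g(2) by (intro member_le_sum[where f="\<lambda>j. (\<zeta> j \<omega>)\<^sup>2 * (g (Suc j) - g j)"]) auto
    also have "\<dots> \<le> \<delta>" by (rule z_delta) simp
    finally show ?thesis using True by (simp add: field_simps)
  next
    case False
    then have "\<zeta> j \<omega> = 0" by (simp add: \<zeta>_def)
    then show ?thesis using pos g(2)[OF j] by simp
  qed
  have z2: "integrable M (\<lambda>\<omega>. (\<zeta> j \<omega>)\<^sup>2)" if "j < K" for j
    by (rule integrable_const_bound[where B="\<delta> / (g (Suc j) - g j)"]) (use zb measurable_F[OF zF] that in auto)
  have "has_bochner_integral M (\<lambda>\<omega>. (T \<omega>)\<^sup>2) (\<Sum>j<K. expectation (\<lambda>\<omega>. (\<zeta> j \<omega>)\<^sup>2) * (g (Suc j) - g j))"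
    unfolding T_def
    using orthogonal_increments[of g K \<zeta> "\<lambda>_ x. x" "\<lambda>j. g (Suc j) - g j", OF g zF z2]
      increment_mean_variance gpos g(2) by auto
  moreover have "(\<Sum>j<K. expectation (\<lambda>\<omega>. (\<zeta> j \<omega>)\<^sup>2) * (g (Suc j) - g j)) =
      expectation (\<lambda>\<omega>. \<Sum>j<K. (\<zeta> j \<omega>)\<^sup>2 * (g (Suc j) - g j))"
    using z2 by (subst Bochner_Integration.integral_sum) auto
  moreover have "integrable M (\<lambda>\<omega>. \<Sum>j<K. (\<zeta> j \<omega>)\<^sup>2 * (g (Suc j) - g j))"
    using z2 by (intro Bochner_Integration.integrable_sum) auto
  ultimately have TT: "(\<integral>\<^sup>+\<omega>. ennreal ((T \<omega>)\<^sup>2) \<partial>M) = (\<integral>\<^sup>+\<omega>. ennreal (\<Sum>j<K. (\<zeta> j \<omega>)\<^sup>2 * (g (Suc j) - g j)) \<partial>M)"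
    using g(2) by (subst (1 2) nn_integral_eq_integral) (auto simp: has_bochner_integral_iff intro!: sum_nonneg)
  have Sm: "S m \<in> borel_measurable M" "Q m \<in> borel_measurable M" if "m \<le> K" for m
    unfolding S_def Q_def using that xi[THEN measurable_F] BF[THEN measurable_F]
    by (auto intro!: borel_measurable_sum borel_measurable_times borel_measurable_diff borel_measurable_power B_measurable gpos)
  have Em: "E \<in> sets M"
  proof -
    have "E = (\<Union>m\<in>{..K}. {\<omega> \<in> space M. \<epsilon> \<le> \<bar>S m \<omega>\<bar> \<and> Q m \<omega> \<le> \<delta>})"
      by (auto simp: E_def)
    also have "\<dots> \<in> sets M"
    proof (rule sets.finite_UN)
      fix m assume "m \<in> {..K}"
      then have [measurable]: "S m \<in> borel_measurable M" "Q m \<in> borel_measurable M" using Sm by auto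
      show "{\<omega> \<in> space M. \<epsilon> \<le> \<bar>S m \<omega>\<bar> \<and> Q m \<omega> \<le> \<delta>} \<in> sets M" by measurable
    qed simp
    finally show ?thesis .
  qed
  \<comment> \<open>Let \<open>m\<close> be the first index at which the sum reaches
    \<open>\<epsilon>\<close>. Before \<open>m\<close>, apart from cells of length 0, nothing is
    stopped, because the bracket is monotone and still within \<open>\<delta>\<close> at the later
    index \<open>m'\<close>; from \<open>m\<close> on all coefficients vanish. Hence the complete
    stopped sum \<open>T\<close> equals \<open>S m\<close> and remembers the excursion.\<close>
  have hit: "\<epsilon> \<le> \<bar>T \<omega>\<bar>" if "\<omega> \<in> E" for \<omega>
  proof -
    let ?P = "\<lambda>m. m \<le> K \<and> \<epsilon> \<le> \<bar>S m \<omega>\<bar> \<and> Q m \<omega> \<le> \<delta>"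
    define m where "m = (LEAST m. \<epsilon> \<le> \<bar>S m \<omega>\<bar>)"
    have "\<exists>m\<le>K. \<epsilon> \<le> \<bar>S m \<omega>\<bar> \<and> Q m \<omega> \<le> \<delta>"
      using that unfolding E_def mem_Collect_eq by (rule conjunct2)
    then obtain m' where m': "?P m'" ..
    have m1: "\<epsilon> \<le> \<bar>S m \<omega>\<bar>" unfolding m_def by (rule LeastI[of "\<lambda>m. \<epsilon> \<le> \<bar>S m \<omega>\<bar>" m']) (use m' in simp)
    have m2: "m \<le> m'" unfolding m_def by (rule Least_le) (use m' in simp)
    have m3: "\<bar>S i \<omega>\<bar> < \<epsilon>" if "i < m" for i
      using not_less_Least[OF that[unfolded m_def]] by simp
    have Qmono: "Q i \<omega> \<le> Q m' \<omega>" if "i \<le> m'" for i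
      unfolding Q_def using that m' g(2) by (intro sum_mono2) auto
    have "T \<omega> = (\<Sum>j<m. \<zeta> j \<omega> * (B (g (Suc j)) \<omega> - B (g j) \<omega>))"
      unfolding T_def using m2 m' m1
      by (intro sum.mono_neutral_right) (auto simp: \<zeta>_def not_less)
    also have "\<dots> = S m \<omega>"
      unfolding S_def
    proof (intro sum.cong refl)
      fix j assume j: "j \<in> {..<m}"
      then have "(\<forall>i\<le>j. \<bar>S i \<omega>\<bar> < \<epsilon>)" using m3 by auto
      moreover have "Q (Suc j) \<omega> \<le> \<delta>" using Qmono[of "Suc j"] j m2 m' by auto
      moreover have "g j = g (Suc j)" if "\<not> g j < g (Suc j)" using that g(2)[of j] j m2 m' by simp
      ultimately show "\<zeta> j \<omega> * (B (g (Suc j)) \<omega> - B (g j) \<omega>) = \<xi> j \<omega> * (B (g (Suc j)) \<omega> - B (g j) \<omega>)"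
        by (cases "g j < g (Suc j)") (auto simp: \<zeta>_def)
    qed
    finally show ?thesis using m1 by simp
  qed
  have "ennreal (\<epsilon>\<^sup>2) * emeasure M E = (\<integral>\<^sup>+\<omega>. ennreal (\<epsilon>\<^sup>2) * indicator E \<omega> \<partial>M)"
    by (rule nn_integral_cmult_indicator[OF Em, symmetric])
  also have "\<dots> \<le> (\<integral>\<^sup>+\<omega>. ennreal ((T \<omega>)\<^sup>2) \<partial>M)"
  proof (rule nn_integral_mono)
    fix \<omega>
    show "ennreal (\<epsilon>\<^sup>2) * indicator E \<omega> \<le> ennreal ((T \<omega>)\<^sup>2)"
    proof (cases "\<omega> \<in> E")
      case True
      then have "\<epsilon>\<^sup>2 \<le> (T \<omega>)\<^sup>2" using hit pos by (metis abs_le_square_iff abs_of_pos)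
      then show ?thesis using True by (simp add: ennreal_leI)
    qed simp
  qed
  also have "\<dots> = (\<integral>\<^sup>+\<omega>. ennreal (\<Sum>j<K. (\<zeta> j \<omega>)\<^sup>2 * (g (Suc j) - g j)) \<partial>M)" by (rule TT)
  also have "\<dots> \<le> (\<integral>\<^sup>+\<omega>. ennreal (min (Q K \<omega>) \<delta>) \<partial>M)"
    using z_sum z_delta by (intro nn_integral_mono ennreal_leI) auto
  finally show ?thesis unfolding E_def .
qed

text \<open>Only the behaviour between neighbouring points of \<open>P\<close> is prescribed, so that sums are obtained by
  taking the union of the exceptional sets, without merging partitions. The coefficients need not be
  bounded.\<close>

definition step_integral :: "real set \<Rightarrow> (real \<Rightarrow> 'w \<Rightarrow> real) \<Rightarrow> (real \<Rightarrow> 'w \<Rightarrow> real) \<Rightarrow> bool" where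
  "step_integral P H I \<longleftrightarrow> (\<forall>s t. 0 \<le> s \<longrightarrow> s \<le> t \<longrightarrow> P \<inter> {s<..<t} = {} \<longrightarrow>
     (\<exists>\<xi> \<in> borel_measurable (F s). \<forall>\<omega>\<in>space M.
        (\<forall>u\<in>{s<..t}. H u \<omega> = \<xi> \<omega>) \<and> I t \<omega> - I s \<omega> = \<xi> \<omega> * (B t \<omega> - B s \<omega>)))"

text \<open>\<open>step_integral\<close> determines \<open>H\<close> at positive times and the
  increments of \<open>I\<close>, but neither \<open>H\<close> at time 0 nor \<open>I\<close>
  itself. The separate measurability clauses fill this gap and make brackets and values of
  \<open>I\<close> random variables.\<close>

definition elementary :: "(real \<Rightarrow> 'w \<Rightarrow> real) \<Rightarrow> (real \<Rightarrow> 'w \<Rightarrow> real) \<Rightarrow> bool" where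
  "elementary H I \<longleftrightarrow>
     (\<lambda>(s, \<omega>). H (max 0 s) \<omega>) \<in> borel_measurable (borel \<Otimes>\<^sub>M M) \<and>
     (\<forall>t\<ge>0. I t \<in> borel_measurable M) \<and> (\<exists>P. finite P \<and> step_integral P H I)"

lemma step_integralE:
  assumes "step_integral P H I" "0 \<le> s" "s \<le> t" "P \<inter> {s<..<t} = {}"
  obtains \<xi> where "\<xi> \<in> borel_measurable (F s)"
    "\<And>\<omega> u. \<omega> \<in> space M \<Longrightarrow> u \<in> {s<..t} \<Longrightarrow> H u \<omega> = \<xi> \<omega>"
    "\<And>\<omega>. \<omega> \<in> space M \<Longrightarrow> I t \<omega> - I s \<omega> = \<xi> \<omega> * (B t \<omega> - B s \<omega>)"
proof -
  from assms have "\<exists>\<xi> \<in> borel_measurable (F s). \<forall>\<omega>\<in>space M.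
        (\<forall>u\<in>{s<..t}. H u \<omega> = \<xi> \<omega>) \<and> I t \<omega> - I s \<omega> = \<xi> \<omega> * (B t \<omega> - B s \<omega>)"
    unfolding step_integral_def by simp
  then show ?thesis using that by (elim bexE) simp
qed

lemma elementary_simple:
  assumes t: "0 \<le> \<tau> 0" "\<And>j. j < k \<Longrightarrow> \<tau> j \<le> \<tau> (Suc j)"
    and xi: "\<And>j. j < k \<Longrightarrow> \<xi> j \<in> borel_measurable (F (\<tau> j))"
  shows "elementary (simple_process k \<tau> \<xi>) (simple_integral k \<tau> \<xi> B)"
proof -
  have tpos: "j \<le> k \<Longrightarrow> 0 \<le> \<tau> j" for j
  proof (induction j)
    case (Suc j) then show ?case using t(2)[of j] by simp
  qed (use t in simp)
  have 1: "(\<lambda>(s, \<omega>). simple_process k \<tau> \<xi> (max 0 s) \<omega>) \<in> borel_measurable (borel \<Otimes>\<^sub>M M)"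
  proof -
    have [measurable]: "j < k \<Longrightarrow> \<xi> j \<in> borel_measurable M" for j using xi measurable_F by blast
    have "(\<lambda>x. \<Sum>j<k. \<xi> j (snd x) * indicator {\<tau> j<..\<tau> (Suc j)} (max 0 (fst x))) \<in> borel_measurable (borel \<Otimes>\<^sub>M M)"
      by (rule borel_measurable_sum) measurable
    then show ?thesis by (simp add: simple_process_def case_prod_beta')
  qed
  have 2: "simple_integral k \<tau> \<xi> B t \<in> borel_measurable M" if "0 \<le> t" for t
    unfolding simple_integral_def using xi[THEN measurable_F] tpos that
    by (intro borel_measurable_sum borel_measurable_times borel_measurable_diff B_measurable) auto
  have 3: "\<exists>\<zeta> \<in> borel_measurable (F s). \<forall>\<omega>\<in>space M.
           (\<forall>u\<in>{s<..t}. simple_process k \<tau> \<xi> u \<omega> = \<zeta> \<omega>) \<and>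
           simple_integral k \<tau> \<xi> B t \<omega> - simple_integral k \<tau> \<xi> B s \<omega> = \<zeta> \<omega> * (B t \<omega> - B s \<omega>)"
    if st: "0 \<le> s" "s \<le> t" "(\<tau> ` {..k}) \<inter> {s<..<t} = {}" for s t
  proof (cases "s = t")
    case True
    then show ?thesis by (intro bexI[of _ "\<lambda>_. 0"]) auto
  next
    case False
    then have lt: "s < t" using st by simp
    have gap: "\<tau> j \<le> s \<or> t \<le> \<tau> j" if "j \<le> k" for j
      using st(3) that by (force simp: not_le)
    \<comment> \<open>As no \<open>\<tau> j\<close> lies strictly between \<open>s\<close> and
      \<open>t\<close>, each cell either contains \<open>{s<..t}\<close> or misses it.
      \<open>?J\<close> collects the cells that contain it; summing over \<open>?J\<close> treats
      the empty and the singleton case alike.\<close>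
    let ?J = "{j\<in>{..<k}. \<tau> j \<le> s \<and> t \<le> \<tau> (Suc j)}"
    show ?thesis
    proof (intro bexI[of _ "\<lambda>\<omega>. \<Sum>j\<in>?J. \<xi> j \<omega>"] ballI conjI)
      fix \<omega> u assume "\<omega> \<in> space M" and u: "u \<in> {s<..t}"
      have "\<tau> j < u \<and> u \<le> \<tau> (Suc j) \<longleftrightarrow> \<tau> j \<le> s \<and> t \<le> \<tau> (Suc j)" if "j < k" for j
        using gap[of j] gap[of "Suc j"] u that by auto
      then show "simple_process k \<tau> \<xi> u \<omega> = (\<Sum>j\<in>?J. \<xi> j \<omega>)"
        unfolding simple_process_def sum.inter_filter[OF finite_lessThan]
        by (intro sum.cong) (auto simp: indicator_def)
    next
      fix \<omega> assume "\<omega> \<in> space M"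
      have "\<xi> j \<omega> * (B (min t (\<tau> (Suc j))) \<omega> - B (min t (\<tau> j)) \<omega>) - \<xi> j \<omega> * (B (min s (\<tau> (Suc j))) \<omega> - B (min s (\<tau> j)) \<omega>)
        = (if \<tau> j \<le> s \<and> t \<le> \<tau> (Suc j) then \<xi> j \<omega> * (B t \<omega> - B s \<omega>) else 0)" if "j < k" for j
        using gap[of j] gap[of "Suc j"] that t(2)[OF that] lt
        by (auto simp: min_absorb1 min_absorb2 algebra_simps)
      then show "simple_integral k \<tau> \<xi> B t \<omega> - simple_integral k \<tau> \<xi> B s \<omega> = (\<Sum>j\<in>?J. \<xi> j \<omega>) * (B t \<omega> - B s \<omega>)"
        unfolding simple_integral_def sum_subtractf[symmetric] sum_distrib_right sum.inter_filter[OF finite_lessThan]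
        by (intro sum.cong) auto
    next
      show "(\<lambda>\<omega>. \<Sum>j\<in>?J. \<xi> j \<omega>) \<in> borel_measurable (F s)"
        using xi tpos by (intro borel_measurable_sum measurable_F_mono[of _ "\<tau> _" s]) auto
    qed
  qed
  have "step_integral (\<tau> ` {..k}) (simple_process k \<tau> \<xi>) (simple_integral k \<tau> \<xi> B)"
    unfolding step_integral_def by (intro allI impI 3)
  then show ?thesis unfolding elementary_def
    using 1 2 by (intro conjI exI[of _ "\<tau> ` {..k}"]) auto
qed

text \<open>A coefficient known at time 0 is known at the left end of every cell, and
  \<open>step_integral\<close> imposes no bound on it. This is what later permits
  \<open>- D 0\<close> as a coefficient.\<close>

lemma elementary_add_mult:
  assumes e: "elementary H I" "elementary H' I'"
    and c: "c \<in> borel_measurable (F 0)" "c' \<in> borel_measurable (F 0)"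
  shows "elementary (\<lambda>t \<omega>. c \<omega> * H t \<omega> + c' \<omega> * H' t \<omega>) (\<lambda>t \<omega>. c \<omega> * I t \<omega> + c' \<omega> * I' t \<omega>)"
proof -
  from e obtain P P' where P: "finite P" "finite P'" and H: "step_integral P H I" and H': "step_integral P' H' I'"
    unfolding elementary_def by blast
  have m: "(\<lambda>x. H (max 0 (fst x)) (snd x)) \<in> borel_measurable (borel \<Otimes>\<^sub>M M)"
      "(\<lambda>x. H' (max 0 (fst x)) (snd x)) \<in> borel_measurable (borel \<Otimes>\<^sub>M M)"
      "\<And>t. 0 \<le> t \<Longrightarrow> I t \<in> borel_measurable M" "\<And>t. 0 \<le> t \<Longrightarrow> I' t \<in> borel_measurable M"
    using e by (simp_all add: elementary_def case_prod_beta')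
  note [measurable] = m measurable_F[OF c(1)] measurable_F[OF c(2)]
  have "(\<lambda>x. c (snd x) * H (max 0 (fst x)) (snd x) + c' (snd x) * H' (max 0 (fst x)) (snd x)) \<in> borel_measurable (borel \<Otimes>\<^sub>M M)"
    by measurable
  moreover have "step_integral (P \<union> P') (\<lambda>t \<omega>. c \<omega> * H t \<omega> + c' \<omega> * H' t \<omega>) (\<lambda>t \<omega>. c \<omega> * I t \<omega> + c' \<omega> * I' t \<omega>)"
    unfolding step_integral_def
  proof (intro allI impI)
    fix s t :: real assume st: "0 \<le> s" "s \<le> t" "(P \<union> P') \<inter> {s<..<t} = {}"
    then have d: "P \<inter> {s<..<t} = {}" "P' \<inter> {s<..<t} = {}" by auto
    obtain \<xi> where [measurable]: "\<xi> \<in> borel_measurable (F s)"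
      and 1: "\<And>\<omega> u. \<omega> \<in> space M \<Longrightarrow> u \<in> {s<..t} \<Longrightarrow> H u \<omega> = \<xi> \<omega>"
        "\<And>\<omega>. \<omega> \<in> space M \<Longrightarrow> I t \<omega> - I s \<omega> = \<xi> \<omega> * (B t \<omega> - B s \<omega>)"
      using step_integralE[OF H st(1,2) d(1)] by metis
    obtain \<xi>' where [measurable]: "\<xi>' \<in> borel_measurable (F s)"
      and 2: "\<And>\<omega> u. \<omega> \<in> space M \<Longrightarrow> u \<in> {s<..t} \<Longrightarrow> H' u \<omega> = \<xi>' \<omega>"
        "\<And>\<omega>. \<omega> \<in> space M \<Longrightarrow> I' t \<omega> - I' s \<omega> = \<xi>' \<omega> * (B t \<omega> - B s \<omega>)"
      using step_integralE[OF H' st(1,2) d(2)] by metis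
    note [measurable] = measurable_F_mono[OF c(1) order_refl st(1)] measurable_F_mono[OF c(2) order_refl st(1)]
    have "(\<lambda>\<omega>. c \<omega> * \<xi> \<omega> + c' \<omega> * \<xi>' \<omega>) \<in> borel_measurable (F s)" by measurable
    moreover have "c \<omega> * I t \<omega> + c' \<omega> * I' t \<omega> - (c \<omega> * I s \<omega> + c' \<omega> * I' s \<omega>) = (c \<omega> * \<xi> \<omega> + c' \<omega> * \<xi>' \<omega>) * (B t \<omega> - B s \<omega>)"
      if "\<omega> \<in> space M" for \<omega>
    proof -
      have "c \<omega> * I t \<omega> + c' \<omega> * I' t \<omega> - (c \<omega> * I s \<omega> + c' \<omega> * I' s \<omega>) = c \<omega> * (I t \<omega> - I s \<omega>) + c' \<omega> * (I' t \<omega> - I' s \<omega>)"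
        by (simp add: algebra_simps)
      also have "\<dots> = (c \<omega> * \<xi> \<omega> + c' \<omega> * \<xi>' \<omega>) * (B t \<omega> - B s \<omega>)"
        unfolding 1(2)[OF that] 2(2)[OF that] by (simp add: algebra_simps)
      finally show ?thesis .
    qed
    ultimately show "\<exists>\<zeta> \<in> borel_measurable (F s). \<forall>\<omega>\<in>space M.
           (\<forall>u\<in>{s<..t}. c \<omega> * H u \<omega> + c' \<omega> * H' u \<omega> = \<zeta> \<omega>) \<and>
           c \<omega> * I t \<omega> + c' \<omega> * I' t \<omega> - (c \<omega> * I s \<omega> + c' \<omega> * I' s \<omega>) = \<zeta> \<omega> * (B t \<omega> - B s \<omega>)"
      by (intro bexI[of _ "\<lambda>\<omega>. c \<omega> * \<xi> \<omega> + c' \<omega> * \<xi>' \<omega>"] ballI conjI) (simp_all only: 1(1) 2(1))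
  qed
  ultimately show ?thesis
    unfolding elementary_def using P m(3,4)
    by (intro conjI exI[of _ "P \<union> P'"]) (simp_all add: case_prod_beta')
qed

text \<open>On the grid made of \<open>a\<close>, \<open>b\<close>, the times in \<open>Q\<close>
  and the partition points in between, increments of \<open>I\<close> are discrete sums and
  \<open>sq_int\<close> is the discrete bracket. The bound does not depend on \<open>Q\<close>,
  which lets dyadic sets grow later, and it keeps the minimum with \<open>\<delta>\<close>, so that
  outcomes with a small bracket contribute little.\<close>

lemma elementary_lenglart:
  assumes e: "elementary H I" and ab: "0 \<le> a" "a \<le> b" and Q: "finite Q" "Q \<subseteq> {a..b}"
    and pos: "0 < \<epsilon>" "0 \<le> \<delta>"
  defines "E \<equiv> {\<omega> \<in> space M. \<exists>q\<in>Q. \<epsilon> \<le> \<bar>I q \<omega> - I a \<omega>\<bar> \<and> sq_int H a q \<omega> \<le> ennreal \<delta>}"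
  shows "E \<in> sets M"
    and "ennreal (\<epsilon>\<^sup>2) * emeasure M E \<le> (\<integral>\<^sup>+\<omega>. min (sq_int H a b \<omega>) (ennreal \<delta>) \<partial>M)"
proof -
  from e obtain P where P: "finite P" and H: "step_integral P H I"
    and m: "(\<lambda>(s, \<omega>). H (max 0 s) \<omega>) \<in> borel_measurable (borel \<Otimes>\<^sub>M M)"
    and I: "\<forall>t\<ge>0. I t \<in> borel_measurable M"
    unfolding elementary_def by blast
  show E: "E \<in> sets M"
  proof -
    have "E = (\<Union>q\<in>Q. {\<omega> \<in> space M. \<epsilon> \<le> \<bar>I q \<omega> - I a \<omega>\<bar> \<and> sq_int H a q \<omega> \<le> ennreal \<delta>})"
      by (auto simp: E_def)
    also have "\<dots> \<in> sets M"
    proof (rule sets.finite_UN[OF Q(1)])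
      fix q assume "q \<in> Q"
      then have [measurable]: "I q \<in> borel_measurable M" "I a \<in> borel_measurable M" "sq_int H a q \<in> borel_measurable M"
        using Q ab sq_int_measurable[OF ab(1) m] I by auto
      show "{\<omega> \<in> space M. \<epsilon> \<le> \<bar>I q \<omega> - I a \<omega>\<bar> \<and> sq_int H a q \<omega> \<le> ennreal \<delta>} \<in> sets M"
        by measurable
    qed
    finally show ?thesis .
  qed
  define A where "A = insert a (insert b (Q \<union> (P \<inter> {a..b})))"
  define R where "R = sorted_list_of_set A"
  have A: "finite A" "A \<subseteq> {a..b}" "a \<in> A" "b \<in> A" "Q \<subseteq> A" using P Q ab by (auto simp: A_def)
  have R: "set R = A" "sorted_wrt (<) R" using A by (auto simp: R_def)
  define g where "g j = R ! j" for j
  define K where "K = length R - 1"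
  have len: "0 < length R" using R A by (cases R) auto
  have gA: "g j \<in> A" if "j \<le> K" for j
  proof -
    have "j < length R" using that len unfolding K_def by linarith
    then show ?thesis using R(1) nth_mem[of j R] by (simp add: g_def)
  qed
  have gless: "g i < g j" if "i < j" "j \<le> K" for i j
    using sorted_wrt_nth_less[OF R(2)] that len by (auto simp: g_def K_def)
  have Ag: "\<exists>j\<le>K. x = g j" if "x \<in> A" for x
    using that len R(1) by (auto simp: g_def K_def in_set_conv_nth less_Suc_eq_le[symmetric])
  have g0: "g 0 = a"
  proof -
    obtain j where j: "j \<le> K" "a = g j" using Ag A by auto
    show ?thesis using gless[of 0 j] gA[of 0] A j by (cases "j = 0") auto
  qed
  have gK: "g K = b"
  proof -
    obtain j where j: "j \<le> K" "b = g j" using Ag A by auto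
    show ?thesis using gless[of j K] gA[of K] A j by (cases "j = K") auto
  qed
  have gap: "P \<inter> {g j<..<g (Suc j)} = {}" if j: "j < K" for j
  proof (rule ccontr)
    assume "\<not> ?thesis"
    then obtain x where x: "x \<in> P" "g j < x" "x < g (Suc j)" by auto
    then have "x \<in> A" using gA[of j] gA[of "Suc j"] A(2) j by (force simp: A_def)
    then obtain i where i: "i \<le> K" "x = g i" using Ag by auto
    have "j < i" using gless[of i j] x i j by (metis not_less_iff_gr_or_eq order_less_imp_le order.asym)
    moreover have "i < Suc j" using gless[of "Suc j" i] x i j by (metis not_less_iff_gr_or_eq order.asym)
    ultimately show False by simp
  qed
  have "\<exists>\<xi>. \<forall>j. j < K \<longrightarrow> \<xi> j \<in> borel_measurable (F (g j)) \<and>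
      (\<forall>\<omega>\<in>space M. \<forall>u\<in>{g j<..g (Suc j)}. H u \<omega> = \<xi> j \<omega>) \<and>
      (\<forall>\<omega>\<in>space M. I (g (Suc j)) \<omega> - I (g j) \<omega> = \<xi> j \<omega> * (B (g (Suc j)) \<omega> - B (g j) \<omega>))"
  proof (rule choice, intro allI)
    fix j
    show "\<exists>\<xi>. j < K \<longrightarrow> \<xi> \<in> borel_measurable (F (g j)) \<and>
      (\<forall>\<omega>\<in>space M. \<forall>u\<in>{g j<..g (Suc j)}. H u \<omega> = \<xi> \<omega>) \<and>
      (\<forall>\<omega>\<in>space M. I (g (Suc j)) \<omega> - I (g j) \<omega> = \<xi> \<omega> * (B (g (Suc j)) \<omega> - B (g j) \<omega>))"
    proof (cases "j < K")
      case True
      have le: "0 \<le> g j" "g j \<le> g (Suc j)"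
        using gA[of j] A ab gless[of j "Suc j"] True by force+
      show ?thesis by (rule step_integralE[OF H le gap[OF True]]) blast
    qed simp
  qed
  then obtain \<xi> where xi: "\<And>j. j < K \<Longrightarrow> \<xi> j \<in> borel_measurable (F (g j))"
    and Hxi: "\<And>j \<omega> u. j < K \<Longrightarrow> \<omega> \<in> space M \<Longrightarrow> u \<in> {g j<..g (Suc j)} \<Longrightarrow> H u \<omega> = \<xi> j \<omega>"
    and Ixi: "\<And>j \<omega>. j < K \<Longrightarrow> \<omega> \<in> space M \<Longrightarrow> I (g (Suc j)) \<omega> - I (g j) \<omega> = \<xi> j \<omega> * (B (g (Suc j)) \<omega> - B (g j) \<omega>)"
    by blast
  let ?S = "\<lambda>m \<omega>. (\<Sum>j<m. \<xi> j \<omega> * (B (g (Suc j)) \<omega> - B (g j) \<omega>))"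
  let ?Q = "\<lambda>m \<omega>. (\<Sum>j<m. (\<xi> j \<omega>)\<^sup>2 * (g (Suc j) - g j))"
  have S: "?S k \<omega> = I (g k) \<omega> - I a \<omega>" if "k \<le> K" "\<omega> \<in> space M" for k \<omega>
    using that
  proof (induction k)
    case (Suc k)
    then show ?case using Ixi[of k \<omega>] by simp
  qed (simp add: g0)
  have QQ: "ennreal (?Q k \<omega>) = sq_int H a (g k) \<omega>" if "k \<le> K" "\<omega> \<in> space M" for k \<omega>
    using that
  proof (induction k)
    case 0
    have "sq_int H a a \<omega> = (\<integral>\<^sup>+s. ennreal ((H a \<omega>)\<^sup>2) * indicator {a} s \<partial>lborel)"
      by (intro nn_integral_cong) (auto split: split_indicator)
    then show ?case by (simp add: g0 nn_integral_cmult)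
  next
    case (Suc k)
    let ?h = "\<lambda>s. ennreal ((H (max 0 s) \<omega>)\<^sup>2)"
    have [measurable]: "(\<lambda>s. H (max 0 s) \<omega>) \<in> borel_measurable borel"
      using jointly_measurable_path[OF m] Suc by auto
    have k: "k < K" using Suc by simp
    have gk: "a \<le> g k" "g k \<le> g (Suc k)" using gA[of k] A gless[of k "Suc k"] k by auto
    have "sq_int H a (g (Suc k)) \<omega> = (\<integral>\<^sup>+s. ?h s * indicator {a..g k} s + ?h s * indicator {g k<..g (Suc k)} s \<partial>lborel)"
      unfolding sq_int_max[OF ab(1), of H, symmetric] using gk
      by (intro nn_integral_cong) (auto split: split_indicator)
    also have "\<dots> = sq_int H a (g k) \<omega> + (\<integral>\<^sup>+s. ?h s * indicator {g k<..g (Suc k)} s \<partial>lborel)"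
      unfolding sq_int_max[OF ab(1), of H, symmetric] by (subst nn_integral_add) auto
    also have "(\<integral>\<^sup>+s. ?h s * indicator {g k<..g (Suc k)} s \<partial>lborel) = (\<integral>\<^sup>+s. ennreal ((\<xi> k \<omega>)\<^sup>2) * indicator {g k<..g (Suc k)} s \<partial>lborel)"
      using Hxi[OF k, of \<omega>] Suc gk ab by (intro nn_integral_cong) (auto split: split_indicator simp: max_absorb2)
    also have "\<dots> = ennreal ((\<xi> k \<omega>)\<^sup>2 * (g (Suc k) - g k))"
      using gk by (subst nn_integral_cmult_indicator) (auto simp: ennreal_mult)
    also have "sq_int H a (g k) \<omega> = ennreal (?Q k \<omega>)" using Suc by simp
    also have "ennreal (?Q k \<omega>) + ennreal ((\<xi> k \<omega>)\<^sup>2 * (g (Suc k) - g k)) = ennreal (?Q (Suc k) \<omega>)"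
    proof -
      have "0 \<le> ?Q k \<omega>"
        using k by (intro sum_nonneg mult_nonneg_nonneg) (auto intro!: less_imp_le[OF gless])
      then show ?thesis using gk by (subst ennreal_plus[symmetric]) auto
    qed
    finally show ?case by simp
  qed
  have Qnn: "0 \<le> ?Q k \<omega>" if "k \<le> K" for k \<omega>
    using that gless by (intro sum_nonneg) (auto simp: less_imp_le)
  have sub: "E \<subseteq> {\<omega> \<in> space M. \<exists>m\<le>K. \<epsilon> \<le> \<bar>?S m \<omega>\<bar> \<and> ?Q m \<omega> \<le> \<delta>}"
  proof safe
    fix \<omega> assume w: "\<omega> \<in> E"
    then show sp: "\<omega> \<in> space M" by (simp add: E_def)
    from w obtain q where q: "q \<in> Q" "\<epsilon> \<le> \<bar>I q \<omega> - I a \<omega>\<bar>" "sq_int H a q \<omega> \<le> ennreal \<delta>" by (auto simp: E_def)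
    then obtain k where k: "k \<le> K" "q = g k" using Ag A by blast
    have "ennreal (?Q k \<omega>) \<le> ennreal \<delta>" unfolding QQ[OF k(1) sp] k(2)[symmetric] by (rule q(3))
    then have "?Q k \<omega> \<le> \<delta>" by (simp only: ennreal_le_iff[OF pos(2)])
    moreover have "\<epsilon> \<le> \<bar>?S k \<omega>\<bar>" unfolding S[OF k(1) sp] k(2)[symmetric] by (rule q(2))
    ultimately show "\<exists>m\<le>K. \<epsilon> \<le> \<bar>?S m \<omega>\<bar> \<and> ?Q m \<omega> \<le> \<delta>" using k(1) by blast
  qed
  have meas: "{\<omega> \<in> space M. \<exists>m\<le>K. \<epsilon> \<le> \<bar>?S m \<omega>\<bar> \<and> ?Q m \<omega> \<le> \<delta>} \<in> sets M"
  proof -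
    have "{\<omega> \<in> space M. \<exists>m\<le>K. \<epsilon> \<le> \<bar>?S m \<omega>\<bar> \<and> ?Q m \<omega> \<le> \<delta>} = (\<Union>m\<in>{..K}. {\<omega> \<in> space M. \<epsilon> \<le> \<bar>?S m \<omega>\<bar> \<and> ?Q m \<omega> \<le> \<delta>})"
      by auto
    also have "\<dots> \<in> sets M"
    proof (rule sets.finite_UN)
      fix k assume k: "k \<in> {..K}"
      have gp: "0 \<le> g j" if "j \<le> K" for j using gA[OF that] A(2) ab by auto
      have "?S k \<in> borel_measurable M" "?Q k \<in> borel_measurable M"
        using k xi[THEN measurable_F]
        by (auto intro!: borel_measurable_sum borel_measurable_times borel_measurable_diff borel_measurable_power B_measurable gp)
      then show "{\<omega> \<in> space M. \<epsilon> \<le> \<bar>?S k \<omega>\<bar> \<and> ?Q k \<omega> \<le> \<delta>} \<in> sets M" by measurable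
    qed simp
    finally show ?thesis .
  qed
  have "ennreal (\<epsilon>\<^sup>2) * emeasure M E \<le> ennreal (\<epsilon>\<^sup>2) * emeasure M {\<omega> \<in> space M. \<exists>m\<le>K. \<epsilon> \<le> \<bar>?S m \<omega>\<bar> \<and> ?Q m \<omega> \<le> \<delta>}"
    by (intro mult_left_mono emeasure_mono sub meas) simp
  also have "\<dots> \<le> (\<integral>\<^sup>+\<omega>. ennreal (min (?Q K \<omega>) \<delta>) \<partial>M)"
    by (rule discrete_lenglart) (use g0 ab gless xi pos in \<open>auto simp: less_imp_le\<close>)
  also have "\<dots> = (\<integral>\<^sup>+\<omega>. min (sq_int H a b \<omega>) (ennreal \<delta>) \<partial>M)"
  proof (rule nn_integral_cong)
    fix \<omega> assume w: "\<omega> \<in> space M"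
    have "ennreal (min x \<delta>) = min (ennreal x) (ennreal \<delta>)" for x
      by (rule min_of_mono[symmetric]) (auto simp: mono_def ennreal_leI)
    then show "ennreal (min (?Q K \<omega>) \<delta>) = min (sq_int H a b \<omega>) (ennreal \<delta>)"
      by (simp only: QQ[OF order_refl w] gK)
  qed
  finally show "ennreal (\<epsilon>\<^sup>2) * emeasure M E \<le> (\<integral>\<^sup>+\<omega>. min (sq_int H a b \<omega>) (ennreal \<delta>) \<partial>M)" .
qed

end

section \<open>Limits of elementary integrals\<close>

text \<open>Mesh and horizon improve together with \<open>n\<close>: the sets are finite, nested and
  exhaust the nonnegative dyadic rationals, so a single index controls both the resolution and the
  time range.\<close>

definition dyadics :: "nat \<Rightarrow> real set" where
  "dyadics n = (\<lambda>m::nat. real m / 2 ^ n) ` {..n * 2 ^ n}"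

lemma finite_dyadics: "finite (dyadics n)"
  by (simp add: dyadics_def)

lemma dyadics_nonneg: "q \<in> dyadics n \<Longrightarrow> 0 \<le> q"
  by (auto simp: dyadics_def)

lemma dyadics_mono: "m \<le> n \<Longrightarrow> dyadics m \<subseteq> dyadics n"
proof
  fix q assume mn: "m \<le> n" and "q \<in> dyadics m"
  then obtain k where k: "k \<le> m * 2 ^ m" "q = real k / 2 ^ m" by (auto simp: dyadics_def)
  obtain d where d: "n = m + d" using mn le_Suc_ex by blast
  have "k * 2 ^ d \<le> n * 2 ^ n"
  proof -
    have "k * 2 ^ d \<le> m * 2 ^ m * 2 ^ d" using k by simp
    also have "\<dots> = m * 2 ^ n" by (simp add: d power_add)
    also have "\<dots> \<le> n * 2 ^ n" using mn by simp
    finally show ?thesis .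
  qed
  moreover have "q = real (k * 2 ^ d) / 2 ^ n" by (simp add: k d power_add)
  ultimately show "q \<in> dyadics n" unfolding dyadics_def by blast
qed

lemma dyadicI: "real m / 2 ^ j \<in> dyadics (j + m)"
proof -
  have "m * 2 ^ m \<le> (j + m) * 2 ^ (j + m)"
    by (intro mult_mono power_increasing) auto
  moreover have "real m / 2 ^ j = real (m * 2 ^ m) / 2 ^ (j + m)" by (simp add: power_add)
  ultimately show ?thesis unfolding dyadics_def by blast
qed

lemma dyadics_dense:
  assumes "0 \<le> a" "a < b"
  obtains n q where "q \<in> dyadics n" "a < q" "q < b"
proof -
  obtain n where n: "(1 / 2) ^ n < b - a"
    using real_arch_pow_inv[of "b - a" "1 / 2"] assms by auto
  define m where "m = nat (\<lfloor>a * 2 ^ n\<rfloor> + 1)"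
  have m: "real m = of_int \<lfloor>a * 2 ^ n\<rfloor> + 1" using assms by (simp add: m_def)
  have "a * 2 ^ n < real m" "real m \<le> a * 2 ^ n + 1" unfolding m by linarith+
  then have "a < real m / 2 ^ n" "real m / 2 ^ n \<le> a + (1 / 2) ^ n"
    by (simp_all add: field_simps power_one_over)
  then show ?thesis using that[OF dyadicI[of m n]] n by simp
qed

text \<open>Fatou's lemma for indicators: almost every point of \<open>A\<close> lies in all late
  \<open>E n\<close>. The factor \<open>k\<close> is carried along to avoid division in the extended
  reals.\<close>

lemma emeasure_eventually_le:
  fixes k C :: ennreal
  assumes E [measurable]: "\<And>n. E n \<in> sets M" and A [measurable]: "A \<in> sets M"
    and ev: "AE \<omega> in M. \<omega> \<in> A \<longrightarrow> (\<forall>\<^sub>F n in sequentially. \<omega> \<in> E n)"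
    and le: "\<And>n. k * emeasure M (E n) \<le> c n" and c: "c \<longlonglongrightarrow> C"
  shows "k * emeasure M A \<le> C"
proof -
  have "k * emeasure M A = (\<integral>\<^sup>+\<omega>. k * indicator A \<omega> \<partial>M)"
    by (simp add: nn_integral_cmult)
  also have "\<dots> \<le> (\<integral>\<^sup>+\<omega>. liminf (\<lambda>n. k * indicator (E n) \<omega>) \<partial>M)"
  proof (rule nn_integral_mono_AE, use ev in eventually_elim)
    case (elim \<omega>)
    show ?case
    proof (cases "\<omega> \<in> A")
      case True
      then have "\<forall>\<^sub>F n in sequentially. k * indicator A \<omega> \<le> k * indicator (E n) \<omega>"
        using elim by (auto elim: eventually_mono)
      then show ?thesis by (rule Liminf_bounded)
    qed simp
  qed
  also have "\<dots> \<le> liminf (\<lambda>n. \<integral>\<^sup>+\<omega>. k * indicator (E n) \<omega> \<partial>M)"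
    by (rule nn_integral_liminf) measurable
  also have "\<dots> \<le> liminf c"
    by (rule Liminf_mono) (use le in \<open>simp add: nn_integral_cmult\<close>)
  also have "\<dots> = C" using c by (simp add: lim_imp_Liminf)
  finally show ?thesis .
qed

lemma sq_int_cmult:
  assumes "(\<lambda>s. H (max 0 s) \<omega>) \<in> borel_measurable borel" "0 \<le> a"
  shows "sq_int (\<lambda>s \<omega>. c * H s \<omega>) a b \<omega> = ennreal (c\<^sup>2) * sq_int H a b \<omega>"
proof -
  have "sq_int (\<lambda>s \<omega>. c * H s \<omega>) a b \<omega> = (\<integral>\<^sup>+s. ennreal (c\<^sup>2) * (ennreal ((H (max 0 s) \<omega>)\<^sup>2) * indicator {a..b} s) \<partial>lborel)"
    using assms(2) by (intro nn_integral_cong) (auto split: split_indicator simp: max_absorb2 power_mult_distrib ennreal_mult)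
  also have "\<dots> = ennreal (c\<^sup>2) * sq_int (\<lambda>s. H (max 0 s)) a b \<omega>"
    using assms by (subst nn_integral_cmult) auto
  finally show ?thesis by (simp add: sq_int_max[OF assms(2), of H])
qed

text \<open>Stop at the first time at which \<open>\<bar>z\<bar>\<close> equals
  \<open>\<epsilon>\<close>. Until then the drift has contributed at most
  \<open>lam * (b - a) * \<epsilon> \<le> \<epsilon> / 4\<close>, so \<open>i\<close> has moved by
  at least \<open>3 * \<epsilon> / 4\<close>, more than \<open>\<epsilon> / 2\<close>.\<close>

lemma linear_excursion:
  fixes z i :: "real \<Rightarrow> real"
  assumes ab: "a \<le> b" and cont: "continuous_on {a..b} z" and za: "z a = 0"
    and lam: "0 \<le> lam" "lam * (b - a) \<le> 1 / 4"
    and eq: "\<And>t. t \<in> {a..b} \<Longrightarrow> z t = - lam * integral {a..t} z + (i t - i a)"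
    and e: "0 < \<epsilon>" "u \<in> {a..b}" "\<epsilon> < \<bar>z u\<bar>"
  shows "\<exists>t\<in>{a..b}. \<epsilon> / 2 < \<bar>i t - i a\<bar> \<and> (\<forall>s\<in>{a..t}. \<bar>z s\<bar> \<le> \<epsilon>)"
proof -
  have ivt: "\<exists>x. a \<le> x \<and> x \<le> v \<and> \<bar>z x\<bar> = \<epsilon>" if "v \<in> {a..b}" "\<epsilon> \<le> \<bar>z v\<bar>" for v
    by (rule IVT') (use that za e ab in \<open>auto intro!: continuous_intros continuous_on_subset[OF cont]\<close>)
  \<comment> \<open>The first hitting time is the least element of this compact level set. The
    intermediate value theorem shows both that the set is nonempty and that
    \<open>\<bar>z\<bar>\<close> cannot exceed \<open>\<epsilon>\<close> before.\<close>
  define S where "S = {x \<in> {a..b}. \<bar>z x\<bar> = \<epsilon>}"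
  have "closed S" unfolding S_def
    by (rule continuous_closed_preimage_constant) (auto intro!: continuous_intros cont)
  moreover have "bounded S" by (rule bounded_subset[of "{a..b}"]) (auto simp: S_def)
  ultimately have "compact S" by (simp add: compact_eq_bounded_closed)
  moreover have "S \<noteq> {}"
  proof -
    obtain x where "a \<le> x" "x \<le> u" "\<bar>z x\<bar> = \<epsilon>" using ivt[OF e(2)] e by auto
    then have "x \<in> S" using e by (auto simp: S_def)
    then show ?thesis by auto
  qed
  ultimately obtain t where t: "t \<in> S" "\<And>s. s \<in> S \<Longrightarrow> t \<le> s"
    using compact_attains_inf by metis
  have tab: "t \<in> {a..b}" "\<bar>z t\<bar> = \<epsilon>" using t by (auto simp: S_def)
  have below: "\<bar>z s\<bar> \<le> \<epsilon>" if s: "s \<in> {a..t}" for s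
  proof (rule ccontr)
    assume "\<not> ?thesis"
    then have gt: "\<epsilon> < \<bar>z s\<bar>" by simp
    then obtain x where x: "a \<le> x" "x \<le> s" "\<bar>z x\<bar> = \<epsilon>" using ivt[of s] s tab by auto
    then have "t \<le> x" using t(2)[of x] s tab by (auto simp: S_def)
    then have "s = t" using x s by auto
    then show False using gt tab by simp
  qed
  have "norm (integral {a..t} z) \<le> \<epsilon> * (t - a)"
    by (rule integral_bound) (use tab below in \<open>auto intro: continuous_on_subset[OF cont]\<close>)
  also have "\<epsilon> * (t - a) \<le> \<epsilon> * (b - a)" using tab e by simp
  finally have "lam * \<bar>integral {a..t} z\<bar> \<le> lam * (\<epsilon> * (b - a))"
    using lam(1) by (simp add: mult_left_mono)
  also have "\<dots> = \<epsilon> * (lam * (b - a))" by simp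
  also have "\<dots> \<le> \<epsilon> * (1 / 4)" using lam e by (intro mult_left_mono) auto
  finally have "\<bar>lam * integral {a..t} z\<bar> \<le> \<epsilon> / 4" using lam by (simp add: abs_mult)
  moreover have "\<bar>z t\<bar> = \<epsilon>" by fact
  ultimately have "\<epsilon> / 2 < \<bar>i t - i a\<bar>" using eq[OF tab(1)] e by linarith
  then show ?thesis using tab below by blast
qed

section \<open>Almost sure limits of elementary integrals, and uniqueness for the linear
  equation\<close>

context brownian_filtration
begin

text \<open>Almost sure instead of stochastic convergence, and only at dyadic times: this is stable under
  linear combinations with arbitrary (unbounded) initial random variables as coefficients.\<close>

definition ito_pair :: "(real \<Rightarrow> 'w \<Rightarrow> real) \<Rightarrow> (real \<Rightarrow> 'w \<Rightarrow> real) \<Rightarrow> bool" where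
  "ito_pair H I \<longleftrightarrow>
     (\<forall>t\<ge>0. H t \<in> borel_measurable M) \<and> (\<forall>\<omega>\<in>space M. continuous_on {0..} (\<lambda>t. H t \<omega>)) \<and>
     (\<forall>t\<ge>0. I t \<in> borel_measurable M) \<and> (\<forall>\<omega>\<in>space M. continuous_on {0..} (\<lambda>t. I t \<omega>)) \<and>
     (\<exists>Hn In. (\<forall>n::nat. elementary (Hn n) (In n)) \<and>
        (AE \<omega> in M. (\<forall>T::nat. (\<lambda>n. sq_int (\<lambda>s \<omega>. Hn n s \<omega> - H s \<omega>) 0 (real T) \<omega>) \<longlonglongrightarrow> 0) \<and>
           (\<forall>k. \<forall>q\<in>dyadics k. (\<lambda>n. In n q \<omega>) \<longlonglongrightarrow> I q \<omega>)))"

lemma ito_pairD: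
  assumes "ito_pair H I"
  shows "0 \<le> t \<Longrightarrow> H t \<in> borel_measurable M" "\<omega> \<in> space M \<Longrightarrow> continuous_on {0..} (\<lambda>t. H t \<omega>)"
    "0 \<le> t \<Longrightarrow> I t \<in> borel_measurable M" "\<omega> \<in> space M \<Longrightarrow> continuous_on {0..} (\<lambda>t. I t \<omega>)"
  using assms unfolding ito_pair_def by auto

lemma ito_pair_jointly_measurable:
  assumes "ito_pair H I"
  shows "(\<lambda>(s, \<omega>). H (max 0 s) \<omega>) \<in> borel_measurable (borel \<Otimes>\<^sub>M M)"
  using ito_pairD[OF assms] by (intro continuous_process_jointly_measurable) auto

lemma elementary_jointly_measurable:
  "elementary H I \<Longrightarrow> (\<lambda>(s, \<omega>). H (max 0 s) \<omega>) \<in> borel_measurable (borel \<Otimes>\<^sub>M M)"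
  by (simp add: elementary_def)

text \<open>For a fixed outcome the coefficients are mere numbers, so the combined error is bounded
  by twice the single errors times the squared coefficients and tends to 0 outcome by
  outcome.\<close>

lemma ito_pair_add_mult:
  assumes p: "ito_pair H I" "ito_pair H' I'"
    and c: "c \<in> borel_measurable (F 0)" "c' \<in> borel_measurable (F 0)"
  shows "ito_pair (\<lambda>t \<omega>. c \<omega> * H t \<omega> + c' \<omega> * H' t \<omega>) (\<lambda>t \<omega>. c \<omega> * I t \<omega> + c' \<omega> * I' t \<omega>)"
proof -
  obtain Hn In where e: "\<And>n::nat. elementary (Hn n) (In n)"
    and ae: "AE \<omega> in M. (\<forall>T::nat. (\<lambda>n. sq_int (\<lambda>s \<omega>. Hn n s \<omega> - H s \<omega>) 0 (real T) \<omega>) \<longlonglongrightarrow> 0) \<and>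
           (\<forall>k. \<forall>q\<in>dyadics k. (\<lambda>n. In n q \<omega>) \<longlonglongrightarrow> I q \<omega>)"
    using p(1) unfolding ito_pair_def by blast
  obtain Hn' In' where e': "\<And>n::nat. elementary (Hn' n) (In' n)"
    and ae': "AE \<omega> in M. (\<forall>T::nat. (\<lambda>n. sq_int (\<lambda>s \<omega>. Hn' n s \<omega> - H' s \<omega>) 0 (real T) \<omega>) \<longlonglongrightarrow> 0) \<and>
           (\<forall>k. \<forall>q\<in>dyadics k. (\<lambda>n. In' n q \<omega>) \<longlonglongrightarrow> I' q \<omega>)"
    using p(2) unfolding ito_pair_def by blast
  let ?H = "\<lambda>n t \<omega>. c \<omega> * Hn n t \<omega> + c' \<omega> * Hn' n t \<omega>" and ?I = "\<lambda>n t \<omega>. c \<omega> * In n t \<omega> + c' \<omega> * In' n t \<omega>"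
  have "AE \<omega> in M. (\<forall>T::nat. (\<lambda>n. sq_int (\<lambda>s \<omega>. ?H n s \<omega> - (c \<omega> * H s \<omega> + c' \<omega> * H' s \<omega>)) 0 (real T) \<omega>) \<longlonglongrightarrow> 0) \<and>
           (\<forall>k. \<forall>q\<in>dyadics k. (\<lambda>n. ?I n q \<omega>) \<longlonglongrightarrow> c \<omega> * I q \<omega> + c' \<omega> * I' q \<omega>)"
    using ae ae' AE_space
  proof eventually_elim
    case (elim \<omega>)
    have pm: "(\<lambda>s. Hn n (max 0 s) \<omega> - H (max 0 s) \<omega>) \<in> borel_measurable borel"
      "(\<lambda>s. Hn' n (max 0 s) \<omega> - H' (max 0 s) \<omega>) \<in> borel_measurable borel" for n
      using jointly_measurable_path[OF elementary_jointly_measurable[OF e] elim(3)]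
        jointly_measurable_path[OF elementary_jointly_measurable[OF e'] elim(3)]
        jointly_measurable_path[OF ito_pair_jointly_measurable[OF p(1)] elim(3)]
        jointly_measurable_path[OF ito_pair_jointly_measurable[OF p(2)] elim(3)]
      by auto
    have "(\<lambda>n. sq_int (\<lambda>s \<omega>. ?H n s \<omega> - (c \<omega> * H s \<omega> + c' \<omega> * H' s \<omega>)) 0 (real T) \<omega>) \<longlonglongrightarrow> 0" for T :: nat
    proof (rule tendsto_sandwich[OF _ _ tendsto_const])
      let ?b = "\<lambda>n. 2 * (ennreal ((c \<omega>)\<^sup>2) * sq_int (\<lambda>s \<omega>. Hn n s \<omega> - H s \<omega>) 0 (real T) \<omega>)
            + 2 * (ennreal ((c' \<omega>)\<^sup>2) * sq_int (\<lambda>s \<omega>. Hn' n s \<omega> - H' s \<omega>) 0 (real T) \<omega>)"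
      have "?b \<longlonglongrightarrow> 2 * (ennreal ((c \<omega>)\<^sup>2) * 0) + 2 * (ennreal ((c' \<omega>)\<^sup>2) * 0)"
        using elim by (intro tendsto_add ennreal_tendsto_cmult) auto
      then show "?b \<longlonglongrightarrow> 0" by simp
      show "\<forall>\<^sub>F n in sequentially. sq_int (\<lambda>s \<omega>. ?H n s \<omega> - (c \<omega> * H s \<omega> + c' \<omega> * H' s \<omega>)) 0 (real T) \<omega> \<le> ?b n"
      proof (intro always_eventually allI)
        fix n
        have "sq_int (\<lambda>s \<omega>. ?H n s \<omega> - (c \<omega> * H s \<omega> + c' \<omega> * H' s \<omega>)) 0 (real T) \<omega>
          = sq_int (\<lambda>s \<omega>'. c \<omega> * (Hn n s \<omega>' - H s \<omega>') + c' \<omega> * (Hn' n s \<omega>' - H' s \<omega>')) 0 (real T) \<omega>"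
          by (simp add: algebra_simps)
        also have "\<dots> \<le> 2 * sq_int (\<lambda>s \<omega>'. c \<omega> * (Hn n s \<omega>' - H s \<omega>')) 0 (real T) \<omega>
            + 2 * sq_int (\<lambda>s \<omega>'. c' \<omega> * (Hn' n s \<omega>' - H' s \<omega>')) 0 (real T) \<omega>"
          by (rule sq_int_triangle) (use pm[of n] in auto)
        also have "\<dots> = ?b n"
          using sq_int_cmult[of "\<lambda>s \<omega>'. Hn n s \<omega>' - H s \<omega>'" \<omega> 0 "c \<omega>" "real T", OF pm(1)]
            sq_int_cmult[of "\<lambda>s \<omega>'. Hn' n s \<omega>' - H' s \<omega>'" \<omega> 0 "c' \<omega>" "real T", OF pm(2)] by simp
        finally show "sq_int (\<lambda>s \<omega>. ?H n s \<omega> - (c \<omega> * H s \<omega> + c' \<omega> * H' s \<omega>)) 0 (real T) \<omega> \<le> ?b n" .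
      qed
    qed simp
    moreover have "(\<lambda>n. ?I n q \<omega>) \<longlonglongrightarrow> c \<omega> * I q \<omega> + c' \<omega> * I' q \<omega>" if "q \<in> dyadics k" for q k
      using elim that by (intro tendsto_intros) auto
    ultimately show ?case by blast
  qed
  moreover have "\<forall>n. elementary (?H n) (?I n)"
    using elementary_add_mult[OF e e' c] by auto
  moreover have "c \<in> borel_measurable M" "c' \<in> borel_measurable M" using c measurable_F by blast+
  ultimately show ?thesis
    unfolding ito_pair_def
    using ito_pairD[OF p(1)] ito_pairD[OF p(2)]
    by (intro conjI exI[of _ ?H] exI[of _ ?I]) (auto intro!: continuous_intros)
qed

text \<open>The constant 3 stems from \<open>H\<^sub>n\<^sup>2 \<le> 2 H\<^sup>2 + 2 (H\<^sub>n - H)\<^sup>2\<close>. The probability on the right-hand side,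
  rather than 1, is what the uniqueness argument for the linear equation exploits.\<close>

lemma ito_lenglart:
  assumes p: "ito_pair H I" and a: "a \<in> dyadics k" "a \<le> b" and pos: "0 < \<epsilon>" "0 < \<delta>"
  defines "E \<equiv> {\<omega> \<in> space M. \<exists>t\<in>{a..b}. \<epsilon> < \<bar>I t \<omega> - I a \<omega>\<bar> \<and> sq_int H a t \<omega> \<le> ennreal \<delta>}"
  shows "E \<in> sets M"
    and "ennreal (\<epsilon>\<^sup>2) * emeasure M E \<le> ennreal (3 * \<delta>) * emeasure M {\<omega> \<in> space M. 0 < sq_int H a b \<omega>}"
proof -
  have a0: "0 \<le> a" using a dyadics_nonneg by blast
  note jm = ito_pair_jointly_measurable[OF p]
  have sqm [measurable]: "sq_int H a t \<in> borel_measurable M" for t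
    by (rule sq_int_measurable[OF a0 jm])
  \<comment> \<open>The excursion is already seen at a dyadic time shortly before \<open>t\<close>:
    continuity keeps the increment above \<open>\<epsilon>\<close>, and an earlier time can only
    lower the bracket. This writes \<open>E\<close> as a countable union, and it brings the event
    within reach of the approximants, which are controlled at dyadic times only.\<close>
  have dense: "\<exists>n q. q \<in> dyadics n \<and> q \<in> {a..b} \<and> \<epsilon> < \<bar>I q \<omega> - I a \<omega>\<bar> \<and> sq_int H a q \<omega> \<le> ennreal \<delta>"
    if w: "\<omega> \<in> E" for \<omega>
  proof -
    from w obtain t where sp: "\<omega> \<in> space M" and t: "t \<in> {a..b}" "\<epsilon> < \<bar>I t \<omega> - I a \<omega>\<bar>" "sq_int H a t \<omega> \<le> ennreal \<delta>"
      unfolding E_def by blast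
    have at: "a < t" using t pos by (cases "a = t") auto
    have "continuous_on {a..t} (\<lambda>s. \<bar>I s \<omega> - I a \<omega>\<bar>)"
      using a0 by (intro continuous_intros continuous_on_subset[OF ito_pairD(4)[OF p sp]]) auto
    then have "((\<lambda>s. \<bar>I s \<omega> - I a \<omega>\<bar>) \<longlongrightarrow> \<bar>I t \<omega> - I a \<omega>\<bar>) (at t within {a..t})"
      using at by (simp add: continuous_on)
    then have "\<forall>\<^sub>F s in at t within {a..t}. \<epsilon> < \<bar>I s \<omega> - I a \<omega>\<bar>"
      by (rule order_tendstoD(1)[OF _ t(2)])
    then obtain d where d: "d > 0" "\<And>s. s \<in> {a..t} \<Longrightarrow> s \<noteq> t \<Longrightarrow> dist s t < d \<Longrightarrow> \<epsilon> < \<bar>I s \<omega> - I a \<omega>\<bar>"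
      unfolding eventually_at by auto
    obtain n q where q: "q \<in> dyadics n" "max a (t - d) < q" "q < t"
      by (rule dyadics_dense[of "max a (t - d)" t]) (use a0 at d(1) in auto)
    have "sq_int H a q \<omega> \<le> sq_int H a t \<omega>"
      using q by (intro nn_integral_mono) (auto split: split_indicator)
    then show ?thesis using q d(2)[of q] t by (intro exI[of _ n] exI[of _ q]) (auto simp: dist_real_def)
  qed
  have "E = (\<Union>n. \<Union>q\<in>dyadics n \<inter> {a..b}. {\<omega> \<in> space M. \<epsilon> < \<bar>I q \<omega> - I a \<omega>\<bar> \<and> sq_int H a q \<omega> \<le> ennreal \<delta>})"
  proof
    show "E \<subseteq> (\<Union>n. \<Union>q\<in>dyadics n \<inter> {a..b}. {\<omega> \<in> space M. \<epsilon> < \<bar>I q \<omega> - I a \<omega>\<bar> \<and> sq_int H a q \<omega> \<le> ennreal \<delta>})"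
    proof
      fix \<omega> assume w: "\<omega> \<in> E"
      then have "\<omega> \<in> space M" by (simp add: E_def)
      with dense[OF w] show "\<omega> \<in> (\<Union>n. \<Union>q\<in>dyadics n \<inter> {a..b}. {\<omega> \<in> space M. \<epsilon> < \<bar>I q \<omega> - I a \<omega>\<bar> \<and> sq_int H a q \<omega> \<le> ennreal \<delta>})"
        by blast
    qed
  qed (unfold E_def, blast)
  also have "\<dots> \<in> sets M"
  proof (rule sets.countable_UN''[OF countableI_type], rule sets.finite_UN)
    show "finite (dyadics n \<inter> {a..b})" for n using finite_dyadics by blast
    fix n q assume "q \<in> dyadics n \<inter> {a..b}"
    then have [measurable]: "I q \<in> borel_measurable M" "I a \<in> borel_measurable M"
      using ito_pairD(3)[OF p] a0 dyadics_nonneg by auto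
    show "{\<omega> \<in> space M. \<epsilon> < \<bar>I q \<omega> - I a \<omega>\<bar> \<and> sq_int H a q \<omega> \<le> ennreal \<delta>} \<in> sets M"
      by measurable
  qed
  finally show Em: "E \<in> sets M" .
  obtain Hn In where e: "\<And>n::nat. elementary (Hn n) (In n)"
    and ae: "AE \<omega> in M. (\<forall>T::nat. (\<lambda>n. sq_int (\<lambda>s \<omega>. Hn n s \<omega> - H s \<omega>) 0 (real T) \<omega>) \<longlonglongrightarrow> 0) \<and>
           (\<forall>k. \<forall>q\<in>dyadics k. (\<lambda>n. In n q \<omega>) \<longlonglongrightarrow> I q \<omega>)"
    using p unfolding ito_pair_def by blast
  define N where "N = nat \<lceil>b\<rceil>"
  have bN: "b \<le> real N" unfolding N_def by linarith
  define r where "r n \<omega> = sq_int (\<lambda>s \<omega>. Hn n s \<omega> - H s \<omega>) 0 (real N) \<omega>" for n \<omega>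
  have jmr: "(\<lambda>(s, \<omega>). Hn n (max 0 s) \<omega> - H (max 0 s) \<omega>) \<in> borel_measurable (borel \<Otimes>\<^sub>M M)" for n
    using borel_measurable_diff[OF elementary_jointly_measurable[OF e[of n]] jm] by (simp add: case_prod_beta')
  have rm [measurable]: "r n \<in> borel_measurable M" for n
    unfolding r_def by (rule sq_int_measurable) (use jmr in auto)
  have tri: "sq_int (Hn n) a t \<omega> \<le> 2 * sq_int H a t \<omega> + 2 * r n \<omega>" if "\<omega> \<in> space M" "t \<le> b" for n t \<omega>
  proof -
    have "sq_int (\<lambda>s \<omega>. H s \<omega> + (Hn n s \<omega> - H s \<omega>)) a t \<omega> \<le> 2 * sq_int H a t \<omega> + 2 * r n \<omega>"
      unfolding r_def
      by (rule sq_int_triangle[OF a0]) (use jointly_measurable_path[OF jm that(1)] jointly_measurable_path[OF jmr that(1)] that bN in auto)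
    then show ?thesis by simp
  qed
  \<comment> \<open>The level \<open>3 * \<delta>\<close> is
    \<open>2 * \<delta> + 2 * (\<delta> / 2)\<close>, an upper bound for the approximating bracket
    once the error \<open>r n\<close> is below \<open>\<delta> / 2\<close>.\<close>
  define A where "A n = {\<omega> \<in> space M. \<exists>q\<in>dyadics n \<inter> {a..b}. \<epsilon> \<le> \<bar>In n q \<omega> - In n a \<omega>\<bar> \<and> sq_int (Hn n) a q \<omega> \<le> ennreal (3 * \<delta>)}" for n
  have fin: "finite (dyadics n \<inter> {a..b})" "dyadics n \<inter> {a..b} \<subseteq> {a..b}" for n
    using finite_dyadics by auto
  have d3: "0 \<le> 3 * \<delta>" using pos by simp
  have EL: "A n \<in> sets M"
    "ennreal (\<epsilon>\<^sup>2) * emeasure M (A n) \<le> (\<integral>\<^sup>+\<omega>. min (sq_int (Hn n) a b \<omega>) (ennreal (3 * \<delta>)) \<partial>M)" for n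
    unfolding A_def by (rule elementary_lenglart[OF e a0 a(2) fin pos(1) d3])+
  let ?Z = "{\<omega> \<in> space M. 0 < sq_int H a b \<omega>}"
  have Zm: "?Z \<in> sets M" by measurable
  \<comment> \<open>On \<open>?Z\<close> the truncated bracket is bounded by
    \<open>3 * \<delta>\<close>; off \<open>?Z\<close> the approximating bracket is at most
    \<open>2 * r n\<close>, whose truncation tends to 0 in mean. This split produces the probability
    on the right-hand side.\<close>
  define c where "c n = ennreal (3 * \<delta>) * emeasure M ?Z + (\<integral>\<^sup>+\<omega>. min (2 * r n \<omega>) (ennreal (3 * \<delta>)) \<partial>M)" for n
  show "ennreal (\<epsilon>\<^sup>2) * emeasure M E \<le> ennreal (3 * \<delta>) * emeasure M ?Z"
  proof (rule emeasure_eventually_le[where E=A and c=c])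
    show "A n \<in> sets M" for n by (rule EL(1))
    show "E \<in> sets M" by fact
    show "ennreal (\<epsilon>\<^sup>2) * emeasure M (A n) \<le> c n" for n
    proof -
      have "ennreal (\<epsilon>\<^sup>2) * emeasure M (A n) \<le> (\<integral>\<^sup>+\<omega>. min (sq_int (Hn n) a b \<omega>) (ennreal (3 * \<delta>)) \<partial>M)"
        by (rule EL(2))
      also have "\<dots> \<le> (\<integral>\<^sup>+\<omega>. ennreal (3 * \<delta>) * indicator ?Z \<omega> + min (2 * r n \<omega>) (ennreal (3 * \<delta>)) \<partial>M)"
      proof (rule nn_integral_mono)
        fix \<omega> assume w: "\<omega> \<in> space M"
        show "min (sq_int (Hn n) a b \<omega>) (ennreal (3 * \<delta>)) \<le> ennreal (3 * \<delta>) * indicator ?Z \<omega> + min (2 * r n \<omega>) (ennreal (3 * \<delta>))"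
        proof (cases "0 < sq_int H a b \<omega>")
          case True
          then have "indicator ?Z \<omega> = (1::ennreal)" using w by simp
          then show ?thesis by (simp add: add_increasing2 min.coboundedI2)
        next
          case False
          then have "sq_int H a b \<omega> = 0" by (simp add: not_less)
          then have "sq_int (Hn n) a b \<omega> \<le> 2 * r n \<omega>" using tri[OF w order_refl, of n] by simp
          then have "min (sq_int (Hn n) a b \<omega>) (ennreal (3 * \<delta>)) \<le> min (2 * r n \<omega>) (ennreal (3 * \<delta>))"
            by (rule min.mono) simp
          then show ?thesis by (rule order_trans) simp
        qed
      qed
      also have "\<dots> = c n"
        unfolding c_def using Zm by (subst nn_integral_add) (auto simp: nn_integral_cmult)
      finally show ?thesis .
    qed
    have "(\<lambda>n. \<integral>\<^sup>+\<omega>. min (2 * r n \<omega>) (ennreal (3 * \<delta>)) \<partial>M) \<longlonglongrightarrow> (\<integral>\<^sup>+\<omega>. 0 \<partial>M)"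
    proof (rule nn_integral_dominated_convergence[where w="\<lambda>_. ennreal (3 * \<delta>)"])
      show "(\<integral>\<^sup>+\<omega>. ennreal (3 * \<delta>) \<partial>M) < \<infinity>" by (simp add: emeasure_space_1)
      show "AE \<omega> in M. (\<lambda>n. min (2 * r n \<omega>) (ennreal (3 * \<delta>))) \<longlonglongrightarrow> 0"
        using ae
      proof eventually_elim
        case (elim \<omega>)
        then have "(\<lambda>n. r n \<omega>) \<longlonglongrightarrow> 0" by (simp add: r_def)
        then have "(\<lambda>n. min (2 * r n \<omega>) (ennreal (3 * \<delta>))) \<longlonglongrightarrow> min (2 * 0) (ennreal (3 * \<delta>))"
          by (intro tendsto_min ennreal_tendsto_cmult tendsto_const) auto
        then show ?case by simp
      qed
    qed auto
    then have "c \<longlonglongrightarrow> ennreal (3 * \<delta>) * emeasure M ?Z + 0"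
      unfolding c_def by (intro tendsto_add tendsto_const) simp
    then show "c \<longlonglongrightarrow> ennreal (3 * \<delta>) * emeasure M ?Z" by simp
    show "AE \<omega> in M. \<omega> \<in> E \<longrightarrow> (\<forall>\<^sub>F n in sequentially. \<omega> \<in> A n)"
      using ae AE_space
    proof eventually_elim
      case (elim \<omega>)
      show ?case
      proof
        assume "\<omega> \<in> E"
        then obtain m q where q: "q \<in> dyadics m" "q \<in> {a..b}" "\<epsilon> < \<bar>I q \<omega> - I a \<omega>\<bar>" "sq_int H a q \<omega> \<le> ennreal \<delta>"
          using dense by blast
        have "(\<lambda>n. \<bar>In n q \<omega> - In n a \<omega>\<bar>) \<longlonglongrightarrow> \<bar>I q \<omega> - I a \<omega>\<bar>"
          using elim q(1) a(1) by (intro tendsto_intros) auto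
        then have ev1: "\<forall>\<^sub>F n in sequentially. \<epsilon> < \<bar>In n q \<omega> - In n a \<omega>\<bar>"
          by (rule order_tendstoD(1)[OF _ q(3)])
        have "(\<lambda>n. r n \<omega>) \<longlonglongrightarrow> 0" using elim by (simp add: r_def)
        then have ev2: "\<forall>\<^sub>F n in sequentially. r n \<omega> < ennreal (\<delta> / 2)"
          by (rule order_tendstoD(2)) (use pos in auto)
        show "\<forall>\<^sub>F n in sequentially. \<omega> \<in> A n"
          using ev1 ev2 eventually_ge_at_top[of m]
        proof eventually_elim
          case (elim n)
          have qn: "q \<in> dyadics n \<inter> {a..b}" using dyadics_mono[OF elim(3)] q by auto
          have "sq_int (Hn n) a q \<omega> \<le> 2 * sq_int H a q \<omega> + 2 * r n \<omega>"
            using tri \<open>\<omega> \<in> space M\<close> q(2) by simp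
          also have "\<dots> \<le> 2 * ennreal \<delta> + 2 * ennreal (\<delta> / 2)"
            using q(4) elim(2) by (intro add_mono mult_left_mono) auto
          also have "\<dots> = ennreal (2 * \<delta> + 2 * (\<delta> / 2))"
          proof -
            have two: "2 * ennreal x = ennreal (2 * x)" if "0 \<le> x" for x
              using that by (simp add: ennreal_mult)
            show ?thesis using pos two[of \<delta>] two[of "\<delta> / 2"] by (subst ennreal_plus) auto
          qed
          also have "\<dots> = ennreal (3 * \<delta>)" by simp
          finally show "\<omega> \<in> A n" unfolding A_def using elim(1) qn \<open>\<omega> \<in> space M\<close> by (auto intro!: bexI[of _ q])
        qed
      qed
    qed
  qed
qed

text \<open>On a dyadic interval of length \<open>h\<close> that \<open>Z\<close> enters at 0, an excursion of \<open>Z\<close> beyond \<open>\<epsilon>\<close> forces \<open>I\<close> to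
  move by more than \<open>\<epsilon>/2\<close> while its bracket is still at most \<open>(\<sigma>\<^sup>2 + 1) h \<epsilon>\<^sup>2\<close>. By scale invariance the
  resulting bound does not depend on \<open>\<epsilon>\<close>, and \<open>\<epsilon> \<rightarrow> 0\<close> shows \<open>p \<le> p/2\<close> for \<open>p = P(\<sigma> Z \<noteq> 0)\<close>.\<close>

lemma linear_sde_unique:
  assumes p: "ito_pair (\<lambda>t \<omega>. \<sigma> * Z t \<omega>) I"
    and Zc: "\<And>\<omega>. \<omega> \<in> space M \<Longrightarrow> continuous_on {0..} (\<lambda>t. Z t \<omega>)"
    and lam: "0 \<le> lam"
    and eq: "AE \<omega> in M. Z 0 \<omega> = 0 \<and> (\<forall>t\<ge>0. Z t \<omega> = - lam * integral {0..t} (\<lambda>s. Z s \<omega>) + I t \<omega>)"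
  shows "AE \<omega> in M. \<forall>t\<ge>0. Z t \<omega> = 0"
proof -
  \<comment> \<open>The step \<open>h = 1 / 2 ^ j\<close> must satisfy
    \<open>lam * h \<le> 1 / 4\<close> for \<open>linear_excursion\<close> and
    \<open>12 * (\<sigma>\<^sup>2 + 1) * h \<le> 1 / 2\<close>, where the left-hand side is the
    Lenglart ratio \<open>3 * \<delta> n / (\<epsilon> n / 2)\<^sup>2\<close>. A power of 2 makes
    the ends of all intervals dyadic.\<close>
  obtain j :: nat where "lam * 4 + 24 * (\<sigma>\<^sup>2 + 1) < 2 ^ j"
    using real_arch_pow[of 2 "lam * 4 + 24 * (\<sigma>\<^sup>2 + 1)"] by auto
  then have j: "lam * 4 \<le> 2 ^ j" "24 * (\<sigma>\<^sup>2 + 1) \<le> 2 ^ j"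
  proof -
    have "0 \<le> lam * 4" "0 \<le> 24 * (\<sigma>\<^sup>2 + 1)" using lam by auto
    then show "lam * 4 \<le> 2 ^ j" "24 * (\<sigma>\<^sup>2 + 1) \<le> 2 ^ j"
      using \<open>lam * 4 + 24 * (\<sigma>\<^sup>2 + 1) < 2 ^ j\<close> by linarith+
  qed
  define h :: real where "h = 1 / 2 ^ j"
  have h: "0 < h" "lam * h \<le> 1 / 4" "12 * (\<sigma>\<^sup>2 + 1) * h \<le> 1 / 2"
    using j by (simp_all add: h_def field_simps)
  have "AE \<omega> in M. \<forall>t\<in>{0..real m * h}. Z t \<omega> = 0" for m
  proof (induction m)
    case 0
    show ?case using eq by eventually_elim auto
  next
    case (Suc m)
    define a where "a = real m * h"
    define b where "b = real (Suc m) * h"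
    have ab: "0 \<le> a" "a \<le> b" "b - a = h" using h by (simp_all add: a_def b_def algebra_simps)
    have ad: "a \<in> dyadics (j + m)" using dyadicI[of m j] by (simp add: a_def h_def)
    define \<epsilon> :: "nat \<Rightarrow> real" where "\<epsilon> n = 1 / (real n + 1)" for n
    \<comment> \<open>\<open>\<sigma>\<^sup>2 + 1\<close> in place of
      \<open>\<sigma>\<^sup>2\<close> keeps the level positive when
      \<open>\<sigma> = 0\<close>.\<close>
    define \<delta> where "\<delta> n = (\<sigma>\<^sup>2 + 1) * h * (\<epsilon> n)\<^sup>2" for n
    have pos: "0 < \<epsilon> n" "0 < \<epsilon> n / 2" "0 < \<delta> n" for n
      using h by (auto simp: \<epsilon>_def \<delta>_def intro!: mult_pos_pos add_nonneg_pos)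
    let ?H = "\<lambda>t \<omega>. \<sigma> * Z t \<omega>"
    define E where "E n = {\<omega> \<in> space M. \<exists>t\<in>{a..b}. \<epsilon> n / 2 < \<bar>I t \<omega> - I a \<omega>\<bar> \<and> sq_int ?H a t \<omega> \<le> ennreal (\<delta> n)}" for n
    define A where "A = {\<omega> \<in> space M. 0 < sq_int ?H a b \<omega>}"
    have L: "E n \<in> sets M" "ennreal ((\<epsilon> n / 2)\<^sup>2) * emeasure M (E n) \<le> ennreal (3 * \<delta> n) * emeasure M A" for n
      unfolding E_def A_def by (rule ito_lenglart[OF p ad ab(2) pos(2)[of n] pos(3)[of n]])+
    have Am: "A \<in> sets M"
      unfolding A_def using sq_int_measurable[OF ab(1) ito_pair_jointly_measurable[OF p], of b] by measurable
    have half: "prob (E n) \<le> prob A / 2" for n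
    proof -
      have "ennreal ((\<epsilon> n / 2)\<^sup>2 * prob (E n)) \<le> ennreal (3 * \<delta> n * prob A)"
        using L(2)[of n] pos(3)[of n] by (simp add: emeasure_eq_measure ennreal_mult'')
      then have "(\<epsilon> n / 2)\<^sup>2 * prob (E n) \<le> 3 * \<delta> n * prob A"
        using pos[of n] by (subst (asm) ennreal_le_iff) auto
      also have "\<dots> = (\<epsilon> n / 2)\<^sup>2 * (12 * (\<sigma>\<^sup>2 + 1) * h * prob A)"
        by (simp add: \<delta>_def power_divide)
      finally have "prob (E n) \<le> 12 * (\<sigma>\<^sup>2 + 1) * h * prob A"
        using pos(2)[of n] by (subst (asm) mult_le_cancel_left_pos) auto
      also have "\<dots> \<le> 1 / 2 * prob A" by (intro mult_right_mono h) simp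
      finally show ?thesis by simp
    qed
    \<comment> \<open>A path that does not vanish on \<open>{a..b}\<close> exceeds every
      sufficiently small \<open>\<epsilon> n\<close>, so it makes an excursion at all late
      scales.\<close>
    have key: "AE \<omega> in M. (\<exists>t\<in>{a..b}. Z t \<omega> \<noteq> 0) \<longrightarrow> (\<forall>\<^sub>F n in sequentially. \<omega> \<in> E n)"
      using eq Suc.IH AE_space
    proof eventually_elim
      case (elim \<omega>)
      show ?case
      proof
        assume "\<exists>t\<in>{a..b}. Z t \<omega> \<noteq> 0"
        then obtain u where u: "u \<in> {a..b}" "Z u \<omega> \<noteq> 0" by auto
        let ?z = "\<lambda>t. Z t \<omega>"
        have zc: "continuous_on {0..} ?z" using Zc elim by blast
        have int: "?z integrable_on {s..t}" if "0 \<le> s" for s t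
          using that by (intro integrable_continuous_real continuous_on_subset[OF zc]) auto
        have zero: "?z t = 0" if "t \<in> {0..a}" for t using elim that by (simp add: a_def)
        have I0: "integral {0..a} ?z = 0"
          using Henstock_Kurzweil_Integration.integral_cong[of "{0..a}" ?z "\<lambda>_. 0"] zero by simp
        have Ia: "I a \<omega> = 0" using elim(1) zero[of a] I0 ab by auto
        have eq': "?z t = - lam * integral {a..t} ?z + (I t \<omega> - I a \<omega>)" if "t \<in> {a..b}" for t
        proof -
          have "integral {0..t} ?z = integral {a..t} ?z"
            using Henstock_Kurzweil_Integration.integral_combine[of 0 a t ?z] that ab int I0 by simp
          then show ?thesis using elim(1) that ab Ia by auto
        qed
        have zab: "continuous_on {a..b} ?z" using ab by (intro continuous_on_subset[OF zc]) auto
        have za: "?z a = 0" using zero[of a] ab by simp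
        have lamh: "lam * (b - a) \<le> 1 / 4" using h(2) ab(3) by simp
        have "\<forall>\<^sub>F n in sequentially. \<epsilon> n < \<bar>?z u\<bar>"
        proof -
          have "\<epsilon> \<longlonglongrightarrow> 0" unfolding \<epsilon>_def using LIMSEQ_inverse_real_of_nat by (simp add: inverse_eq_divide add.commute)
          then show ?thesis by (rule order_tendstoD(2)) (use u in simp)
        qed
        then show "\<forall>\<^sub>F n in sequentially. \<omega> \<in> E n"
        proof eventually_elim
          case (elim n)
          obtain t where t: "t \<in> {a..b}" "\<epsilon> n / 2 < \<bar>I t \<omega> - I a \<omega>\<bar>" "\<And>s. s \<in> {a..t} \<Longrightarrow> \<bar>?z s\<bar> \<le> \<epsilon> n"
            using linear_excursion[of a b ?z lam "\<lambda>t. I t \<omega>" "\<epsilon> n" u, OF ab(2) zab za lam lamh eq' pos(1) u(1) elim]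
            by blast
          have "sq_int ?H a t \<omega> \<le> (\<integral>\<^sup>+s. ennreal (\<sigma>\<^sup>2 * (\<epsilon> n)\<^sup>2) * indicator {a..t} s \<partial>lborel)"
          proof (rule nn_integral_mono)
            fix s
            have "(\<sigma> * ?z s)\<^sup>2 \<le> \<sigma>\<^sup>2 * (\<epsilon> n)\<^sup>2" if "s \<in> {a..t}"
              using t(3)[OF that] pos(1)[of n] unfolding power_mult_distrib
              by (intro mult_left_mono) (auto simp: abs_le_square_iff[symmetric])
            then show "ennreal ((\<sigma> * ?z s)\<^sup>2) * indicator {a..t} s \<le> ennreal (\<sigma>\<^sup>2 * (\<epsilon> n)\<^sup>2) * indicator {a..t} s"
              by (auto split: split_indicator intro!: ennreal_leI)
          qed
          also have "\<dots> = ennreal (\<sigma>\<^sup>2 * (\<epsilon> n)\<^sup>2 * (t - a))"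
            using t(1) by (subst nn_integral_cmult_indicator) (auto simp: ennreal_mult)
          also have "\<dots> \<le> ennreal (\<delta> n)"
          proof (rule ennreal_leI)
            have "\<sigma>\<^sup>2 * (\<epsilon> n)\<^sup>2 * (t - a) \<le> (\<sigma>\<^sup>2 + 1) * (\<epsilon> n)\<^sup>2 * h"
              using t(1) ab h by (intro mult_mono) auto
            then show "\<sigma>\<^sup>2 * (\<epsilon> n)\<^sup>2 * (t - a) \<le> \<delta> n" by (simp add: \<delta>_def mult_ac)
          qed
          finally show "\<omega> \<in> E n" unfolding E_def using t(1,2) \<open>\<omega> \<in> space M\<close> by blast
        qed
      qed
    qed
    have "1 * emeasure M A \<le> ennreal (prob A / 2)"
    proof (rule emeasure_eventually_le[where E=E and c="\<lambda>_. ennreal (prob A / 2)"])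
      show "AE \<omega> in M. \<omega> \<in> A \<longrightarrow> (\<forall>\<^sub>F n in sequentially. \<omega> \<in> E n)"
        using key
      proof eventually_elim
        case (elim \<omega>)
        have "\<exists>t\<in>{a..b}. Z t \<omega> \<noteq> 0" if "\<omega> \<in> A"
        proof (rule ccontr)
          assume "\<not> ?thesis"
          then have *: "ennreal ((\<sigma> * Z s \<omega>)\<^sup>2) * indicator {a..b} s = 0" for s
            by (auto split: split_indicator)
          have "sq_int ?H a b \<omega> = 0" unfolding * by simp
          then show False using that by (simp add: A_def)
        qed
        then show ?case using elim by blast
      qed
    qed (use L(1) Am half in \<open>auto simp: emeasure_eq_measure intro: ennreal_leI\<close>)
    \<comment> \<open>\<open>prob A \<le> prob A / 2\<close> leaves only 0. Then every
      \<open>E n\<close> is null, and \<open>key\<close> gives the vanishing of \<open>Z\<close>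
      itself, also for \<open>\<sigma> = 0\<close>, where \<open>A\<close> is empty.\<close>
    then have "prob A = 0" by (simp add: emeasure_eq_measure ennreal_le_iff[OF divide_nonneg_pos] measure_le_0_iff)
    then have "prob (E n) = 0" for n using half[of n] by (simp add: measure_le_0_iff)
    then have "E n \<in> null_sets M" for n using L(1)[of n] by (simp add: null_sets_def emeasure_eq_measure)
    then have "AE \<omega> in M. \<forall>n. \<omega> \<notin> E n" by (auto simp: AE_all_countable intro: AE_not_in)
    then show ?case using key Suc.IH
    proof eventually_elim
      case (elim \<omega>)
      have "Z t \<omega> = 0" if "t \<in> {a..b}" for t
        using elim(1,2) that eventually_sequentially by auto
      moreover have "t \<in> {a..b}" if "t \<in> {0..real (Suc m) * h}" "t \<notin> {0..real m * h}" for t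
        using that by (auto simp: a_def b_def)
      ultimately show ?case using elim(3) by blast
    qed
  qed
  then have "AE \<omega> in M. \<forall>m. \<forall>t\<in>{0..real m * h}. Z t \<omega> = 0" by (simp add: AE_all_countable)
  then show ?thesis
  proof eventually_elim
    case (elim \<omega>)
    show ?case
    proof (intro allI impI)
      fix t :: real assume "0 \<le> t"
      obtain m where "t / h < real m" using reals_Archimedean2 by blast
      then have "t \<le> real m * h" using h by (simp add: field_simps)
      then show "Z t \<omega> = 0" using elim \<open>0 \<le> t\<close> by auto
    qed
  qed
qed

end

section \<open>Dyadic approximation\<close>

lemma continuous_on_atLeast_if_compact:
  fixes f :: "real \<Rightarrow> 'a::topological_space"
  assumes "\<And>T. continuous_on {0..T} f"
  shows "continuous_on {0..} f"
  unfolding continuous_on_def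
proof
  fix t :: real assume t: "t \<in> {0..}"
  have "at t within {0..} = at t within {0..t + 1}"
    by (rule at_within_nhd[of t "{..<t + 1}"]) auto
  then show "(f \<longlongrightarrow> f t) (at t within {0..})"
    using assms[of "t + 1"] t by (simp add: continuous_on_def)
qed

text \<open>For a continuous path the gauge integral is a Lebesgue integral, which depends
  measurably on the outcome because the process is jointly measurable.\<close>

lemma integral_process:
  fixes H :: "real \<Rightarrow> 'w \<Rightarrow> real"
  assumes m: "\<And>t. 0 \<le> t \<Longrightarrow> H t \<in> borel_measurable M"
    and c: "\<And>\<omega>. \<omega> \<in> space M \<Longrightarrow> continuous_on {0..} (\<lambda>t. H t \<omega>)"
  shows "(\<lambda>\<omega>. integral {0..t} (\<lambda>s. H s \<omega>)) \<in> borel_measurable M"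
    and "\<omega> \<in> space M \<Longrightarrow> continuous_on {0..} (\<lambda>t. integral {0..t} (\<lambda>s. H s \<omega>))"
proof -
  interpret sigma_finite_measure lborel by (rule sigma_finite_lborel)
  have [measurable]: "(\<lambda>(\<omega>, s). H (max 0 s) \<omega>) \<in> borel_measurable (M \<Otimes>\<^sub>M lborel)"
    using measurable_pair_swap[OF continuous_process_jointly_measurable[OF m c]] by (simp add: case_prod_beta')
  have "(\<lambda>\<omega>. \<integral>s. indicator {0..t} s *\<^sub>R H (max 0 s) \<omega> \<partial>lborel) \<in> borel_measurable M"
    by measurable
  moreover have "integral {0..t} (\<lambda>s. H s \<omega>) = (\<integral>s. indicator {0..t} s *\<^sub>R H (max 0 s) \<omega> \<partial>lborel)"
    if "\<omega> \<in> space M" for \<omega>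
  proof -
    have "set_integrable lborel {0..t} (\<lambda>s. H s \<omega>)"
      unfolding set_integrable_def
      by (rule borel_integrable_compact) (auto intro: continuous_on_subset[OF c[OF that]])
    then have "integral {0..t} (\<lambda>s. H s \<omega>) = (LINT s:{0..t}|lborel. H s \<omega>)"
      by (simp add: set_borel_integral_eq_integral)
    also have "\<dots> = (\<integral>s. indicator {0..t} s *\<^sub>R H (max 0 s) \<omega> \<partial>lborel)"
      unfolding set_lebesgue_integral_def
      by (rule Bochner_Integration.integral_cong) (auto split: split_indicator simp: max_absorb2)
    finally show ?thesis .
  qed
  ultimately show "(\<lambda>\<omega>. integral {0..t} (\<lambda>s. H s \<omega>)) \<in> borel_measurable M"
    by (simp cong: measurable_cong)
  assume w: "\<omega> \<in> space M"
  show "continuous_on {0..} (\<lambda>t. integral {0..t} (\<lambda>s. H s \<omega>))"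
    by (rule continuous_on_atLeast_if_compact)
      (intro indefinite_integral_continuous_1 integrable_continuous_real continuous_on_subset[OF c[OF w]], auto)
qed

lemma uniformly_close:
  fixes f :: "real \<Rightarrow> real"
  assumes c: "continuous_on {0..} f" and e: "0 < \<epsilon>"
  shows "\<forall>\<^sub>F n in sequentially. \<forall>x\<in>{0..T}. \<forall>y\<in>{0..T}. \<bar>x - y\<bar> \<le> 1 / 2 ^ n \<longrightarrow> \<bar>f x - f y\<bar> \<le> \<epsilon>"
proof -
  have "continuous_on {0..T} f" by (rule continuous_on_subset[OF c]) auto
  then have "uniformly_continuous_on {0..T} f" by (rule compact_uniformly_continuous) simp
  then obtain d where d: "0 < d" "\<And>x y. x \<in> {0..T} \<Longrightarrow> y \<in> {0..T} \<Longrightarrow> dist y x < d \<Longrightarrow> dist (f y) (f x) < \<epsilon>"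
    using e unfolding uniformly_continuous_on_def by metis
  have "(\<lambda>n. 1 / 2 ^ n :: real) \<longlonglongrightarrow> 0" using LIMSEQ_power_zero[of "1 / 2 :: real"] by (simp add: power_one_over)
  then have "\<forall>\<^sub>F n in sequentially. 1 / 2 ^ n < d" by (rule order_tendstoD(2)) (rule d(1))
  then show ?thesis
  proof eventually_elim
    case (elim n)
    then show ?case using d(2) by (force simp: dist_real_def abs_minus_commute less_imp_le)
  qed
qed

lemma dyadic_step_value:
  fixes f :: "real \<Rightarrow> real"
  assumes s: "0 < s" "s \<le> real n"
  obtains x where "0 \<le> x" "x < s" "s \<le> x + 1 / 2 ^ n"
    "(\<Sum>k<n * 2 ^ n. f (real k / 2 ^ n) * indicator {real k / 2 ^ n<..real (Suc k) / 2 ^ n} s) = f x"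
proof -
  \<comment> \<open>Cells are open on the left, as in \<open>simple_process\<close>: a grid point
    belongs to the cell on its left, whence the \<open>- 1\<close> after the ceiling, and time 0
    belongs to no cell.\<close>
  define k0 where "k0 = nat (\<lceil>s * 2 ^ n\<rceil> - 1)"
  have "0 < s * 2 ^ n" using s by simp
  then have "1 \<le> \<lceil>s * 2 ^ n\<rceil>" by linarith
  then have k0: "int k0 = \<lceil>s * 2 ^ n\<rceil> - 1" by (simp add: k0_def)
  have iff: "real k < s * 2 ^ n \<and> s * 2 ^ n \<le> real (Suc k) \<longleftrightarrow> k = k0" for k
  proof -
    have "real k < s * 2 ^ n \<and> s * 2 ^ n \<le> real (Suc k) \<longleftrightarrow> \<lceil>s * 2 ^ n\<rceil> = int k + 1"
      by (simp add: ceiling_eq_iff add.commute)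
    then show ?thesis using k0 by auto
  qed
  have in_iff: "s \<in> {real k / 2 ^ n<..real (Suc k) / 2 ^ n} \<longleftrightarrow> k = k0" for k
    unfolding iff[symmetric] by (auto simp: field_simps)
  have k0lt: "k0 < n * 2 ^ n"
  proof -
    have "real k0 < s * 2 ^ n" using iff[of k0] by simp
    also have "\<dots> \<le> real n * 2 ^ n" using s by simp
    also have "\<dots> = real (n * 2 ^ n)" by simp
    finally show ?thesis by (simp only: of_nat_less_iff)
  qed
  have "(\<Sum>k<n * 2 ^ n. f (real k / 2 ^ n) * indicator {real k / 2 ^ n<..real (Suc k) / 2 ^ n} s)
      = (\<Sum>k<n * 2 ^ n. if k = k0 then f (real k / 2 ^ n) else 0)"
    by (intro sum.cong refl) (use in_iff in \<open>auto simp: indicator_def\<close>)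
  also have "\<dots> = f (real k0 / 2 ^ n)" using k0lt by simp
  finally have "(\<Sum>k<n * 2 ^ n. f (real k / 2 ^ n) * indicator {real k / 2 ^ n<..real (Suc k) / 2 ^ n} s) = f (real k0 / 2 ^ n)" .
  then show ?thesis
    using in_iff[of k0] by (intro that[of "real k0 / 2 ^ n"]) (auto simp: add_divide_distrib add.commute)
qed

lemma dyadic_step_tendsto:
  fixes f :: "real \<Rightarrow> real"
  assumes c: "continuous_on {0..} f"
  shows "(\<lambda>n. \<integral>\<^sup>+s\<in>{0..real T}. ennreal (((\<Sum>k<n * 2 ^ n. f (real k / 2 ^ n) * indicator {real k / 2 ^ n<..real (Suc k) / 2 ^ n} s) - f s)\<^sup>2) \<partial>lborel) \<longlonglongrightarrow> 0"
    (is "?r \<longlonglongrightarrow> 0")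
proof (rule order_tendstoI)
  fix e :: ennreal assume e: "0 < e"
  obtain e' :: real where e': "0 < e'" "ennreal e' < e"
  proof (cases e)
    case (real x)
    then show ?thesis using e by (intro that[of "x / 2"]) (auto simp: ennreal_less_iff)
  qed (auto intro: that[of 1])
  define \<epsilon> where "\<epsilon> = sqrt (e' / (real T + 1))"
  have eps: "0 < \<epsilon>" "\<epsilon>\<^sup>2 = e' / (real T + 1)" using e' by (auto simp: \<epsilon>_def)
  show "\<forall>\<^sub>F n in sequentially. ?r n < e"
    using uniformly_close[OF c eps(1), of "real T"] eventually_ge_at_top[of T]
  proof eventually_elim
    case (elim n)
    \<comment> \<open>At time 0 the step function is 0 whatever \<open>f 0\<close> is, so this point
      is discarded as a null set.\<close>
    have "AE s in lborel. s \<noteq> (0::real)" by (rule AE_lborel_singleton)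
    then have "?r n \<le> (\<integral>\<^sup>+s. ennreal (\<epsilon>\<^sup>2) * indicator {0..real T} s \<partial>lborel)"
    proof (intro nn_integral_mono_AE, eventually_elim)
      case (elim s)
      show ?case
      proof (cases "s \<in> {0..real T}")
        case True
        then have s: "0 < s" "s \<le> real n" using elim \<open>T \<le> n\<close> by auto
        obtain x where x: "0 \<le> x" "x < s" "s \<le> x + 1 / 2 ^ n"
          "(\<Sum>k<n * 2 ^ n. f (real k / 2 ^ n) * indicator {real k / 2 ^ n<..real (Suc k) / 2 ^ n} s) = f x"
          by (rule dyadic_step_value[OF s])
        have "\<bar>f x - f s\<bar> \<le> \<epsilon>"
          using \<open>\<forall>x\<in>{0..real T}. \<forall>y\<in>{0..real T}. \<bar>x - y\<bar> \<le> 1 / 2 ^ n \<longrightarrow> \<bar>f x - f y\<bar> \<le> \<epsilon>\<close> x True by auto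
        then have "(f x - f s)\<^sup>2 \<le> \<epsilon>\<^sup>2" using eps(1) by (simp add: abs_le_square_iff[symmetric])
        then have "ennreal ((f x - f s)\<^sup>2) * indicator {0..real T} s \<le> ennreal (\<epsilon>\<^sup>2) * indicator {0..real T} s"
          by (intro mult_right_mono ennreal_leI) auto
        then show ?thesis unfolding x(4) .
      qed simp
    qed
    also have "\<dots> = ennreal (\<epsilon>\<^sup>2 * real T)"
      by (subst nn_integral_cmult_indicator) (auto simp: ennreal_mult)
    also have "\<dots> \<le> ennreal e'"
      using e' by (intro ennreal_leI) (simp add: eps(2) field_simps)
    finally show ?case using e'(2) by simp
  qed
qed simp

lemma dyadic_Riemann_sum:
  fixes f :: "real \<Rightarrow> real"
  assumes c: "continuous_on {0..} f" and K: "\<forall>\<^sub>F n in sequentially. real (K n) / 2 ^ n = q"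
  shows "(\<lambda>n. (\<Sum>k<K n. f (real k / 2 ^ n)) / 2 ^ n) \<longlonglongrightarrow> integral {0..q} f"
proof (rule tendstoI)
  fix e :: real assume e: "0 < e"
  define \<epsilon> where "\<epsilon> = e / (\<bar>q\<bar> + 1)"
  have eps: "0 < \<epsilon>" using e by (simp add: \<epsilon>_def)
  show "\<forall>\<^sub>F n in sequentially. dist ((\<Sum>k<K n. f (real k / 2 ^ n)) / 2 ^ n) (integral {0..q} f) < e"
    using uniformly_close[OF c eps, of q] K
  proof eventually_elim
    case (elim n)
    define h :: real where "h = 1 / 2 ^ n"
    have h: "0 < h" "real k / 2 ^ n = real k * h" for k by (simp_all add: h_def)
    have int: "f integrable_on {a..b}" if "0 \<le> a" for a b
      using that by (intro integrable_continuous_real continuous_on_subset[OF c]) auto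
    have "\<bar>integral {0..real m * h} f - (\<Sum>k<m. f (real k * h)) * h\<bar> \<le> \<epsilon> * (real m * h)" if "m \<le> K n" for m
      using that
    proof (induction m)
      case (Suc m)
      let ?a = "real m * h" and ?b = "real (Suc m) * h"
      have ab: "0 \<le> ?a" "?a \<le> ?b" "?b - ?a = h" using h by (auto simp: algebra_simps)
      have "?b \<le> real (K n) * h" using Suc.prems h(1) by (intro mult_right_mono) auto
      then have bq: "?b \<le> q" using elim(2) by (simp add: h_def)
      have comb: "integral {0..?b} f = integral {0..?a} f + integral {?a..?b} f"
        using Henstock_Kurzweil_Integration.integral_combine[OF ab(1,2) int] by simp
      have "integral {?a..?b} (\<lambda>s. f s - f ?a) = integral {?a..?b} f - f ?a * h"
        using ab int[OF ab(1), of ?b] by (subst Henstock_Kurzweil_Integration.integral_diff) (auto simp: mult.commute)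
      moreover have "norm (integral {?a..?b} (\<lambda>s. f s - f ?a)) \<le> \<epsilon> * (?b - ?a)"
      proof (rule integral_bound)
        show "continuous_on {?a..?b} (\<lambda>s. f s - f ?a)"
          using ab by (intro continuous_intros continuous_on_subset[OF c]) auto
        show "norm (f s - f ?a) \<le> \<epsilon>" if "s \<in> {?a..?b}" for s
        proof -
          have "s \<in> {0..q}" "?a \<in> {0..q}" "\<bar>s - ?a\<bar> \<le> 1 / 2 ^ n"
            using that ab bq order_trans[OF ab(1), of s] order_trans[OF _ bq, of s] order_trans[OF ab(2) bq]
            unfolding h_def[symmetric] by (simp_all del: of_nat_Suc)
          then show ?thesis using elim(1) by simp
        qed
      qed (rule ab)
      ultimately have "\<bar>integral {?a..?b} f - f ?a * h\<bar> \<le> \<epsilon> * h" using ab by simp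
      then have "\<bar>integral {0..?b} f - (\<Sum>k<Suc m. f (real k * h)) * h\<bar> \<le> \<epsilon> * (real m * h) + \<epsilon> * h"
        using Suc unfolding comb by (simp add: algebra_simps)
      then show ?case by (simp add: algebra_simps)
    qed simp
    from this[of "K n"] have "\<bar>integral {0..q} f - (\<Sum>k<K n. f (real k / 2 ^ n)) / 2 ^ n\<bar> \<le> \<epsilon> * q"
      using elim(2) by (simp add: h_def)
    also have "\<epsilon> * q \<le> \<epsilon> * \<bar>q\<bar>" using eps by simp
    also have "\<dots> < e" using e by (simp add: \<epsilon>_def field_simps)
    finally show ?case by (simp add: dist_real_def abs_minus_commute)
  qed
qed

section \<open>Almost sure convergence from summable bounds\<close>

context prob_space
begin

lemma borel_cantelli_eventually:
  assumes A: "\<And>n. A n \<in> sets M" and le: "\<And>n. prob (A n) \<le> b n" and b: "summable b"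
  shows "AE \<omega> in M. \<forall>\<^sub>F n in sequentially. \<omega> \<notin> A n"
proof -
  have "summable (\<lambda>n. prob (A n))"
    by (rule summable_comparison_test'[OF b, of 0]) (use le in simp)
  then have "AE \<omega> in M. \<forall>\<^sub>F n in sequentially. \<omega> \<in> space M - A n"
    using A by (intro borel_cantelli_AE1) (auto simp: emeasure_eq_measure)
  then show ?thesis by eventually_elim (auto elim: eventually_mono)
qed

text \<open>Summable second moments make the sum of all squares integrable, hence finite almost
  surely, so its terms tend to 0 along the whole sequence.\<close>

lemma AE_tendsto_0_if_L2_summable:
  fixes R :: "nat \<Rightarrow> 'a \<Rightarrow> real"
  assumes R: "\<And>n. R n \<in> borel_measurable M"
    and le: "\<And>n. (\<integral>\<^sup>+\<omega>. ennreal ((R n \<omega>)\<^sup>2) \<partial>M) \<le> ennreal (b n)" and b: "summable b" "\<And>n. 0 \<le> b n"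
  shows "AE \<omega> in M. (\<lambda>n. R n \<omega>) \<longlonglongrightarrow> 0"
proof -
  note [measurable] = R
  have "(\<integral>\<^sup>+\<omega>. (\<Sum>n. ennreal ((R n \<omega>)\<^sup>2)) \<partial>M) = (\<Sum>n. \<integral>\<^sup>+\<omega>. ennreal ((R n \<omega>)\<^sup>2) \<partial>M)"
    by (rule nn_integral_suminf) measurable
  also have "\<dots> \<le> (\<Sum>n. ennreal (b n))" by (intro suminf_le le) auto
  also have "\<dots> < \<infinity>" using b by (simp add: suminf_ennreal2)
  finally have "AE \<omega> in M. (\<Sum>n. ennreal ((R n \<omega>)\<^sup>2)) \<noteq> \<infinity>"
    by (intro nn_integral_noteq_infinite) auto
  then show ?thesis
  proof eventually_elim
    case (elim \<omega>)
    then have "summable (\<lambda>n. (R n \<omega>)\<^sup>2)" by (intro summable_suminf_not_top) auto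
    then have "(\<lambda>n. (R n \<omega>)\<^sup>2) \<longlonglongrightarrow> 0" by (rule summable_LIMSEQ_zero)
    then have "(\<lambda>n. sqrt ((R n \<omega>)\<^sup>2)) \<longlonglongrightarrow> sqrt 0" by (rule tendsto_real_sqrt)
    then show ?case by (simp add: tendsto_rabs_zero_iff)
  qed
qed

end

context brownian_filtration
begin

text \<open>Diagonal choice: \<open>\<rho> m\<close> is taken so far out that, on the horizon
  \<open>m\<close> and at every point of \<open>dyadics m\<close>, an error above
  \<open>(1/2)^m\<close> has probability below \<open>(1/2)^m\<close>. By Borel--Cantelli,
  convergence in probability becomes almost sure at all dyadic times simultaneously.\<close>

lemma ito_pair_of_integral_process:
  assumes ito: "ito_integral_process M F B H I"
    and Hm: "\<And>t. 0 \<le> t \<Longrightarrow> H t \<in> borel_measurable M"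
    and Hc: "\<And>\<omega>. \<omega> \<in> space M \<Longrightarrow> continuous_on {0..} (\<lambda>t. H t \<omega>)"
  shows "ito_pair H I"
proof -
  from ito obtain k \<tau> \<xi> where
    data: "\<And>n::nat. simple_process_data M F (k n) (\<tau> n) (\<xi> n)"
    and r0: "\<forall>T\<ge>0. \<forall>\<epsilon>>0. (\<lambda>n. prob {\<omega>\<in>space M. ennreal \<epsilon> <
        sq_int (\<lambda>s \<omega>. simple_process (k n) (\<tau> n) (\<xi> n) s \<omega> - H s \<omega>) 0 T \<omega>}) \<longlonglongrightarrow> 0"
    and i0: "\<forall>t\<ge>0. \<forall>\<epsilon>>0. (\<lambda>n. prob {\<omega>\<in>space M. \<epsilon> < \<bar>simple_integral (k n) (\<tau> n) (\<xi> n) B t \<omega> - I t \<omega>\<bar>}) \<longlonglongrightarrow> 0"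
    and Ia: "adapted F I" and Ic: "\<forall>\<omega>\<in>space M. continuous_on {0..} (\<lambda>t. I t \<omega>)"
    unfolding ito_integral_process_def by blast
  define S where "S n = simple_process (k n) (\<tau> n) (\<xi> n)" for n
  define N where "N n = simple_integral (k n) (\<tau> n) (\<xi> n) B" for n
  have el: "elementary (S n) (N n)" for n
    unfolding S_def N_def using data[of n] by (intro elementary_simple) (auto simp: simple_process_data_def)
  have Im: "0 \<le> t \<Longrightarrow> I t \<in> borel_measurable M" for t
    using Ia measurable_F unfolding adapted_def by blast
  have Nm: "0 \<le> t \<Longrightarrow> N n t \<in> borel_measurable M" for n t
    using el[of n] unfolding elementary_def by blast
  have jm: "(\<lambda>(s, \<omega>). S n (max 0 s) \<omega> - H (max 0 s) \<omega>) \<in> borel_measurable (borel \<Otimes>\<^sub>M M)" for n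
    using borel_measurable_diff[OF elementary_jointly_measurable[OF el[of n]] continuous_process_jointly_measurable[OF Hm Hc]]
    by (simp add: case_prod_beta')
  define r where "r n T = sq_int (\<lambda>s \<omega>. S n s \<omega> - H s \<omega>) 0 T" for n T
  have rm [measurable]: "r n T \<in> borel_measurable M" for n T
    unfolding r_def by (rule sq_int_measurable) (use jm in auto)
  have ex: "\<exists>n. prob {\<omega>\<in>space M. ennreal ((1/2)^m) < r n (real m) \<omega>} < (1/2)^m \<and>
      (\<forall>q\<in>dyadics m. prob {\<omega>\<in>space M. (1/2)^m < \<bar>N n q \<omega> - I q \<omega>\<bar>} < (1/2)^m)" for m :: nat
  proof -
    have "(\<lambda>n. prob {\<omega>\<in>space M. ennreal ((1/2)^m) < r n (real m) \<omega>}) \<longlonglongrightarrow> 0"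
      using r0 unfolding r_def S_def by simp
    then have "\<forall>\<^sub>F n in sequentially. prob {\<omega>\<in>space M. ennreal ((1/2)^m) < r n (real m) \<omega>} < (1/2)^m"
      by (rule order_tendstoD(2)) simp
    moreover have "\<forall>\<^sub>F n in sequentially. \<forall>q\<in>dyadics m. prob {\<omega>\<in>space M. (1/2)^m < \<bar>N n q \<omega> - I q \<omega>\<bar>} < (1/2)^m"
    proof (rule eventually_ball_finite[OF finite_dyadics], rule ballI)
      fix q assume "q \<in> dyadics m"
      then have "(\<lambda>n. prob {\<omega>\<in>space M. (1/2)^m < \<bar>N n q \<omega> - I q \<omega>\<bar>}) \<longlonglongrightarrow> 0"
        using i0 dyadics_nonneg unfolding N_def by simp
      then show "\<forall>\<^sub>F n in sequentially. prob {\<omega>\<in>space M. (1/2)^m < \<bar>N n q \<omega> - I q \<omega>\<bar>} < (1/2)^m"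
        by (rule order_tendstoD(2)) simp
    qed
    ultimately show ?thesis
      using eventually_happens'[OF sequentially_bot] eventually_conj by blast
  qed
  from choice[OF allI[OF ex]] obtain \<rho> where
    "\<forall>m. prob {\<omega>\<in>space M. ennreal ((1/2)^m) < r (\<rho> m) (real m) \<omega>} < (1/2)^m \<and>
      (\<forall>q\<in>dyadics m. prob {\<omega>\<in>space M. (1/2)^m < \<bar>N (\<rho> m) q \<omega> - I q \<omega>\<bar>} < (1/2)^m)" ..
  then have \<rho>1: "\<And>m. prob {\<omega>\<in>space M. ennreal ((1/2)^m) < r (\<rho> m) (real m) \<omega>} < (1/2)^m"
    and \<rho>2: "\<And>m q. q \<in> dyadics m \<Longrightarrow> prob {\<omega>\<in>space M. (1/2)^m < \<bar>N (\<rho> m) q \<omega> - I q \<omega>\<bar>} < (1/2)^m"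
    by simp_all
  have sm: "summable (\<lambda>m. (1/2)^m :: real)" by simp
  have ae1: "AE \<omega> in M. \<forall>\<^sub>F m in sequentially. \<omega> \<notin> {\<omega>\<in>space M. ennreal ((1/2)^m) < r (\<rho> m) (real m) \<omega>}"
    using \<rho>1 by (intro borel_cantelli_eventually[OF _ _ sm]) (auto simp: less_imp_le)
  have ae2: "AE \<omega> in M. \<forall>q\<in>(\<Union>n. dyadics n). \<forall>\<^sub>F m in sequentially. \<bar>N (\<rho> m) q \<omega> - I q \<omega>\<bar> \<le> (1/2)^m"
  proof (rule AE_ball_countable')
    show "countable (\<Union>n. dyadics n)"
      by (intro countable_UN countableI_type countable_finite finite_dyadics)
    fix q assume "q \<in> (\<Union>n. dyadics n)"
    then obtain n where n: "q \<in> dyadics n" by auto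
    then have q0: "0 \<le> q" using dyadics_nonneg by blast
    \<comment> \<open>\<open>q\<close> is known to lie in \<open>dyadics m\<close> only from
      \<open>m = n\<close> on; the earlier events are replaced by the empty set so that the bound
      holds for every \<open>m\<close>.\<close>
    let ?A = "\<lambda>m. if n \<le> m then {\<omega>\<in>space M. (1/2)^m < \<bar>N (\<rho> m) q \<omega> - I q \<omega>\<bar>} else {}"
    have "AE \<omega> in M. \<forall>\<^sub>F m in sequentially. \<omega> \<notin> ?A m"
    proof (rule borel_cantelli_eventually[OF _ _ sm])
      fix m
      note [measurable] = Nm[OF q0] Im[OF q0]
      show "?A m \<in> sets M" by simp
      show "prob (?A m) \<le> (1/2)^m"
        using \<rho>2[of q m] dyadics_mono[of n m] n by (auto simp: less_imp_le subset_eq)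
    qed
    then show "AE \<omega> in M. \<forall>\<^sub>F m in sequentially. \<bar>N (\<rho> m) q \<omega> - I q \<omega>\<bar> \<le> (1/2)^m"
      using AE_space
    proof eventually_elim
      case (elim \<omega>)
      from elim(1) eventually_ge_at_top[of n] show ?case
        by eventually_elim (use elim(2) in \<open>auto simp: not_less\<close>)
    qed
  qed
  have "AE \<omega> in M. (\<forall>T::nat. (\<lambda>m. sq_int (\<lambda>s \<omega>. S (\<rho> m) s \<omega> - H s \<omega>) 0 (real T) \<omega>) \<longlonglongrightarrow> 0) \<and>
           (\<forall>k. \<forall>q\<in>dyadics k. (\<lambda>m. N (\<rho> m) q \<omega>) \<longlonglongrightarrow> I q \<omega>)"
    using ae1 ae2 AE_space
  proof eventually_elim
    case (elim \<omega>)
    have half: "(\<lambda>m. (1/2)^m :: real) \<longlonglongrightarrow> 0" by (rule LIMSEQ_power_zero) simp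
    have "(\<lambda>m. r (\<rho> m) (real T) \<omega>) \<longlonglongrightarrow> 0" for T :: nat
    proof (rule tendsto_sandwich[OF _ _ tendsto_const])
      show "(\<lambda>m. ennreal ((1/2)^m)) \<longlonglongrightarrow> 0" using tendsto_ennrealI[OF half] by simp
      show "\<forall>\<^sub>F m in sequentially. r (\<rho> m) (real T) \<omega> \<le> ennreal ((1/2)^m)"
        using elim(1) eventually_ge_at_top[of T]
      proof eventually_elim
        case (elim m)
        have "r (\<rho> m) (real T) \<omega> \<le> r (\<rho> m) (real m) \<omega>"
          unfolding r_def using elim(2) by (intro nn_integral_mono) (auto split: split_indicator)
        also have "\<dots> \<le> ennreal ((1/2)^m)" using elim(1) \<open>\<omega> \<in> space M\<close> by (auto simp: not_less)
        finally show ?case .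
      qed
    qed simp
    moreover have "(\<lambda>m. N (\<rho> m) q \<omega>) \<longlonglongrightarrow> I q \<omega>" if "q \<in> dyadics k" for q k
    proof -
      have "\<forall>\<^sub>F m in sequentially. norm (N (\<rho> m) q \<omega> - I q \<omega>) \<le> (1/2)^m"
        using elim(2) that by auto
      then have "(\<lambda>m. N (\<rho> m) q \<omega> - I q \<omega>) \<longlonglongrightarrow> 0" by (rule Lim_null_comparison[OF _ half])
      then show ?thesis by (simp add: LIM_zero_iff)
    qed
    ultimately show ?case unfolding r_def by blast
  qed
  then show ?thesis
    unfolding ito_pair_def using Hm Hc Im Ic el
    by (intro conjI exI[of _ "\<lambda>m. S (\<rho> m)"] exI[of _ "\<lambda>m. N (\<rho> m)"]) auto
qed

text \<open>This makes Lenglart's inequality available for \<open>B\<close> itself. The approximants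
  are the indicators of \<open>{0<..real n}\<close> with integrals
  \<open>B (min t (real n))\<close>; on a bounded horizon they are exact for large \<open>n\<close>,
  up to the time 0.\<close>

lemma ito_pair_one: "ito_pair (\<lambda>_ _. 1) B"
proof -
  let ?\<tau> = "\<lambda>n j. if j = 0 then 0 else real n" and ?\<xi> = "\<lambda>_ _. 1 :: real"
  have H: "simple_process 1 (?\<tau> n) ?\<xi> s \<omega> = indicator {0<..real n} s" for n s \<omega>
    by (simp add: simple_process_def)
  have I: "simple_integral 1 (?\<tau> n) ?\<xi> B t \<omega> = B (min t (real n)) \<omega>" if "\<omega> \<in> space M" "0 \<le> t" for n t \<omega>
    using that by (simp add: simple_integral_def B_zero min_absorb2)
  have "\<And>n. elementary (simple_process 1 (?\<tau> n) ?\<xi>) (simple_integral 1 (?\<tau> n) ?\<xi> B)"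
    by (rule elementary_simple) auto
  moreover have "AE \<omega> in M. (\<forall>T::nat. (\<lambda>n. sq_int (\<lambda>s \<omega>. simple_process 1 (?\<tau> n) ?\<xi> s \<omega> - 1) 0 (real T) \<omega>) \<longlonglongrightarrow> 0) \<and>
           (\<forall>k. \<forall>q\<in>dyadics k. (\<lambda>n. simple_integral 1 (?\<tau> n) ?\<xi> B q \<omega>) \<longlonglongrightarrow> B q \<omega>)"
  proof (rule AE_I2, intro conjI allI ballI)
    fix \<omega> and T :: nat assume w: "\<omega> \<in> space M"
    have "sq_int (\<lambda>s \<omega>. simple_process 1 (?\<tau> n) ?\<xi> s \<omega> - 1) 0 (real T) \<omega> = 0" if "T \<le> n" for n
    proof -
      have "AE s in lborel. s \<noteq> (0::real)" by (rule AE_lborel_singleton)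
      then have "AE s in lborel. ennreal ((simple_process 1 (?\<tau> n) ?\<xi> s \<omega> - 1)\<^sup>2) * indicator {0..real T} s = 0"
        unfolding H by eventually_elim (use that in \<open>auto split: split_indicator\<close>)
      then show ?thesis unfolding H by (subst nn_integral_0_iff_AE) auto
    qed
    then show "(\<lambda>n. sq_int (\<lambda>s \<omega>. simple_process 1 (?\<tau> n) ?\<xi> s \<omega> - 1) 0 (real T) \<omega>) \<longlonglongrightarrow> 0"
      by (intro tendsto_eventually) (auto simp: eventually_sequentially)
  next
    fix \<omega> k q assume w: "\<omega> \<in> space M" and "q \<in> dyadics k"
    then have q: "0 \<le> q" using dyadics_nonneg by blast
    have "\<forall>\<^sub>F n in sequentially. q \<le> real n"
      using real_arch_simple[of q] by (metis eventually_sequentially of_nat_le_iff order_trans)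
    then have "\<forall>\<^sub>F n in sequentially. simple_integral 1 (?\<tau> n) ?\<xi> B q \<omega> = B q \<omega>"
      by eventually_elim (simp only: I[OF w q] min_absorb1)
    then show "(\<lambda>n. simple_integral 1 (?\<tau> n) ?\<xi> B q \<omega>) \<longlonglongrightarrow> B q \<omega>"
      by (rule tendsto_eventually)
  qed
  ultimately show ?thesis
    unfolding ito_pair_def using B_measurable B_continuous
    by (intro conjI exI[of _ "\<lambda>n. simple_process 1 (?\<tau> n) ?\<xi>"] exI[of _ "\<lambda>n. simple_integral 1 (?\<tau> n) ?\<xi> B"]) auto
qed

end

section \<open>The linear stochastic differential equation\<close>

lemma dyadic_mesh_tendsto_0: "(\<lambda>n. 1 / 2 ^ n :: real) \<longlonglongrightarrow> 0"
  using LIMSEQ_power_zero[of "1 / 2 :: real"] by (simp add: power_one_over)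

lemma exp_difference_quotient:
  fixes lam :: real
  shows "(\<lambda>n. (exp (lam / 2 ^ n) - 1) * 2 ^ n) \<longlonglongrightarrow> lam"
proof -
  have "((\<lambda>x. exp (lam * x)) has_real_derivative lam) (at 0)"
    by (auto intro!: derivative_eq_intros)
  then have "((\<lambda>h. (exp (lam * h) - 1) / h) \<longlongrightarrow> lam) (at 0)"
    by (simp add: DERIV_def)
  moreover have "filterlim (\<lambda>n. 1 / 2 ^ n :: real) (at 0) sequentially"
    using dyadic_mesh_tendsto_0 by (auto simp: filterlim_at)
  ultimately have "(\<lambda>n. (exp (lam * (1 / 2 ^ n)) - 1) / (1 / 2 ^ n)) \<longlonglongrightarrow> lam"
    by (rule filterlim_compose)
  then show ?thesis by simp
qed

text \<open>Along the integers the increments are summable, so the values converge; in between the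
  path stays within \<open>b (nat \<lfloor>t\<rfloor>)\<close> of them, which tends to 0.\<close>

lemma tendsto_at_top_if_summable_oscillation:
  fixes f :: "real \<Rightarrow> 'a::banach"
  assumes ev: "\<forall>\<^sub>F n in sequentially. \<forall>t\<in>{real n..real n + 1}. norm (f t - f (real n)) \<le> b n"
    and b: "summable b"
  shows "\<exists>l. (f \<longlongrightarrow> l) at_top"
proof -
  have "\<forall>\<^sub>F n in sequentially. norm (f (real (Suc n)) - f (real n)) \<le> b n"
    using ev by eventually_elim (auto simp: add.commute)
  then have "summable (\<lambda>n. f (real (Suc n)) - f (real n))"
    using b by (rule summable_comparison_test_ev)
  then have "convergent (\<lambda>n. \<Sum>k<n. f (real (Suc k)) - f (real k))"
    by (simp add: summable_iff_convergent)
  then have "convergent (\<lambda>n. f (real n) - f (real 0))"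
    by (simp only: sum_lessThan_telescope[of "\<lambda>k. f (real k)"])
  then obtain l where "(\<lambda>n. f (real n) - f (real 0)) \<longlonglongrightarrow> l" by (auto simp: convergent_def)
  then have "(\<lambda>n. f (real n) - f (real 0) + f (real 0)) \<longlonglongrightarrow> l + f (real 0)"
    by (intro tendsto_add tendsto_const)
  then have lim: "(\<lambda>n. f (real n)) \<longlonglongrightarrow> l + f 0" by simp
  have fl: "filterlim (\<lambda>t::real. nat \<lfloor>t\<rfloor>) sequentially at_top"
    unfolding filterlim_at_top
  proof
    fix N :: nat
    show "\<forall>\<^sub>F t::real in at_top. N \<le> nat \<lfloor>t\<rfloor>"
      using eventually_ge_at_top[of "real N"] by eventually_elim linarith
  qed
  have "((\<lambda>t. f t - f (real (nat \<lfloor>t\<rfloor>))) \<longlongrightarrow> 0) at_top"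
  proof (rule Lim_null_comparison)
    have "\<forall>\<^sub>F t::real in at_top. \<forall>u\<in>{real (nat \<lfloor>t\<rfloor>)..real (nat \<lfloor>t\<rfloor>) + 1}. norm (f u - f (real (nat \<lfloor>t\<rfloor>))) \<le> b (nat \<lfloor>t\<rfloor>)"
      by (rule fl[unfolded filterlim_iff, rule_format, OF ev])
    then show "\<forall>\<^sub>F t in at_top. norm (f t - f (real (nat \<lfloor>t\<rfloor>))) \<le> b (nat \<lfloor>t\<rfloor>)"
      using eventually_ge_at_top[of 0]
    proof eventually_elim
      case (elim t)
      have "t \<in> {real (nat \<lfloor>t\<rfloor>)..real (nat \<lfloor>t\<rfloor>) + 1}" using elim(2) by auto
      then show ?case using elim(1) by blast
    qed
    show "((\<lambda>t::real. b (nat \<lfloor>t\<rfloor>)) \<longlongrightarrow> 0) at_top"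
      by (rule filterlim_compose[OF summable_LIMSEQ_zero[OF b] fl])
  qed
  moreover have "((\<lambda>t::real. f (real (nat \<lfloor>t\<rfloor>))) \<longlongrightarrow> l + f 0) at_top"
    by (rule filterlim_compose[OF lim fl])
  ultimately have "((\<lambda>t. f t - f (real (nat \<lfloor>t\<rfloor>)) + f (real (nat \<lfloor>t\<rfloor>))) \<longlongrightarrow> 0 + (l + f 0)) at_top"
    by (rule tendsto_add)
  then show ?thesis by auto
qed

section \<open>Geometric Brownian motion: exact solution and long-time behaviour\<close>

context brownian_filtration
begin

text \<open>Geometric Brownian motion with drift \<open>- lam\<close> and volatility
  \<open>\<sigma>\<close>; the term \<open>\<sigma>\<^sup>2 / 2\<close> is the Ito
  correction.\<close>

definition geom :: "real \<Rightarrow> real \<Rightarrow> real \<Rightarrow> 'w \<Rightarrow> real" where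
  "geom lam \<sigma> t \<omega> = exp (- (lam + \<sigma>\<^sup>2 / 2) * t + \<sigma> * B t \<omega>)"

lemma geom_adapted: "0 \<le> t \<Longrightarrow> geom lam \<sigma> t \<in> borel_measurable (F t)"
  unfolding geom_def using B_adapted[of t] by measurable

lemma geom_measurable: "0 \<le> t \<Longrightarrow> geom lam \<sigma> t \<in> borel_measurable M"
  using geom_adapted measurable_F by blast

lemma geom_continuous: "\<omega> \<in> space M \<Longrightarrow> continuous_on {0..} (\<lambda>t. geom lam \<sigma> t \<omega>)"
  unfolding geom_def by (intro continuous_intros B_continuous)

lemma geom_0: "\<omega> \<in> space M \<Longrightarrow> geom lam \<sigma> 0 \<omega> = 1"
  by (simp add: geom_def B_zero)

text \<open>Squaring doubles the exponent and the Gaussian moment of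
  \<open>2 * \<sigma> * B t\<close> gives back \<open>2 * \<sigma>\<^sup>2 * t\<close>; the sum
  \<open>- (2 * lam + \<sigma>\<^sup>2) + 2 * \<sigma>\<^sup>2\<close> is the rate in (i).\<close>

lemma geom_second_moment:
  assumes t: "0 \<le> t"
  shows "has_bochner_integral M (\<lambda>\<omega>. (geom lam \<sigma> t \<omega>)\<^sup>2) (exp (- (2 * lam - \<sigma>\<^sup>2) * t))"
proof -
  have "has_bochner_integral M (\<lambda>\<omega>. exp (- (2 * lam + \<sigma>\<^sup>2) * t) * exp (2 * \<sigma> * (B t \<omega> - B 0 \<omega>)))
      (exp (- (2 * lam + \<sigma>\<^sup>2) * t) * exp ((2 * \<sigma>)\<^sup>2 * (t - 0) / 2))"
    by (rule has_bochner_integral_mult_right[OF increment_exp_moments(1)[OF order_refl t]])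
  moreover have "exp (- (2 * lam + \<sigma>\<^sup>2) * t) * exp ((2 * \<sigma>)\<^sup>2 * (t - 0) / 2) = exp (- (2 * lam - \<sigma>\<^sup>2) * t)"
    by (simp flip: exp_add add: algebra_simps)
  moreover have "exp (- (2 * lam + \<sigma>\<^sup>2) * t) * exp (2 * \<sigma> * (B t \<omega> - B 0 \<omega>)) = (geom lam \<sigma> t \<omega>)\<^sup>2" if "\<omega> \<in> space M" for \<omega>
    using that by (simp add: geom_def B_zero power2_eq_square algebra_simps flip: exp_add)
  ultimately show ?thesis by (simp cong: has_bochner_integral_cong)
qed

text \<open>A discrete substitute for Ito's formula. Writing \<open>g\<close> and \<open>g'\<close>
  for neighbouring values, \<open>exp (lam * h) * g' = g * exp (\<sigma> * \<Delta> m -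
  \<sigma>\<^sup>2 * h / 2)\<close> holds exactly. Splitting the exponential on the right into
  \<open>1 + \<sigma> * \<Delta> m\<close> and a remainder and solving for
  \<open>\<sigma> * g * \<Delta> m\<close> gives one summand; the differences \<open>g' - g\<close>
  telescope from the initial value 1.\<close>

lemma geom_sum_identity:
  fixes h :: real
  assumes w: "\<omega> \<in> space M"
  defines "\<Delta> \<equiv> \<lambda>k. B (real (Suc k) * h) \<omega> - B (real k * h) \<omega>"
  shows "(\<Sum>k<m. \<sigma> * geom lam \<sigma> (real k * h) \<omega> * \<Delta> k) =
    exp (lam * h) * (geom lam \<sigma> (real m * h) \<omega> - 1) + (exp (lam * h) - 1) * (\<Sum>k<m. geom lam \<sigma> (real k * h) \<omega>)
      - (\<Sum>k<m. geom lam \<sigma> (real k * h) \<omega> * (exp (\<sigma> * \<Delta> k - \<sigma>\<^sup>2 * h / 2) - 1 - \<sigma> * \<Delta> k))"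
proof (induction m)
  case 0
  then show ?case using geom_0[OF w] by simp
next
  case (Suc m)
  let ?g = "geom lam \<sigma> (real m * h) \<omega>" and ?g' = "geom lam \<sigma> (real (Suc m) * h) \<omega>"
  have "exp (lam * h) * ?g' = ?g * exp (\<sigma> * \<Delta> m - \<sigma>\<^sup>2 * h / 2)"
    unfolding geom_def \<Delta>_def exp_add[symmetric] by (rule arg_cong[where f=exp]) (simp add: field_simps)
  then have "\<sigma> * ?g * \<Delta> m = exp (lam * h) * (?g' - ?g) + (exp (lam * h) - 1) * ?g - ?g * (exp (\<sigma> * \<Delta> m - \<sigma>\<^sup>2 * h / 2) - 1 - \<sigma> * \<Delta> m)"
    by (simp add: algebra_simps)
  then show ?case using Suc by (simp add: algebra_simps)
qed

text \<open>The summands are orthogonal with second moments at most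
  \<open>exp (\<sigma>\<^sup>2 * q) * (\<sigma>\<^sup>2 * h)\<^sup>2\<close>, and there are
  \<open>q / h\<close> of them. The second moment of the sum is therefore at most
  \<open>C * h\<close> with \<open>h = 1 / 2 ^ n\<close>, which is summable in
  \<open>n\<close>.\<close>

lemma geom_remainder:
  fixes lam \<sigma> q :: real and K :: "nat \<Rightarrow> nat"
  assumes lam: "0 \<le> lam" and K: "\<And>n. j \<le> n \<Longrightarrow> real (K n) / 2 ^ n = q"
  defines "R \<equiv> \<lambda>n \<omega>. \<Sum>k<K n. geom lam \<sigma> (real k / 2 ^ n) \<omega> *
    (exp (\<sigma> * (B (real (Suc k) / 2 ^ n) \<omega> - B (real k / 2 ^ n) \<omega>) - \<sigma>\<^sup>2 * (1 / 2 ^ n) / 2) - 1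
      - \<sigma> * (B (real (Suc k) / 2 ^ n) \<omega> - B (real k / 2 ^ n) \<omega>))"
  shows "AE \<omega> in M. (\<lambda>n. R n \<omega>) \<longlonglongrightarrow> 0"
proof -
  \<comment> \<open>From \<open>j\<close> on \<open>K n\<close> is tied to \<open>q\<close>, and
    \<open>\<sigma>\<^sup>2 * h \<le> 1\<close> is the range of
    \<open>exp y \<le> 1 + y + y\<^sup>2\<close>. Only finitely many \<open>n\<close> fail, so
    setting \<open>R'\<close> to 0 there does not affect the limit.\<close>
  define good where "good n \<longleftrightarrow> j \<le> n \<and> \<sigma>\<^sup>2 * (1 / 2 ^ n) \<le> 1" for n
  define R' where "R' n \<omega> = (if good n then R n \<omega> else 0)" for n \<omega>
  define C where "C = q * exp (\<sigma>\<^sup>2 * q) * \<sigma> ^ 4"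
  have q0: "0 \<le> q" using K[of j] by (metis divide_nonneg_nonneg of_nat_0_le_iff order_refl zero_le_numeral zero_le_power)
  have ev: "\<forall>\<^sub>F n in sequentially. good n"
  proof -
    have "(\<lambda>n. \<sigma>\<^sup>2 * (1 / 2 ^ n)) \<longlonglongrightarrow> \<sigma>\<^sup>2 * 0" by (intro tendsto_mult dyadic_mesh_tendsto_0 tendsto_const)
    then have "\<forall>\<^sub>F n in sequentially. \<sigma>\<^sup>2 * (1 / 2 ^ n) < 1" by (rule order_tendstoD(2)) simp
    then show ?thesis using eventually_ge_at_top[of j] by eventually_elim (simp add: good_def)
  qed
  have L2: "R n \<in> borel_measurable M \<and> (\<integral>\<^sup>+\<omega>. ennreal ((R n \<omega>)\<^sup>2) \<partial>M) \<le> ennreal (C * (1 / 2) ^ n)" if g: "good n" for n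
  proof -
    define h :: real where "h = 1 / 2 ^ n"
    have h: "0 < h" "\<sigma>\<^sup>2 * h \<le> 1" using g by (auto simp: h_def good_def)
    have Kq: "real (K n) * h = q" using K[of n] g by (simp add: good_def h_def)
    define \<phi> where "\<phi> x = exp (\<sigma> * x - \<sigma>\<^sup>2 * h / 2) - 1 - \<sigma> * x" for x
    define v where "v = exp (\<sigma>\<^sup>2 * h) - 1 - \<sigma>\<^sup>2 * h"
    let ?g = "\<lambda>k. real k / 2 ^ n"
    have gh: "?g (Suc k) - ?g k = h" for k by (simp add: h_def diff_divide_distrib[symmetric])
    have gmono: "0 \<le> ?g k" "?g k \<le> ?g (Suc k)" for k by (auto simp: divide_right_mono)
    have \<phi>m: "\<phi> \<in> borel_measurable borel" unfolding \<phi>_def by measurable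
    have b1: "has_bochner_integral M (\<lambda>\<omega>. \<phi> (B (?g (Suc k)) \<omega> - B (?g k) \<omega>)) 0"
      and b2: "has_bochner_integral M (\<lambda>\<omega>. (\<phi> (B (?g (Suc k)) \<omega> - B (?g k) \<omega>))\<^sup>2) v" for k
      using exp_remainder_moments[OF gmono[of k], of \<sigma>] unfolding gh \<phi>_def v_def by auto
    note s2 = geom_second_moment[of _ lam \<sigma>]
    have R: "R n = (\<lambda>\<omega>. \<Sum>k<K n. geom lam \<sigma> (?g k) \<omega> * \<phi> (B (?g (Suc k)) \<omega> - B (?g k) \<omega>))"
      by (simp add: R_def \<phi>_def h_def)
    have oi: "0 \<le> ?g (K n) \<and> R n \<in> borel_measurable (F (?g (K n))) \<and>
      has_bochner_integral M (\<lambda>\<omega>. (R n \<omega>)\<^sup>2) (\<Sum>k<K n. expectation (\<lambda>\<omega>. (geom lam \<sigma> (?g k) \<omega>)\<^sup>2) * v)"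
      unfolding R
      by (rule orthogonal_increments)
        (use gmono geom_adapted s2 \<phi>m b1 b2 in \<open>auto simp: has_bochner_integral_iff simp del: of_nat_Suc\<close>)
    have "(\<Sum>k<K n. expectation (\<lambda>\<omega>. (geom lam \<sigma> (?g k) \<omega>)\<^sup>2) * v) \<le> (\<Sum>k<K n. exp (\<sigma>\<^sup>2 * q) * (\<sigma>\<^sup>2 * h)\<^sup>2)"
    proof (rule sum_mono)
      fix k assume k: "k \<in> {..<K n}"
      have kq: "?g k \<le> q"
      proof -
        have "?g k \<le> real (K n) / 2 ^ n" using k by (intro divide_right_mono) auto
        then show ?thesis using K[of n] g by (simp add: good_def)
      qed
      have "expectation (\<lambda>\<omega>. (geom lam \<sigma> (?g k) \<omega>)\<^sup>2) = exp (- (2 * lam - \<sigma>\<^sup>2) * ?g k)"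
        using s2[OF gmono(1)[of k]] by (simp only: has_bochner_integral_iff)
      also have "\<dots> \<le> exp (\<sigma>\<^sup>2 * q)"
      proof (rule exp_le_cancel_iff[THEN iffD2])
        have "- (2 * lam - \<sigma>\<^sup>2) * ?g k \<le> \<sigma>\<^sup>2 * ?g k" using lam by (intro mult_right_mono) auto
        also have "\<dots> \<le> \<sigma>\<^sup>2 * q" using kq by (intro mult_left_mono) auto
        finally show "- (2 * lam - \<sigma>\<^sup>2) * ?g k \<le> \<sigma>\<^sup>2 * q" .
      qed
      finally have e: "expectation (\<lambda>\<omega>. (geom lam \<sigma> (?g k) \<omega>)\<^sup>2) \<le> exp (\<sigma>\<^sup>2 * q)" .
      have "0 \<le> \<sigma>\<^sup>2 * h" using h by simp
      then have v: "0 \<le> v" "v \<le> (\<sigma>\<^sup>2 * h)\<^sup>2"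
        using exp_bound[of "\<sigma>\<^sup>2 * h"] exp_ge_add_one_self[of "\<sigma>\<^sup>2 * h"] h unfolding v_def by linarith+
      show "expectation (\<lambda>\<omega>. (geom lam \<sigma> (?g k) \<omega>)\<^sup>2) * v \<le> exp (\<sigma>\<^sup>2 * q) * (\<sigma>\<^sup>2 * h)\<^sup>2"
        using e v by (intro mult_mono) auto
    qed
    also have "\<dots> = real (K n) * h * exp (\<sigma>\<^sup>2 * q) * \<sigma> ^ 4 * h"
      by (simp add: power2_eq_square power4_eq_xxxx)
    also have "\<dots> = C * (1 / 2) ^ n" unfolding Kq C_def by (simp add: h_def power_one_over)
    finally have le: "(\<Sum>k<K n. expectation (\<lambda>\<omega>. (geom lam \<sigma> (?g k) \<omega>)\<^sup>2) * v) \<le> C * (1 / 2) ^ n" .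
    have "R n \<in> borel_measurable M" using oi measurable_F by blast
    moreover have "(\<integral>\<^sup>+\<omega>. ennreal ((R n \<omega>)\<^sup>2) \<partial>M) \<le> ennreal (C * (1 / 2) ^ n)"
      using oi le by (subst nn_integral_eq_integral) (auto simp: has_bochner_integral_iff intro!: ennreal_leI)
    ultimately show ?thesis by blast
  qed
  have "AE \<omega> in M. (\<lambda>n. R' n \<omega>) \<longlonglongrightarrow> 0"
  proof (rule AE_tendsto_0_if_L2_summable)
    show "R' n \<in> borel_measurable M" for n using L2[of n] by (cases "good n") (auto simp: R'_def[abs_def])
    show "(\<integral>\<^sup>+\<omega>. ennreal ((R' n \<omega>)\<^sup>2) \<partial>M) \<le> ennreal (C * (1 / 2) ^ n)" for n
      using L2[of n] by (cases "good n") (auto simp: R'_def)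
    show "summable (\<lambda>n. C * (1 / 2) ^ n)" by (intro summable_mult) simp
    show "0 \<le> C * (1 / 2) ^ n" for n using q0 by (simp add: C_def)
  qed
  then show ?thesis
  proof eventually_elim
    case (elim \<omega>)
    have "\<forall>\<^sub>F n in sequentially. R' n \<omega> = R n \<omega>" using ev by eventually_elim (simp add: R'_def)
    then show ?case using elim by (rule Lim_transform_eventually[rotated])
  qed
qed

text \<open>In the identity for dyadic sums with mesh \<open>h\<close>, \<open>exp (lam * h)\<close>
  tends to 1, \<open>(exp (lam * h) - 1) / h\<close> to \<open>lam\<close>, the Riemann sums to the
  integral and the remainder to 0. What is left is the integrated form of the linear equation for
  \<open>geom\<close>.\<close>

lemma geom_ito_pair:
  assumes lam: "0 \<le> lam"
  shows "ito_pair (\<lambda>t \<omega>. \<sigma> * geom lam \<sigma> t \<omega>) (\<lambda>t \<omega>. geom lam \<sigma> t \<omega> - 1 + lam * integral {0..t} (\<lambda>s. geom lam \<sigma> s \<omega>))"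
proof -
  let ?G = "geom lam \<sigma>" and ?\<tau> = "\<lambda>n k. real k / 2 ^ n"
  let ?\<xi> = "\<lambda>n k \<omega>. \<sigma> * geom lam \<sigma> (real k / 2 ^ n) \<omega>"
  let ?H = "\<lambda>n. simple_process (n * 2 ^ n) (?\<tau> n) (?\<xi> n)" and ?I = "\<lambda>n. simple_integral (n * 2 ^ n) (?\<tau> n) (?\<xi> n) B"
  let ?J = "\<lambda>t \<omega>. ?G t \<omega> - 1 + lam * integral {0..t} (\<lambda>s. ?G s \<omega>)"
  have el: "elementary (?H n) (?I n)" for n
  proof (rule elementary_simple)
    show "?\<xi> n k \<in> borel_measurable (F (?\<tau> n k))" for k
      using geom_adapted[of "?\<tau> n k" lam \<sigma>] by simp
  qed (auto simp: divide_right_mono)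
  have conv: "AE \<omega> in M. (\<lambda>n. ?I n q \<omega>) \<longlonglongrightarrow> ?J q \<omega>" if qd: "q \<in> (\<Union>j. dyadics j)" for q
  proof -
    from qd obtain j where "q \<in> dyadics j" by blast
    then obtain m where qm: "q = real m / 2 ^ j" unfolding dyadics_def by blast
    \<comment> \<open>For \<open>n \<ge> j\<close> the point \<open>q\<close> is the grid point with
      index \<open>K n\<close>, so exactly \<open>K n\<close> cells lie to its left.\<close>
    define K where "K n = m * 2 ^ (n - j)" for n
    have Kq: "real (K n) / 2 ^ n = q" if "j \<le> n" for n
    proof -
      have "(2::real) ^ n = 2 ^ j * 2 ^ (n - j)" using that by (simp flip: power_add)
      then show ?thesis by (simp add: K_def qm)
    qed
    show ?thesis
      using geom_remainder[OF lam Kq, of j \<sigma>, simplified] AE_space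
    proof eventually_elim
      case (elim \<omega>)
      let ?R = "\<lambda>n. \<Sum>k<K n. ?G (real k / 2 ^ n) \<omega> *
        (exp (\<sigma> * (B (real (Suc k) / 2 ^ n) \<omega> - B (real k / 2 ^ n) \<omega>) - \<sigma>\<^sup>2 * (1 / 2 ^ n) / 2) - 1
          - \<sigma> * (B (real (Suc k) / 2 ^ n) \<omega> - B (real k / 2 ^ n) \<omega>))"
      let ?S = "\<lambda>n. \<Sum>k<K n. ?G (real k / 2 ^ n) \<omega>"
      have R0: "?R \<longlonglongrightarrow> 0" using elim(1) by simp
      have Kev: "\<forall>\<^sub>F n in sequentially. real (K n) / 2 ^ n = q"
        using eventually_ge_at_top[of j] by eventually_elim (rule Kq)
      have "(\<lambda>n. ?S n / 2 ^ n) \<longlonglongrightarrow> integral {0..q} (\<lambda>s. ?G s \<omega>)"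
        by (rule dyadic_Riemann_sum[OF geom_continuous[OF elim(2)] Kev])
      then have "(\<lambda>n. exp (lam / 2 ^ n) * (?G q \<omega> - 1) + ((exp (lam / 2 ^ n) - 1) * 2 ^ n) * (?S n / 2 ^ n) - ?R n)
          \<longlonglongrightarrow> exp 0 * (?G q \<omega> - 1) + lam * integral {0..q} (\<lambda>s. ?G s \<omega>) - 0"
      proof (intro tendsto_diff tendsto_add tendsto_mult tendsto_const tendsto_exp exp_difference_quotient R0)
        show "(\<lambda>n. lam / 2 ^ n) \<longlonglongrightarrow> 0"
          using tendsto_mult[OF tendsto_const[of lam] dyadic_mesh_tendsto_0] by simp
      qed
      then have lim: "(\<lambda>n. exp (lam / 2 ^ n) * (?G q \<omega> - 1) + ((exp (lam / 2 ^ n) - 1) * 2 ^ n) * (?S n / 2 ^ n) - ?R n) \<longlonglongrightarrow> ?J q \<omega>"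
        by simp
      have "\<forall>\<^sub>F n in sequentially. exp (lam / 2 ^ n) * (?G q \<omega> - 1) + ((exp (lam / 2 ^ n) - 1) * 2 ^ n) * (?S n / 2 ^ n) - ?R n = ?I n q \<omega>"
        using eventually_ge_at_top[of j] eventually_ge_at_top[of "nat \<lceil>q\<rceil>"]
      proof eventually_elim
        case (elim n)
        have qn: "q \<le> real n" using elim(2) by linarith
        have KN: "K n \<le> n * 2 ^ n"
        proof -
          have "real (K n) = q * 2 ^ n" using Kq[OF elim(1)] by (simp add: field_simps)
          also have "\<dots> \<le> real n * 2 ^ n" using qn by simp
          also have "\<dots> = real (n * 2 ^ n)" by simp
          finally show ?thesis by (simp only: of_nat_le_iff)
        qed
        have lo: "real (Suc k) / 2 ^ n \<le> q" if "k < K n" for k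
          unfolding Kq[OF elim(1), symmetric] using that by (intro divide_right_mono) auto
        have lo': "real k / 2 ^ n \<le> q" if "k < K n" for k
          unfolding Kq[OF elim(1), symmetric] using that by (intro divide_right_mono) auto
        have hi: "q \<le> real k / 2 ^ n" if "\<not> k < K n" for k
          unfolding Kq[OF elim(1), symmetric] using that by (intro divide_right_mono) auto
        have hi': "q \<le> real (Suc k) / 2 ^ n" if "\<not> k < K n" for k
          unfolding Kq[OF elim(1), symmetric] using that by (intro divide_right_mono) auto
        \<comment> \<open>Cells to the right of \<open>q\<close> have both ends cut back to
          \<open>q\<close> by the \<open>min\<close> and contribute 0.\<close>
        have "?I n q \<omega> = (\<Sum>k<K n. ?\<xi> n k \<omega> * (B (min q (?\<tau> n (Suc k))) \<omega> - B (min q (?\<tau> n k)) \<omega>))"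
          unfolding simple_integral_def
          by (rule sum.mono_neutral_right) (use KN hi hi' in \<open>auto simp: min_absorb1 simp del: of_nat_Suc\<close>)
        also have "\<dots> = (\<Sum>k<K n. \<sigma> * ?G (real k / 2 ^ n) \<omega> * (B (real (Suc k) / 2 ^ n) \<omega> - B (real k / 2 ^ n) \<omega>))"
          by (intro sum.cong refl) (use lo lo' in \<open>simp add: min_absorb2 del: of_nat_Suc\<close>)
        also have "\<dots> = exp (lam / 2 ^ n) * (?G (real (K n) / 2 ^ n) \<omega> - 1) + (exp (lam / 2 ^ n) - 1) * ?S n - ?R n"
          using geom_sum_identity[OF \<open>\<omega> \<in> space M\<close>, where h="1 / 2 ^ n" and m="K n" and \<sigma>=\<sigma> and lam=lam] by simp
        finally show ?case using Kq[OF elim(1)] by simp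
      qed
      with lim show ?case by (rule Lim_transform_eventually)
    qed
  qed
  have "countable (\<Union>j. dyadics j)"
    by (intro countable_UN countableI_type countable_finite finite_dyadics)
  then have "AE \<omega> in M. \<forall>q\<in>(\<Union>j. dyadics j). (\<lambda>n. ?I n q \<omega>) \<longlonglongrightarrow> ?J q \<omega>"
    using conv by (intro AE_ball_countable') auto
  then have "AE \<omega> in M. (\<forall>T::nat. (\<lambda>n. sq_int (\<lambda>s \<omega>. ?H n s \<omega> - \<sigma> * ?G s \<omega>) 0 (real T) \<omega>) \<longlonglongrightarrow> 0) \<and>
           (\<forall>k. \<forall>q\<in>dyadics k. (\<lambda>n. ?I n q \<omega>) \<longlonglongrightarrow> ?J q \<omega>)"
    using AE_space
  proof eventually_elim
    case (elim \<omega>)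
    have "(\<lambda>n. sq_int (\<lambda>s \<omega>. ?H n s \<omega> - \<sigma> * ?G s \<omega>) 0 (real T) \<omega>) \<longlonglongrightarrow> 0" for T :: nat
      unfolding simple_process_def
      by (rule dyadic_step_tendsto[of "\<lambda>s. \<sigma> * ?G s \<omega>" T]) (intro continuous_intros geom_continuous elim(2))
    then show ?case using elim by blast
  qed
  moreover have "?J t \<in> borel_measurable M" if "0 \<le> t" for t
    using integral_process(1)[where H="geom lam \<sigma>" and t=t, OF geom_measurable geom_continuous] geom_measurable[OF that]
    by measurable
  moreover have "continuous_on {0..} (\<lambda>t. ?J t \<omega>)" if "\<omega> \<in> space M" for \<omega>
    using integral_process(2)[where H="geom lam \<sigma>", OF geom_measurable geom_continuous that] geom_continuous[OF that]
    by (intro continuous_intros) auto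
  moreover have "(\<lambda>\<omega>. \<sigma> * ?G t \<omega>) \<in> borel_measurable M" if "0 \<le> t" for t
    using geom_measurable[OF that] by simp
  ultimately show ?thesis
    unfolding ito_pair_def using el geom_measurable geom_continuous
    by (intro conjI exI[of _ ?H] exI[of _ ?I]) (auto intro!: continuous_intros)
qed

text \<open>By linearity \<open>Z = D - D 0 * G\<close> satisfies the same equation with initial
  value 0, so uniqueness applies. \<open>D 0\<close> enters as a possibly unbounded coefficient
  known at time 0.\<close>

lemma linear_sde_solution:
  assumes p: "ito_pair (\<lambda>t \<omega>. \<sigma> * D t \<omega>) I" and lam: "0 \<le> lam"
    and Dc: "\<And>\<omega>. \<omega> \<in> space M \<Longrightarrow> continuous_on {0..} (\<lambda>t. D t \<omega>)"
    and D0: "D 0 \<in> borel_measurable (F 0)"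
    and eq: "AE \<omega> in M. \<forall>t\<ge>0. D t \<omega> = D 0 \<omega> - lam * integral {0..t} (\<lambda>s. D s \<omega>) + I t \<omega>"
  shows "AE \<omega> in M. \<forall>t\<ge>0. D t \<omega> = D 0 \<omega> * geom lam \<sigma> t \<omega>"
proof -
  let ?G = "geom lam \<sigma>"
  let ?J = "\<lambda>t \<omega>. ?G t \<omega> - 1 + lam * integral {0..t} (\<lambda>s. ?G s \<omega>)"
  define Z where "Z t \<omega> = D t \<omega> - D 0 \<omega> * ?G t \<omega>" for t \<omega>
  have "ito_pair (\<lambda>t \<omega>. 1 * (\<sigma> * D t \<omega>) + (- D 0 \<omega>) * (\<sigma> * ?G t \<omega>)) (\<lambda>t \<omega>. 1 * I t \<omega> + (- D 0 \<omega>) * ?J t \<omega>)"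
    by (rule ito_pair_add_mult[OF p geom_ito_pair[OF lam]]) (use D0 in auto)
  also have "(\<lambda>t \<omega>. 1 * (\<sigma> * D t \<omega>) + (- D 0 \<omega>) * (\<sigma> * ?G t \<omega>)) = (\<lambda>t \<omega>. \<sigma> * Z t \<omega>)"
    by (auto simp: Z_def fun_eq_iff algebra_simps)
  finally have pz: "ito_pair (\<lambda>t \<omega>. \<sigma> * Z t \<omega>) (\<lambda>t \<omega>. 1 * I t \<omega> + (- D 0 \<omega>) * ?J t \<omega>)" .
  have "AE \<omega> in M. \<forall>t\<ge>0. Z t \<omega> = 0"
  proof (rule linear_sde_unique[OF pz _ lam])
    show "\<omega> \<in> space M \<Longrightarrow> continuous_on {0..} (\<lambda>t. Z t \<omega>)" for \<omega>
      unfolding Z_def by (intro continuous_intros Dc geom_continuous)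
    show "AE \<omega> in M. Z 0 \<omega> = 0 \<and> (\<forall>t\<ge>0. Z t \<omega> = - lam * integral {0..t} (\<lambda>s. Z s \<omega>) + (1 * I t \<omega> + (- D 0 \<omega>) * ?J t \<omega>))"
      using eq AE_space
    proof eventually_elim
      case (elim \<omega>)
      have z0: "Z 0 \<omega> = 0" using geom_0[OF elim(2)] by (simp add: Z_def)
      have "Z t \<omega> = - lam * integral {0..t} (\<lambda>s. Z s \<omega>) + (1 * I t \<omega> + (- D 0 \<omega>) * ?J t \<omega>)" if t: "0 \<le> t" for t
      proof -
        have i: "(\<lambda>s. D s \<omega>) integrable_on {0..t}" "(\<lambda>s. D 0 \<omega> * ?G s \<omega>) integrable_on {0..t}"
          using Dc[OF elim(2)] geom_continuous[OF elim(2), of lam \<sigma>]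
          by (auto intro!: integrable_continuous_real continuous_intros intro: continuous_on_subset)
        have iz: "integral {0..t} (\<lambda>s. Z s \<omega>) = integral {0..t} (\<lambda>s. D s \<omega>) - D 0 \<omega> * integral {0..t} (\<lambda>s. ?G s \<omega>)"
          unfolding Z_def by (simp add: Henstock_Kurzweil_Integration.integral_diff[OF i])
        have "D t \<omega> = D 0 \<omega> - lam * integral {0..t} (\<lambda>s. D s \<omega>) + I t \<omega>" using elim(1) t by blast
        then show ?thesis unfolding iz by (simp add: Z_def[of t] algebra_simps)
      qed
      then show ?case using z0 by blast
    qed
  qed
  then show ?thesis unfolding Z_def right_minus_eq .
qed

text \<open>The bracket of \<open>B\<close> at time \<open>t\<close> is \<open>t\<close>, so on
  \<open>{0..2 ^ k}\<close> the level \<open>2 ^ k\<close> is never exceeded and the inequality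
  controls the maximum of \<open>\<bar>B\<bar>\<close>. With threshold
  \<open>\<epsilon> / 2 * 2 ^ k\<close> the bound is
  \<open>12 / \<epsilon>\<^sup>2 * (1 / 2) ^ k\<close>, which is summable.\<close>

lemma B_sublinear:
  assumes e: "0 < \<epsilon>"
  shows "AE \<omega> in M. \<forall>\<^sub>F t in at_top. \<bar>B t \<omega>\<bar> \<le> \<epsilon> * t"
proof -
  define A where "A k = {\<omega> \<in> space M. \<exists>t\<in>{0..2 ^ k}. \<epsilon> / 2 * 2 ^ k < \<bar>B t \<omega> - B 0 \<omega>\<bar> \<and> sq_int (\<lambda>_ _. 1) 0 t \<omega> \<le> ennreal (2 ^ k)}" for k :: nat
  have d0: "0 \<in> dyadics 0" by (simp add: dyadics_def)
  have L: "A k \<in> sets M" "ennreal ((\<epsilon> / 2 * 2 ^ k)\<^sup>2) * emeasure M (A k) \<le>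
      ennreal (3 * 2 ^ k) * emeasure M {\<omega> \<in> space M. 0 < sq_int (\<lambda>_ _. 1) 0 (2 ^ k) \<omega>}" for k
    unfolding A_def by (rule ito_lenglart[OF ito_pair_one d0]; use e in simp)+
  have "prob (A k) \<le> 12 / \<epsilon>\<^sup>2 * (1 / 2) ^ k" for k
  proof -
    have "ennreal ((\<epsilon> / 2 * 2 ^ k)\<^sup>2) * emeasure M (A k) \<le> ennreal (3 * 2 ^ k) * 1"
      using L(2)[of k] by (rule order_trans) (intro mult_left_mono emeasure_space_1[THEN eq_refl, THEN order_trans[OF emeasure_space]], simp)
    then have "ennreal ((\<epsilon> / 2 * 2 ^ k)\<^sup>2 * prob (A k)) \<le> ennreal (3 * 2 ^ k)"
      by (simp add: emeasure_eq_measure ennreal_mult)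
    then have "(\<epsilon> / 2 * 2 ^ k)\<^sup>2 * prob (A k) \<le> 3 * 2 ^ k"
      by (subst (asm) ennreal_le_iff) auto
    then show ?thesis using e by (simp add: field_simps power2_eq_square power_one_over)
  qed
  then have "AE \<omega> in M. \<forall>\<^sub>F k in sequentially. \<omega> \<notin> A k"
    by (rule borel_cantelli_eventually[OF L(1)]) (intro summable_mult, simp)
  then show ?thesis using AE_space
  proof eventually_elim
    case (elim \<omega>)
    then obtain N where N: "\<And>k. N \<le> k \<Longrightarrow> \<omega> \<notin> A k" by (auto simp: eventually_sequentially)
    show ?case using eventually_ge_at_top[of "2 ^ N :: real"]
    proof eventually_elim
      case (elim t)
      have t1: "1 \<le> t" using elim one_le_power[of "2::real" N] by linarith
      \<comment> \<open>This gives \<open>t \<le> 2 ^ k < 2 * t\<close>; the factor 2 lost here is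
        compensated by the \<open>\<epsilon> / 2\<close> in the threshold.\<close>
      define k where "k = nat \<lceil>log 2 t\<rceil>"
      have lt: "0 \<le> log 2 t" using t1 by simp
      have "log 2 t \<le> real k" "real k < log 2 t + 1" unfolding k_def using lt by linarith+
      then have "t \<le> 2 powr real k" "2 powr real k < 2 powr (log 2 t + 1)"
        using t1 by (auto simp: log_le_iff)
      then have tk: "t \<le> 2 ^ k" "2 ^ k < 2 * t"
        using t1 by (auto simp: powr_realpow powr_add)
      have "real N \<le> log 2 t" using elim t1 by (simp add: le_log_iff powr_realpow)
      then have "N \<le> k" using \<open>log 2 t \<le> real k\<close> by linarith
      then have "\<omega> \<notin> A k" by (rule N)
      have "sq_int (\<lambda>_ _. 1) 0 t \<omega> \<le> ennreal (2 ^ k)"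
        using tk t1 by (simp add: ennreal_leI)
      from \<open>\<omega> \<notin> A k\<close> have "\<bar>B t \<omega> - B 0 \<omega>\<bar> \<le> \<epsilon> / 2 * 2 ^ k"
      proof (rule contrapos_np)
        assume "\<not> \<bar>B t \<omega> - B 0 \<omega>\<bar> \<le> \<epsilon> / 2 * 2 ^ k"
        then show "\<omega> \<in> A k"
          using \<open>sq_int (\<lambda>_ _. 1) 0 t \<omega> \<le> ennreal (2 ^ k)\<close> \<open>\<omega> \<in> space M\<close> tk(1) t1
          unfolding A_def by (intro CollectI conjI bexI[of _ t]) (auto simp: not_le)
      qed
      also have "\<dots> \<le> \<epsilon> / 2 * (2 * t)" using tk e by (intro mult_left_mono) auto
      finally show ?case using B_zero[OF \<open>\<omega> \<in> space M\<close>] by simp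
    qed
  qed
qed

lemma geom_decay:
  assumes "0 < lam" "0 \<le> \<sigma>"
  shows "AE \<omega> in M. \<forall>\<^sub>F t in at_top. geom lam \<sigma> t \<omega> \<le> exp (- (lam / 2) * t)"
proof -
  \<comment> \<open>The noise may use up at most half of the rate \<open>lam\<close>; the
    denominator contains \<open>\<sigma> + 1\<close> to be positive also for
    \<open>\<sigma> = 0\<close>.\<close>
  define \<epsilon> where "\<epsilon> = lam / (2 * (\<sigma> + 1))"
  have e: "0 < \<epsilon>" "\<sigma> * \<epsilon> \<le> lam / 2" using assms by (auto simp: \<epsilon>_def field_simps)
  show ?thesis using B_sublinear[OF e(1)]
  proof eventually_elim
    case (elim \<omega>)
    then show ?case using eventually_ge_at_top[of 0]
    proof eventually_elim
      case (elim t)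
      have "\<sigma> * B t \<omega> \<le> \<sigma> * (\<epsilon> * t)" using elim assms by (intro mult_left_mono) auto
      also have "\<dots> \<le> lam / 2 * t" using e(2) elim(2) by (metis mult.assoc mult_right_mono)
      finally have "\<sigma> * B t \<omega> \<le> lam / 2 * t" .
      moreover have "0 \<le> \<sigma>\<^sup>2 / 2 * t" using elim by simp
      ultimately have "- (lam + \<sigma>\<^sup>2 / 2) * t + \<sigma> * B t \<omega> \<le> - (lam / 2) * t" by (simp add: algebra_simps)
      then show ?case by (simp add: geom_def)
    qed
  qed
qed

text \<open>The bracket over \<open>{real n..real n + 1}\<close> is at most
  \<open>C\<^sup>2 * exp (- 2 * c * n)\<close> for large \<open>n\<close>, hence eventually below
  \<open>\<delta> n = exp (- c * n)\<close>, whatever the random \<open>C\<close>. With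
  \<open>\<epsilon> n = exp (- c * n / 4)\<close> the Lenglart ratio is
  \<open>3 * exp (- c * n / 2)\<close>, so both the probabilities and the thresholds are
  summable.\<close>

lemma ito_oscillation:
  assumes p: "ito_pair H I" and c: "0 < c"
    and dec: "AE \<omega> in M. \<exists>C. \<forall>\<^sub>F t in at_top. \<bar>H t \<omega>\<bar> \<le> C * exp (- c * t)"
  shows "AE \<omega> in M. \<forall>\<^sub>F n in sequentially. \<forall>t\<in>{real n..real n + 1}. \<bar>I t \<omega> - I (real n) \<omega>\<bar> \<le> exp (- (c / 4)) ^ n"
proof -
  define \<epsilon> where "\<epsilon> n = exp (- (c / 4)) ^ n" for n :: nat
  define \<delta> where "\<delta> n = exp (- c) ^ n" for n :: nat
  have pos: "0 < \<epsilon> n" "0 < \<delta> n" for n by (auto simp: \<epsilon>_def \<delta>_def)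
  define A where "A n = {\<omega> \<in> space M. \<exists>t\<in>{real n..real n + 1}. \<epsilon> n < \<bar>I t \<omega> - I (real n) \<omega>\<bar> \<and> sq_int H (real n) t \<omega> \<le> ennreal (\<delta> n)}" for n
  have dn: "real n \<in> dyadics n" for n using dyadicI[of n 0] by simp
  have le1: "real n \<le> real n + 1" for n by simp
  have L: "A n \<in> sets M" "ennreal ((\<epsilon> n)\<^sup>2) * emeasure M (A n) \<le>
      ennreal (3 * \<delta> n) * emeasure M {\<omega> \<in> space M. 0 < sq_int H (real n) (real n + 1) \<omega>}" for n
    unfolding A_def by (rule ito_lenglart[OF p dn le1 pos])+
  have P: "prob (A n) \<le> 3 * exp (- (c / 2)) ^ n" for n
  proof -
    have "ennreal ((\<epsilon> n)\<^sup>2) * emeasure M (A n) \<le> ennreal (3 * \<delta> n) * 1"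
      using L(2)[of n] by (rule order_trans) (intro mult_left_mono emeasure_space_1[THEN eq_refl, THEN order_trans[OF emeasure_space]], simp)
    then have "ennreal ((\<epsilon> n)\<^sup>2 * prob (A n)) \<le> ennreal (3 * \<delta> n)"
      by (simp add: emeasure_eq_measure ennreal_mult)
    then have "(\<epsilon> n)\<^sup>2 * prob (A n) \<le> 3 * \<delta> n"
      using pos[of n] by (subst (asm) ennreal_le_iff) auto
    also have "3 * \<delta> n = (\<epsilon> n)\<^sup>2 * (3 * exp (- (c / 2)) ^ n)"
    proof -
      have "exp (- c) = (exp (- (c / 4)))\<^sup>2 * exp (- (c / 2))" by (simp add: power2_eq_square flip: exp_add)
      then show ?thesis by (simp add: \<delta>_def \<epsilon>_def power_mult_distrib power_commutes flip: power_mult) (simp add: mult.commute)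
    qed
    finally show ?thesis using pos[of n] by simp
  qed
  have "summable (\<lambda>n. 3 * exp (- (c / 2)) ^ n)" using c by (intro summable_mult summable_geometric) simp
  from borel_cantelli_eventually[OF L(1) P this]
  have "AE \<omega> in M. \<forall>\<^sub>F n in sequentially. \<omega> \<notin> A n" .
  then show ?thesis using dec AE_space
  proof eventually_elim
    case (elim \<omega>)
    from elim(2) obtain C where C: "\<forall>\<^sub>F t in at_top. \<bar>H t \<omega>\<bar> \<le> C * exp (- c * t)" ..
    then obtain T where T: "\<And>t. T \<le> t \<Longrightarrow> \<bar>H t \<omega>\<bar> \<le> C * exp (- c * t)" by (auto simp: eventually_at_top_linorder)
    have "(\<lambda>n. C\<^sup>2 * exp (- c) ^ n) \<longlonglongrightarrow> C\<^sup>2 * 0"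
      using c by (intro tendsto_mult tendsto_const LIMSEQ_power_zero) simp
    then have "\<forall>\<^sub>F n in sequentially. C\<^sup>2 * exp (- c) ^ n < 1"
      by (rule order_tendstoD(2)) simp
    moreover have "\<forall>\<^sub>F n in sequentially. T \<le> real n"
      using eventually_ge_at_top[of "nat \<lceil>T\<rceil>"] by eventually_elim linarith
    ultimately show ?case using elim(1)
    proof eventually_elim
      case (elim n)
      show ?case
      proof
        fix t assume t: "t \<in> {real n..real n + 1}"
        have "sq_int H (real n) t \<omega> \<le> (\<integral>\<^sup>+s. ennreal (C\<^sup>2 * (\<delta> n)\<^sup>2) * indicator {real n..t} s \<partial>lborel)"
        proof (rule nn_integral_mono)
          fix s
          have "(H s \<omega>)\<^sup>2 \<le> C\<^sup>2 * (\<delta> n)\<^sup>2" if "s \<in> {real n..t}"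
          proof -
            have "\<bar>H s \<omega>\<bar> \<le> C * exp (- c * s)" using T[of s] elim(2) that by auto
            also have "\<dots> \<le> \<bar>C\<bar> * \<delta> n"
            proof (intro mult_mono)
              have "\<delta> n = exp (- c * real n)" by (simp add: \<delta>_def exp_of_nat_mult[symmetric] mult.commute)
              then show "exp (- c * s) \<le> \<delta> n" using that c by simp
            qed auto
            finally have "\<bar>H s \<omega>\<bar> \<le> \<bar>\<bar>C\<bar> * \<delta> n\<bar>" by simp
            then have "(H s \<omega>)\<^sup>2 \<le> (\<bar>C\<bar> * \<delta> n)\<^sup>2" by (simp only: abs_le_square_iff)
            then show ?thesis by (simp add: power_mult_distrib)
          qed
          then show "ennreal ((H s \<omega>)\<^sup>2) * indicator {real n..t} s \<le> ennreal (C\<^sup>2 * (\<delta> n)\<^sup>2) * indicator {real n..t} s"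
            by (auto split: split_indicator intro!: ennreal_leI)
        qed
        also have "\<dots> = ennreal (C\<^sup>2 * (\<delta> n)\<^sup>2 * (t - real n))"
          using t by (subst nn_integral_cmult_indicator) (auto simp: ennreal_mult)
        also have "\<dots> \<le> ennreal (\<delta> n)"
        proof (rule ennreal_leI)
          have "C\<^sup>2 * (\<delta> n)\<^sup>2 * (t - real n) \<le> C\<^sup>2 * (\<delta> n)\<^sup>2 * 1" using t by (intro mult_left_mono) auto
          also have "\<dots> = (C\<^sup>2 * exp (- c) ^ n) * \<delta> n" by (simp add: \<delta>_def power2_eq_square)
          also have "\<dots> \<le> 1 * \<delta> n" using elim(1) pos(2)[of n] by (intro mult_right_mono) auto
          finally show "C\<^sup>2 * (\<delta> n)\<^sup>2 * (t - real n) \<le> \<delta> n" by simp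
        qed
        finally have sq: "sq_int H (real n) t \<omega> \<le> ennreal (\<delta> n)" .
        from elim(3) show "\<bar>I t \<omega> - I (real n) \<omega>\<bar> \<le> exp (- (c / 4)) ^ n"
        proof (rule contrapos_np)
          assume "\<not> \<bar>I t \<omega> - I (real n) \<omega>\<bar> \<le> exp (- (c / 4)) ^ n"
          then show "\<omega> \<in> A n"
            using sq \<open>\<omega> \<in> space M\<close> t unfolding A_def
            by (intro CollectI conjI bexI[of _ t]) (auto simp: not_le \<epsilon>_def)
        qed
      qed
    qed
  qed
qed

end

section \<open>The driving filtration\<close>

context prob_space
begin

text \<open>The definition provides independence only for increments along a grid. With 0 and
  \<open>s\<close> added to the grid, each \<open>B u\<close> with \<open>u \<in> T\<close> is a sum
  of increments up to \<open>s\<close>, so the past event and the increment to \<open>t\<close>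
  depend on disjoint blocks of independent variables.\<close>

lemma brownian_past_indep_increment_cylinder:
  fixes B :: "real \<Rightarrow> 'a \<Rightarrow> real"
  assumes bm: "standard_brownian_motion M B" and st: "0 \<le> s" "s < t"
    and T: "finite T" "T \<subseteq> {0..s}" and A: "\<And>u. u \<in> T \<Longrightarrow> A u \<in> sets borel" and C: "C \<in> sets borel"
  shows "prob ({\<omega> \<in> space M. \<forall>u\<in>T. B u \<omega> \<in> A u} \<inter> ((\<lambda>\<omega>. B t \<omega> - B s \<omega>) -` C \<inter> space M)) =
    prob {\<omega> \<in> space M. \<forall>u\<in>T. B u \<omega> \<in> A u} * prob ((\<lambda>\<omega>. B t \<omega> - B s \<omega>) -` C \<inter> space M)"
proof -
  define T' where "T' = insert 0 (insert s T)"
  define R where "R = sorted_list_of_set T'"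
  have "finite T'" using T by (simp add: T'_def)
  then have R: "set R = insert 0 (insert s T)" "sorted_wrt (<) R"
    by (simp_all add: R_def flip: T'_def)
  define n where "n = length R"
  have n: "0 < n" using R by (cases R) (auto simp: n_def)
  \<comment> \<open>Beyond the list the grid is constantly \<open>t\<close>, because the definition
    of Brownian motion asks for monotonicity on all naturals. Thus \<open>\<tau> (n - 1) = s\<close>
    and \<open>\<tau> n = t\<close>, and the increment of interest has index
    \<open>n - 1\<close>.\<close>
  define \<tau> where "\<tau> k = (if k < n then R ! k else t)" for k
  have Rless: "R ! i < R ! j" if "i < j" "j < n" for i j
    using sorted_wrt_nth_less[OF R(2)] that by (simp add: n_def)
  have Rin: "R ! i \<in> {0..s}" if "i < n" for i
  proof -
    have "R ! i \<in> set R" using that by (simp add: n_def)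
    then show ?thesis using R(1) T st by auto
  qed
  have idx: "\<exists>k<n. R ! k = u" if "u \<in> insert 0 (insert s T)" for u
    using that R(1) by (auto simp: n_def in_set_conv_nth[symmetric])
  have \<tau>0: "\<tau> 0 = 0"
  proof -
    obtain k where k: "k < n" "R ! k = 0" using idx[of 0] by auto
    then show ?thesis using Rless[of 0 k] Rin[of 0] n by (cases "k = 0") (auto simp: \<tau>_def)
  qed
  have \<tau>s: "\<tau> (n - 1) = s"
  proof -
    obtain k where k: "k < n" "R ! k = s" using idx[of s] by auto
    have "k = n - 1"
    proof (rule ccontr)
      assume "k \<noteq> n - 1"
      then have "k < n - 1" using k(1) by linarith
      then show False using Rless[of k "n - 1"] Rin[of "n - 1"] n k by simp
    qed
    then show ?thesis using k by (simp add: \<tau>_def)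
  qed
  have \<tau>t: "\<tau> n = t" by (simp add: \<tau>_def)
  have mono: "mono \<tau>"
  proof (rule monoI)
    fix i j :: nat assume "i \<le> j"
    then show "\<tau> i \<le> \<tau> j"
      using Rless[of i j] Rin[of i] st by (cases "i = j") (auto simp: \<tau>_def)
  qed
  define D where "D k \<omega> = B (\<tau> (Suc k)) \<omega> - B (\<tau> k) \<omega>" for k \<omega>
  have "indep_vars (\<lambda>_. borel) D {..<n}"
    using bm mono \<tau>0 unfolding standard_brownian_motion_def D_def by auto
  then have iv: "indep_var (PiM {..<n - 1} (\<lambda>_. borel)) (\<lambda>\<omega>. restrict (\<lambda>k. D k \<omega>) {..<n - 1})
      (PiM {n - 1} (\<lambda>_. borel)) (\<lambda>\<omega>. restrict (\<lambda>k. D k \<omega>) {n - 1})"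
    by (rule indep_var_restrict) (use n in auto)
  obtain ix where ix: "\<And>u. u \<in> T \<Longrightarrow> ix u < n \<and> \<tau> (ix u) = u"
    using idx unfolding \<tau>_def by (metis insertCI)
  have Bsum: "B u \<omega> = (\<Sum>k<ix u. D k \<omega>)" if "u \<in> T" "\<omega> \<in> space M" for u \<omega>
  proof -
    have "(\<Sum>k<ix u. D k \<omega>) = B (\<tau> (ix u)) \<omega> - B (\<tau> 0) \<omega>"
      unfolding D_def by (rule sum_lessThan_telescope)
    then show ?thesis using that ix[OF that(1)] \<tau>0 bm by (simp add: standard_brownian_motion_def)
  qed
  define S where "S = {x \<in> space (PiM {..<n - 1} (\<lambda>_. borel)). \<forall>u\<in>T. (\<Sum>k<ix u. x k) \<in> A u}"
  define S' where "S' = {x \<in> space (PiM {n - 1} (\<lambda>_. borel :: real measure)). x (n - 1) \<in> C}"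
  have Sm: "S \<in> sets (PiM {..<n - 1} (\<lambda>_. borel))"
  proof -
    have "S = {x \<in> space (PiM {..<n - 1} (\<lambda>_. borel)). \<forall>u\<in>T. x \<in> (\<lambda>x. \<Sum>k<ix u. x k) -` A u \<inter> space (PiM {..<n - 1} (\<lambda>_. borel :: real measure))}"
      by (auto simp: S_def)
    also have "\<dots> \<in> sets (PiM {..<n - 1} (\<lambda>_. borel))"
    proof (rule sets.sets_Collect_finite_All[OF _ T(1)])
      fix u assume u: "u \<in> T"
      have "(\<lambda>x. \<Sum>k<ix u. x k) \<in> borel_measurable (PiM {..<n - 1} (\<lambda>_. borel :: real measure))"
      proof (rule borel_measurable_sum)
        fix k assume "k \<in> {..<ix u}"
        then have "k \<in> {..<n - 1}" using ix[OF u] by auto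
        then show "(\<lambda>x. x k) \<in> borel_measurable (PiM {..<n - 1} (\<lambda>_. borel :: real measure))"
          by (rule measurable_component_singleton)
      qed
      from measurable_sets[OF this A[OF u]]
      have "(\<lambda>x. \<Sum>k<ix u. x k) -` A u \<inter> space (PiM {..<n - 1} (\<lambda>_. borel)) \<in> sets (PiM {..<n - 1} (\<lambda>_. borel))" .
      then show "{x \<in> space (PiM {..<n - 1} (\<lambda>_. borel)). x \<in> (\<lambda>x. \<Sum>k<ix u. x k) -` A u \<inter> space (PiM {..<n - 1} (\<lambda>_. borel :: real measure))} \<in> sets (PiM {..<n - 1} (\<lambda>_. borel))"
        by (simp add: Int_def conj_commute conj_left_commute)
    qed
    finally show ?thesis .
  qed
  have S'm: "S' \<in> sets (PiM {n - 1} (\<lambda>_. borel))"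
  proof -
    have "(\<lambda>x. x (n - 1)) \<in> borel_measurable (PiM {n - 1} (\<lambda>_. borel :: real measure))"
      by (rule measurable_component_singleton) simp
    from measurable_sets[OF this C] show ?thesis
      unfolding S'_def by (simp add: vimage_def Int_def conj_commute)
  qed
  have 1: "(\<lambda>\<omega>. restrict (\<lambda>k. D k \<omega>) {..<n - 1}) -` S \<inter> space M = {\<omega> \<in> space M. \<forall>u\<in>T. B u \<omega> \<in> A u}"
  proof -
    have "(\<Sum>k<ix u. restrict (\<lambda>k. D k \<omega>) {..<n - 1} k) = B u \<omega>" if "u \<in> T" "\<omega> \<in> space M" for u \<omega>
      unfolding Bsum[OF that] using ix[OF that(1)] by (intro sum.cong) auto
    then show ?thesis by (auto simp: S_def space_PiM)
  qed
  have 2: "(\<lambda>\<omega>. restrict (\<lambda>k. D k \<omega>) {n - 1}) -` S' \<inter> space M = (\<lambda>\<omega>. B t \<omega> - B s \<omega>) -` C \<inter> space M"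
    using n \<tau>s \<tau>t by (auto simp: S'_def space_PiM D_def)
  have 3: "(\<lambda>x. (restrict (\<lambda>k. D k x) {..<n - 1}, restrict (\<lambda>k. D k x) {n - 1})) -` (S \<times> S') \<inter> space M
      = ((\<lambda>\<omega>. restrict (\<lambda>k. D k \<omega>) {..<n - 1}) -` S \<inter> space M) \<inter> ((\<lambda>\<omega>. restrict (\<lambda>k. D k \<omega>) {n - 1}) -` S' \<inter> space M)"
    by auto
  show ?thesis using indep_varD[OF iv Sm S'm] unfolding 3 1 2 .
qed

text \<open>Cylinders over finitely many times form a pi-system that generates the past, so
  independence extends from them to the whole sigma-algebra.\<close>

lemma brownian_past_indep_increment:
  fixes B :: "real \<Rightarrow> 'a \<Rightarrow> real"
  assumes bm: "standard_brownian_motion M B" and st: "0 \<le> s" "s < t"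
    and A: "A \<in> sigma_sets (space M) {B u -` A \<inter> space M | u A. 0 \<le> u \<and> u \<le> s \<and> A \<in> sets borel}" and C: "C \<in> sets borel"
  shows "prob (A \<inter> ((\<lambda>\<omega>. B t \<omega> - B s \<omega>) -` C \<inter> space M)) =
    prob A * prob ((\<lambda>\<omega>. B t \<omega> - B s \<omega>) -` C \<inter> space M)"
proof -
  let ?U = "\<lambda>\<omega>. B t \<omega> - B s \<omega>"
  have Bm: "0 \<le> u \<Longrightarrow> B u \<in> borel_measurable M" for u
    using bm by (simp add: standard_brownian_motion_def)
  define Q where "Q = {{\<omega> \<in> space M. \<forall>u\<in>T. B u \<omega> \<in> A u} | T A. finite T \<and> T \<subseteq> {0..s} \<and> (\<forall>u\<in>T. A u \<in> sets borel)}"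
  have "indep_set (sigma_sets (space M) Q) (sigma_sets (space M) {?U -` C \<inter> space M})"
  proof (rule indep_set_sigma_sets)
    show "indep_set Q {?U -` C \<inter> space M}"
    proof (rule indep_setI)
      show "Q \<subseteq> events"
      proof
        fix q assume "q \<in> Q"
        then obtain T A where T: "finite T" "T \<subseteq> {0..s}" "\<forall>u\<in>T. A u \<in> sets borel" and q: "q = {\<omega> \<in> space M. \<forall>u\<in>T. B u \<omega> \<in> A u}"
          unfolding Q_def by blast
        show "q \<in> events" unfolding q
        proof (rule sets.sets_Collect_finite_All[OF _ T(1)])
          fix u assume "u \<in> T"
          then have "B u -` A u \<inter> space M \<in> events" using T Bm[of u] by (intro measurable_sets) auto
          then show "{\<omega> \<in> space M. B u \<omega> \<in> A u} \<in> events" by (simp add: vimage_def Int_def conj_commute)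
        qed
      qed
      show "{?U -` C \<inter> space M} \<subseteq> events"
        using Bm[of s] Bm[of t] st C by auto
      show "prob (a \<inter> b) = prob a * prob b" if "a \<in> Q" "b \<in> {?U -` C \<inter> space M}" for a b
        using that brownian_past_indep_increment_cylinder[OF bm st _ _ _ C] unfolding Q_def by blast
    qed
    show "Int_stable Q"
    proof (rule Int_stableI)
      fix a b assume "a \<in> Q" "b \<in> Q"
      then obtain T A T' A' where T: "finite T" "T \<subseteq> {0..s}" "\<forall>u\<in>T. A u \<in> sets borel" "a = {\<omega> \<in> space M. \<forall>u\<in>T. B u \<omega> \<in> A u}"
        and T': "finite T'" "T' \<subseteq> {0..s}" "\<forall>u\<in>T'. A' u \<in> sets borel" "b = {\<omega> \<in> space M. \<forall>u\<in>T'. B u \<omega> \<in> A' u}"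
        unfolding Q_def by blast
      let ?A = "\<lambda>u. (if u \<in> T then A u else UNIV) \<inter> (if u \<in> T' then A' u else UNIV)"
      have "a \<inter> b = {\<omega> \<in> space M. \<forall>u\<in>T \<union> T'. B u \<omega> \<in> ?A u}" unfolding T T' by auto
      moreover have "\<forall>u\<in>T \<union> T'. ?A u \<in> sets borel" using T T' by auto
      moreover have "finite (T \<union> T')" "T \<union> T' \<subseteq> {0..s}" using T T' by auto
      ultimately show "a \<inter> b \<in> Q" unfolding Q_def
        by (intro CollectI exI[of _ "T \<union> T'"] exI[of _ ?A] conjI)
    qed
    show "Int_stable {?U -` C \<inter> space M}" by (simp add: Int_stable_def)
  qed
  moreover have "A \<in> sigma_sets (space M) Q"
  proof (rule subsetD[OF sigma_sets_mono' A])
    show "{B u -` A \<inter> space M | u A. 0 \<le> u \<and> u \<le> s \<and> A \<in> sets borel} \<subseteq> Q"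
    proof safe
      fix u :: real and A :: "real set" assume u: "0 \<le> u" "u \<le> s" "A \<in> sets borel"
      have "B u -` A \<inter> space M = {\<omega> \<in> space M. \<forall>v\<in>{u}. B v \<omega> \<in> A}" by auto
      then show "B u -` A \<inter> space M \<in> Q" unfolding Q_def using u
        by (intro CollectI exI[of _ "{u}"] exI[of _ "\<lambda>_. A"]) auto
    qed
  qed
  moreover have "?U -` C \<inter> space M \<in> sigma_sets (space M) {?U -` C \<inter> space M}" by (rule sigma_sets.Basic) simp
  ultimately show ?thesis by (rule indep_setD)
qed

lemma space_driving_filtration: "space (driving_filtration M W X0 t) = space M"
  by (simp add: driving_filtration_def space_measure_of_conv)

lemma sets_driving_filtration:
  "sets (driving_filtration M W X0 t) = sigma_sets (space M)
     (null_sets M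
      \<union> {X0 i -` A \<inter> space M | i A. A \<in> sets borel}
      \<union> {W l s -` A \<inter> space M | l s A. 0 \<le> s \<and> s \<le> t \<and> A \<in> sets borel})"
  unfolding driving_filtration_def
  by (rule sets_measure_of) (auto dest: sets.sets_into_space)

text \<open>The filtration is generated by a pi-system: events
  \<open>a \<inter> (\<Inter>k. b k)\<close>, with \<open>a\<close> about the initial data and
  \<open>b k\<close> about the past of \<open>W k\<close>, together with the null sets. Their
  probabilities factorize in three stages: initial data against all of the noise, the motions
  against each other, and the past of \<open>W l\<close> against its own increment.\<close>

lemma driving_filtration_indep_increment:
  fixes W :: "'d::finite \<Rightarrow> real \<Rightarrow> 'a \<Rightarrow> real" and X0 :: "'n \<Rightarrow> 'a \<Rightarrow> 'b::topological_space"
  assumes W: "independent_brownian_motions M W" and X0: "initial_data_independent M W X0"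
    and st: "0 \<le> s" "s < t" and A: "A \<in> sets (driving_filtration M W X0 s)" and C: "C \<in> sets borel"
  shows "prob (A \<inter> ((\<lambda>\<omega>. W l t \<omega> - W l s \<omega>) -` C \<inter> space M)) =
    prob A * prob ((\<lambda>\<omega>. W l t \<omega> - W l s \<omega>) -` C \<inter> space M)"
proof -
  let ?U = "\<lambda>\<omega>. W l t \<omega> - W l s \<omega>"
  define u where "u = ?U -` C \<inter> space M"
  have bm: "standard_brownian_motion M (W k)" for k
    using W by (simp add: independent_brownian_motions_def)
  have Wm: "0 \<le> r \<Longrightarrow> W k r \<in> borel_measurable M" for k r
    using bm[of k] by (simp add: standard_brownian_motion_def)
  define V0 where "V0 = vimage_algebra (space M) (\<lambda>\<omega> i. X0 i \<omega>) (\<Pi>\<^sub>M i\<in>UNIV. borel)"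
  define VW where "VW = vimage_algebra (space M) (\<lambda>\<omega>. \<lambda>(l, t)\<in>UNIV \<times> {0..}. W l t \<omega>) (\<Pi>\<^sub>M p\<in>UNIV \<times> {0..}. borel)"
  define VP where "VP k = vimage_algebra (space M) (\<lambda>\<omega>. \<lambda>t\<in>{0..}. W k t \<omega>) (\<Pi>\<^sub>M t\<in>{0..}. borel)" for k
  define VS where "VS k = sigma (space M) {W k r -` A \<inter> space M | r A. 0 \<le> r \<and> r \<le> s \<and> A \<in> sets borel}" for k
  have sp [simp]: "space V0 = space M" "space VW = space M" "space (VP k) = space M" "space (VS k) = space M" for k
    by (simp_all add: V0_def VW_def VP_def VS_def space_measure_of_conv)
  have i0: "indep_set (sets V0) (sets VW)" and X0m: "X0 i \<in> borel_measurable M" for i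
    using X0 by (auto simp: initial_data_independent_def V0_def VW_def)
  have iP: "indep_sets (\<lambda>k. sets (VP k)) UNIV"
    using W unfolding independent_brownian_motions_def indep_vars_def VP_def sets_vimage_algebra by auto
  have V0X: "X0 i \<in> borel_measurable V0" for i
  proof -
    have "(\<lambda>\<omega> i. X0 i \<omega>) \<in> measurable V0 (\<Pi>\<^sub>M i\<in>UNIV. borel)"
      unfolding V0_def by (rule measurable_vimage_algebra1) (simp add: space_PiM)
    from measurable_compose[OF this measurable_component_singleton[of i]] show ?thesis by simp
  qed
  have VWW: "W k r \<in> borel_measurable VW" if "0 \<le> r" for k r
  proof -
    have "(\<lambda>\<omega>. \<lambda>(l, t)\<in>UNIV \<times> {0..}. W l t \<omega>) \<in> measurable VW (\<Pi>\<^sub>M p\<in>UNIV \<times> {0..}. borel)"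
      unfolding VW_def by (rule measurable_vimage_algebra1) (simp add: space_PiM)
    from measurable_compose[OF this measurable_component_singleton[of "(k, r)"]] that show ?thesis by simp
  qed
  have VPW: "W k r \<in> borel_measurable (VP k)" if "0 \<le> r" for k r
  proof -
    have "(\<lambda>\<omega>. \<lambda>t\<in>{0..}. W k t \<omega>) \<in> measurable (VP k) (\<Pi>\<^sub>M t\<in>{0..}. borel)"
      unfolding VP_def by (rule measurable_vimage_algebra1) (simp add: space_PiM)
    from measurable_compose[OF this measurable_component_singleton[of r]] that show ?thesis by simp
  qed
  have VS_sets: "sets (VS k) = sigma_sets (space M) {W k r -` A \<inter> space M | r A. 0 \<le> r \<and> r \<le> s \<and> A \<in> sets borel}" for k
    unfolding VS_def by (rule sets_measure_of) auto
  have VS_sub: "sets (VS k) \<subseteq> sets N" if "space N = space M" "\<And>r. 0 \<le> r \<Longrightarrow> W k r \<in> borel_measurable N" for k N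
    unfolding VS_sets that(1)[symmetric] using that(2) by (intro sets.sigma_sets_subset) (auto intro: measurable_sets)
  have VS_P: "sets (VS k) \<subseteq> sets (VP k)" and VS_W: "sets (VS k) \<subseteq> sets VW" and VS_M: "sets (VS k) \<subseteq> sets M" for k
    by (rule VS_sub; use VPW VWW Wm in simp)+
  have V0M: "sets V0 \<subseteq> sets M" using i0 indep_setD_ev1 by blast
  have uP: "u \<in> sets (VP l)" and uW: "u \<in> sets VW" and uM: "u \<in> sets M"
  proof -
    have "u \<in> sets N" if N: "space N = space M" "\<And>r. 0 \<le> r \<Longrightarrow> W l r \<in> borel_measurable N" for N
    proof -
      have "?U \<in> borel_measurable N" using N(2)[of s] N(2)[of t] st by auto
      from measurable_sets[OF this C] show ?thesis by (simp add: u_def N(1))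
    qed
    then show "u \<in> sets (VP l)" "u \<in> sets VW" "u \<in> sets M" using VPW VWW Wm by simp_all
  qed
  define P where "P = {a \<inter> (\<Inter>k. b k) | a b. a \<in> sets V0 \<and> (\<forall>k. b k \<in> sets (VS k))}"
  have Inter_W: "(\<Inter>k. b k) \<in> sets VW" if "\<forall>k. b k \<in> sets (VS k)" for b
    using that VS_W by (intro sets.finite_INT) auto
  have prodW: "prob ((\<Inter>k. b k) \<inter> u) = prob (\<Inter>k. b k) * prob u" if b: "\<forall>k. b k \<in> sets (VS k)" for b
  proof -
    have bu: "prob (b l \<inter> u) = prob (b l) * prob u"
      using brownian_past_indep_increment[OF bm[of l] st _ C] b VS_sets[of l] unfolding u_def by blast
    \<comment> \<open>The increment event is absorbed into the factor with index \<open>l\<close>,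
      so that the intersection still has one factor for each of the independent motions.\<close>
    have "(\<Inter>k. b k) \<inter> u = (\<Inter>k. (if k = l then b k \<inter> u else b k))"
      by (auto split: if_splits)
    also have "prob \<dots> = (\<Prod>k\<in>UNIV. prob (if k = l then b k \<inter> u else b k))"
      by (rule indep_setsD[OF iP]) (use b VS_P uP in auto)
    also have "\<dots> = (\<Prod>k\<in>UNIV. prob (b k) * (if k = l then prob u else 1))"
      by (intro prod.cong) (auto simp: bu)
    also have "\<dots> = (\<Prod>k\<in>UNIV. prob (b k)) * prob u"
      by (simp add: prod.distrib)
    also have "(\<Prod>k\<in>UNIV. prob (b k)) = prob (\<Inter>k. b k)"
      by (rule indep_setsD[OF iP, symmetric]) (use b VS_P in auto)
    finally show ?thesis .
  qed
  have "indep_set (sigma_sets (space M) (P \<union> null_sets M)) (sigma_sets (space M) {u})"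
  proof (rule indep_set_sigma_sets)
    have PM: "P \<subseteq> events"
    proof
      fix p assume "p \<in> P"
      then obtain a b where ab: "a \<in> sets V0" "\<forall>k. b k \<in> sets (VS k)" "p = a \<inter> (\<Inter>k. b k)" unfolding P_def by blast
      have "a \<in> events" using ab(1) V0M by blast
      moreover have "(\<Inter>k. b k) \<in> events" using ab(2) VS_M by (intro sets.finite_INT) auto
      ultimately show "p \<in> events" unfolding ab(3) by (rule sets.Int)
    qed
    show "indep_set (P \<union> null_sets M) {u}"
    proof (rule indep_setI)
      show "P \<union> null_sets M \<subseteq> events" using PM by auto
      show "{u} \<subseteq> events" using uM by simp
      fix x y assume x: "x \<in> P \<union> null_sets M" and y: "y \<in> {u}"
      show "prob (x \<inter> y) = prob x * prob y"
      proof (cases "x \<in> null_sets M")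
        case True
        then have "x \<inter> u \<in> null_sets M" using uM by (rule null_set_Int2)
        then show ?thesis using True y by (simp add: null_sets_def measure_def)
      next
        case False
        then obtain a b where ab: "a \<in> sets V0" "\<forall>k. b k \<in> sets (VS k)" "x = a \<inter> (\<Inter>k. b k)"
          using x unfolding P_def by blast
        have "prob (a \<inter> ((\<Inter>k. b k) \<inter> u)) = prob a * prob ((\<Inter>k. b k) \<inter> u)"
          by (rule indep_setD[OF i0 ab(1)]) (use Inter_W[OF ab(2)] uW in auto)
        also have "\<dots> = prob a * prob (\<Inter>k. b k) * prob u" by (simp add: prodW[OF ab(2)])
        also have "prob a * prob (\<Inter>k. b k) = prob x"
          unfolding ab(3) by (rule indep_setD[OF i0 ab(1) Inter_W[OF ab(2)], symmetric])
        finally show ?thesis using y unfolding ab(3) by (simp add: Int_assoc)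
      qed
    qed
    show "Int_stable {u}" by (simp add: Int_stable_def)
    show "Int_stable (P \<union> null_sets M)"
    proof (rule Int_stableI)
      fix x y assume x: "x \<in> P \<union> null_sets M" and y: "y \<in> P \<union> null_sets M"
      then have ev: "x \<in> events" "y \<in> events" using PM by auto
      show "x \<inter> y \<in> P \<union> null_sets M"
      proof (cases "x \<in> null_sets M \<or> y \<in> null_sets M")
        case True
        then show ?thesis using ev null_set_Int1 null_set_Int2 by blast
      next
        case False
        then obtain a b a' b' where "a \<in> sets V0" "\<forall>k. b k \<in> sets (VS k)" "x = a \<inter> (\<Inter>k. b k)"
          "a' \<in> sets V0" "\<forall>k. b' k \<in> sets (VS k)" "y = a' \<inter> (\<Inter>k. b' k)"
          using x y unfolding P_def by blast
        then have "x \<inter> y = (a \<inter> a') \<inter> (\<Inter>k. b k \<inter> b' k)" "a \<inter> a' \<in> sets V0" "\<forall>k. b k \<inter> b' k \<in> sets (VS k)" by auto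
        then have "x \<inter> y \<in> P" unfolding P_def by blast
        then show ?thesis ..
      qed
    qed
  qed
  moreover have "A \<in> sigma_sets (space M) (P \<union> null_sets M)"
  proof (rule subsetD[OF sigma_sets_mono' A[unfolded sets_driving_filtration]])
    have X: "X0 i -` A \<inter> space M \<in> P" if "A \<in> sets borel" for i A
    proof -
      have "X0 i -` A \<inter> space V0 \<in> sets V0" using V0X that by (rule measurable_sets)
      moreover have "X0 i -` A \<inter> space M = (X0 i -` A \<inter> space M) \<inter> (\<Inter>k. space (VS k))" by auto
      ultimately show ?thesis unfolding P_def
        by (intro CollectI exI[of _ "X0 i -` A \<inter> space M"] exI[of _ "\<lambda>k. space (VS k)"] conjI) (auto simp del: sp(4))
    qed
    have Y: "W k r -` A \<inter> space M \<in> P" if "A \<in> sets borel" "0 \<le> r" "r \<le> s" for k r A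
    proof -
      let ?b = "\<lambda>k'. if k' = k then W k r -` A \<inter> space M else space (VS k')"
      have "\<forall>k'. ?b k' \<in> sets (VS k')"
      proof
        fix k'
        have "W k r -` A \<inter> space M \<in> sets (VS k)" unfolding VS_sets using that by (intro sigma_sets.Basic) blast
        then show "?b k' \<in> sets (VS k')" using sets.top[of "VS k'"] by auto
      qed
      moreover have "W k r -` A \<inter> space M = space V0 \<inter> (\<Inter>k'. ?b k')" by (auto split: if_splits)
      ultimately show ?thesis unfolding P_def using sets.top[of V0] by blast
    qed
    show "null_sets M \<union> {X0 i -` A \<inter> space M | i A. A \<in> sets borel}
      \<union> {W l r -` A \<inter> space M | l r A. 0 \<le> r \<and> r \<le> s \<and> A \<in> sets borel} \<subseteq> P \<union> null_sets M"
      using X Y by blast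
  qed
  moreover have "u \<in> sigma_sets (space M) {u}" by (rule sigma_sets.Basic) simp
  ultimately have "prob (A \<inter> u) = prob A * prob u" by (rule indep_setD)
  then show ?thesis by (simp add: u_def)
qed

lemma initial_data_driving_filtration:
  "X0 i \<in> borel_measurable (driving_filtration M W X0 t)"
  by (rule measurableI)
    (auto simp: space_driving_filtration sets_driving_filtration intro!: sigma_sets.Basic)

lemma brownian_filtration_driving:
  fixes W :: "'d::finite \<Rightarrow> real \<Rightarrow> 'a \<Rightarrow> real" and X0 :: "'n \<Rightarrow> 'a \<Rightarrow> 'b::topological_space"
  assumes W: "independent_brownian_motions M W" and X0: "initial_data_independent M W X0"
  shows "brownian_filtration M (driving_filtration M W X0) (W l)"
proof -
  have bm: "standard_brownian_motion M (W k)" for k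
    using W by (simp add: independent_brownian_motions_def)
  have Wm: "0 \<le> r \<Longrightarrow> W k r \<in> borel_measurable M" for k r
    using bm[of k] by (simp add: standard_brownian_motion_def)
  have X0m: "X0 i \<in> borel_measurable M" for i using X0 by (simp add: initial_data_independent_def)
  show ?thesis
  proof
    fix s t :: real
    show "space (driving_filtration M W X0 t) = space M" by (rule space_driving_filtration)
    show "sets (driving_filtration M W X0 t) \<subseteq> sets M"
      unfolding sets_driving_filtration using X0m Wm
      by (intro sets.sigma_sets_subset) (auto intro: measurable_sets)
    show "sets (driving_filtration M W X0 s) \<subseteq> sets (driving_filtration M W X0 t)" if "s \<le> t"
      unfolding sets_driving_filtration
    proof (rule sigma_sets_mono')
      have "{W l r -` A \<inter> space M | l r A. 0 \<le> r \<and> r \<le> s \<and> A \<in> sets borel}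
          \<subseteq> {W l r -` A \<inter> space M | l r A. 0 \<le> r \<and> r \<le> t \<and> A \<in> sets borel}"
      proof
        fix x assume "x \<in> {W l r -` A \<inter> space M | l r A. 0 \<le> r \<and> r \<le> s \<and> A \<in> sets borel}"
        then obtain l r A where x: "x = W l r -` A \<inter> space M" "0 \<le> r" "r \<le> s" "A \<in> sets borel" by blast
        have "r \<le> t" using x(3) that by (rule order_trans)
        then show "x \<in> {W l r -` A \<inter> space M | l r A. 0 \<le> r \<and> r \<le> t \<and> A \<in> sets borel}"
          using x by blast
      qed
      then show "null_sets M \<union> {X0 i -` A \<inter> space M | i A. A \<in> sets borel}
          \<union> {W l r -` A \<inter> space M | l r A. 0 \<le> r \<and> r \<le> s \<and> A \<in> sets borel}
        \<subseteq> null_sets M \<union> {X0 i -` A \<inter> space M | i A. A \<in> sets borel}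
          \<union> {W l r -` A \<inter> space M | l r A. 0 \<le> r \<and> r \<le> t \<and> A \<in> sets borel}"
        by (intro Un_mono order_refl)
    qed
    show "W l t \<in> borel_measurable (driving_filtration M W X0 t)" if "0 \<le> t"
    proof (rule measurableI)
      fix A :: "real set" assume "A \<in> sets borel"
      then show "W l t -` A \<inter> space (driving_filtration M W X0 t) \<in> sets (driving_filtration M W X0 t)"
        unfolding space_driving_filtration sets_driving_filtration using that
        by (intro sigma_sets.Basic) blast
    qed simp
    show "W l 0 \<omega> = 0" if "\<omega> \<in> space M" for \<omega> using bm[of l] that by (simp add: standard_brownian_motion_def)
    show "continuous_on {0..} (\<lambda>t. W l t \<omega>)" if "\<omega> \<in> space M" for \<omega>
      using bm[of l] that by (simp add: standard_brownian_motion_def)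
    show "distributed M lborel (\<lambda>\<omega>. W l t \<omega> - W l s \<omega>) (normal_density 0 (sqrt (t - s)))" if "0 \<le> s" "s < t"
      using bm[of l] that by (simp add: standard_brownian_motion_def)
    show "prob (A \<inter> ((\<lambda>\<omega>. W l t \<omega> - W l s \<omega>) -` C \<inter> space M)) =
        prob A * prob ((\<lambda>\<omega>. W l t \<omega> - W l s \<omega>) -` C \<inter> space M)"
      if "0 \<le> s" "s < t" "A \<in> sets (driving_filtration M W X0 s)" "C \<in> sets borel" for A C
      by (rule driving_filtration_indep_increment[OF W X0 that])
  qed
qed

end

section \<open>Consensus\<close>

lemma vec_nth_borel_measurable [measurable (raw)]:
  fixes f :: "'w \<Rightarrow> real^'d"
  assumes "f \<in> borel_measurable M"
  shows "(\<lambda>\<omega>. f \<omega> $ l) \<in> borel_measurable M"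
  by (rule measurable_compose[OF assms borel_measurable_continuous_onI]) (intro continuous_intros)

lemma locally_lipschitz_continuous:
  assumes "locally_lipschitz f"
  shows "continuous_on UNIV f"
proof -
  have "\<exists>r>0. continuous_on (ball x r) f" for x
    using assms lipschitz_on_continuous_on unfolding locally_lipschitz_def by metis
  then have "isCont f x" for x
    by (meson at_within_open centre_in_ball continuous_on_eq_continuous_at open_ball)
  then show ?thesis by (simp add: continuous_at_imp_continuous_on)
qed

text \<open>The Gibbs weights of the particles, which exhibit the consensus point as a convex
  combination.\<close>

definition consensus_weight :: "real \<Rightarrow> ('a \<Rightarrow> real) \<Rightarrow> ('n::finite \<Rightarrow> 'a) \<Rightarrow> 'n \<Rightarrow> real" where
  "consensus_weight \<beta> L x k = exp (- \<beta> * L (x k)) / (\<Sum>k\<in>UNIV. exp (- \<beta> * L (x k)))"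

lemma consensus_weight_nonneg: "0 \<le> consensus_weight \<beta> L x k"
  by (simp add: consensus_weight_def sum_nonneg)

lemma exp_sum_pos: "0 < (\<Sum>k\<in>(UNIV :: 'n::finite set). exp (f k :: real))"
  by (intro sum_pos) auto

lemma consensus_weight_sum: "(\<Sum>k\<in>UNIV. consensus_weight \<beta> L x k) = 1"
  using exp_sum_pos[of "\<lambda>k. - \<beta> * L (x k)"] by (simp add: consensus_weight_def flip: sum_divide_distrib)

lemma consensus_point_nth:
  fixes x :: "'n::finite \<Rightarrow> real^'d"
  shows "consensus_point \<beta> L x $ l = (\<Sum>k\<in>UNIV. consensus_weight \<beta> L x k * x k $ l)"
  by (simp add: consensus_point_def consensus_weight_def sum_distrib_left divide_inverse mult_ac)

lemma consensus_point_continuous: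
  fixes x :: "'n::finite \<Rightarrow> 'b::topological_space \<Rightarrow> 'a::real_normed_vector"
  assumes "continuous_on UNIV L" "\<And>k. continuous_on S (x k)"
  shows "continuous_on S (\<lambda>t. consensus_point \<beta> L (\<lambda>k. x k t))"
proof -
  have "continuous_on S (\<lambda>t. L (x k t))" for k
    by (rule continuous_on_compose2[OF assms(1) assms(2)]) simp
  moreover have "(\<Sum>k\<in>UNIV. exp (- \<beta> * L (x k t))) \<noteq> 0" for t
    using exp_sum_pos[of "\<lambda>k. - \<beta> * L (x k t)"] by simp
  ultimately show ?thesis
    unfolding consensus_point_def by (intro continuous_intros assms) auto
qed

lemma consensus_point_measurable:
  fixes x :: "'n::finite \<Rightarrow> 'w \<Rightarrow> 'a::{real_normed_vector, second_countable_topology}"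
  assumes "continuous_on UNIV L" and [measurable]: "\<And>k. x k \<in> borel_measurable M"
  shows "(\<lambda>\<omega>. consensus_point \<beta> L (\<lambda>k. x k \<omega>)) \<in> borel_measurable M"
proof -
  have [measurable]: "L \<in> borel_measurable borel" by (rule borel_measurable_continuous_onI[OF assms(1)])
  show ?thesis unfolding consensus_point_def by measurable
qed

lemma weighted_mean_deviation:
  fixes x :: "'n::finite \<Rightarrow> real"
  assumes w: "\<And>k. 0 \<le> w k" "(\<Sum>k\<in>UNIV. w k) = 1"
  shows "\<bar>y - (\<Sum>k\<in>UNIV. w k * x k)\<bar> \<le> (\<Sum>k\<in>UNIV. w k * \<bar>y - x k\<bar>)"
proof -
  have "y - (\<Sum>k\<in>UNIV. w k * x k) = (\<Sum>k\<in>UNIV. w k) * y - (\<Sum>k\<in>UNIV. w k * x k)" using w by simp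
  also have "\<dots> = (\<Sum>k\<in>UNIV. w k * (y - x k))"
    by (simp add: sum_distrib_left sum_subtractf algebra_simps)
  also have "\<bar>\<dots>\<bar> \<le> (\<Sum>k\<in>UNIV. \<bar>w k * (y - x k)\<bar>)" by (rule sum_abs)
  finally show ?thesis using w by (simp add: abs_mult)
qed

text \<open>With mean \<open>a\<close> and weighted mean \<open>c\<close>, the cross terms cancel
  and the mean of \<open>(x i - c)\<^sup>2\<close> is the mean of \<open>(x i - a)\<^sup>2\<close>
  plus \<open>(a - c)\<^sup>2\<close>. Both are at most \<open>m\<close>, the second because
  \<open>c\<close> is a convex combination of points within \<open>sqrt m\<close> of
  \<open>a\<close>.\<close>

lemma variance_about_weighted_mean:
  fixes x :: "'n::finite \<Rightarrow> real"
  assumes w: "\<And>k. 0 \<le> w k" "(\<Sum>k\<in>UNIV. w k) = 1"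
    and m: "\<And>k. (x k - (1 / real CARD('n)) * (\<Sum>j\<in>UNIV. x j))\<^sup>2 \<le> m"
  shows "(1 / real CARD('n)) * (\<Sum>i\<in>UNIV. (x i - (\<Sum>k\<in>UNIV. w k * x k))\<^sup>2) \<le> 2 * m"
proof -
  define a where "a = (1 / real CARD('n)) * (\<Sum>j\<in>UNIV. x j)"
  define c where "c = (\<Sum>k\<in>UNIV. w k * x k)"
  have m0: "0 \<le> m" using m[of undefined] zero_le_power2 order_trans by blast
  have "\<bar>a - c\<bar> \<le> (\<Sum>k\<in>UNIV. w k * \<bar>a - x k\<bar>)"
    unfolding c_def by (rule weighted_mean_deviation[OF w])
  also have "\<dots> \<le> (\<Sum>k\<in>UNIV. w k * sqrt m)"
  proof (intro sum_mono mult_left_mono w)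
    fix k
    have "\<bar>a - x k\<bar> = sqrt ((x k - a)\<^sup>2)" by simp
    also have "\<dots> \<le> sqrt m" using m[of k] by (simp only: a_def real_sqrt_le_iff)
    finally show "\<bar>a - x k\<bar> \<le> sqrt m" .
  qed
  also have "\<dots> = sqrt m" using w by (simp flip: sum_distrib_right)
  finally have "\<bar>a - c\<bar>\<^sup>2 \<le> (sqrt m)\<^sup>2" by (intro power_mono) auto
  then have ac: "(a - c)\<^sup>2 \<le> m" using m0 by simp
  have "(\<Sum>i\<in>UNIV. x i - a) = 0" by (simp add: sum_subtractf a_def)
  moreover have "(\<Sum>i\<in>UNIV. 2 * (x i - a) * (a - c)) = (\<Sum>i\<in>UNIV. x i - a) * (2 * (a - c))"
    unfolding sum_distrib_right by (intro sum.cong) (auto simp: algebra_simps)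
  ultimately have cross: "(\<Sum>i\<in>UNIV. 2 * (x i - a) * (a - c)) = 0" by simp
  have "(\<Sum>i\<in>UNIV. (x i - c)\<^sup>2) = (\<Sum>i\<in>UNIV. (x i - a)\<^sup>2 + 2 * (x i - a) * (a - c) + (a - c)\<^sup>2)"
    by (intro sum.cong refl) (simp add: power2_eq_square algebra_simps)
  also have "\<dots> = (\<Sum>i\<in>UNIV. (x i - a)\<^sup>2) + (\<Sum>i\<in>UNIV. 2 * (x i - a) * (a - c)) + (\<Sum>i\<in>(UNIV::'n set). (a - c)\<^sup>2)"
    by (simp only: sum.distrib)
  also have "\<dots> \<le> (\<Sum>i\<in>(UNIV::'n set). m) + 0 + (\<Sum>i\<in>(UNIV::'n set). m)"
    unfolding cross using m ac by (intro add_mono sum_mono) (auto simp: a_def)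
  also have "\<dots> = real CARD('n) * (2 * m)" by simp
  finally show ?thesis unfolding c_def[symmetric] by (simp add: field_simps)
qed

context brownian_filtration
begin

text \<open>\<open>geom\<close> at time \<open>t\<close> is a function of \<open>B t - B 0\<close>
  and hence independent of whatever is known at time 0, so its second moment splits off.\<close>

lemma nn_integral_geom_square:
  assumes t: "0 \<le> t" and f: "f \<in> borel_measurable (F 0)"
  shows "(\<integral>\<^sup>+\<omega>. f \<omega> * ennreal ((geom lam \<sigma> t \<omega>)\<^sup>2) \<partial>M) = ennreal (exp (- (2 * lam - \<sigma>\<^sup>2) * t)) * (\<integral>\<^sup>+\<omega>. f \<omega> \<partial>M)"
proof -
  define \<phi> where "\<phi> x = ennreal ((exp (- (lam + \<sigma>\<^sup>2 / 2) * t + \<sigma> * x))\<^sup>2)" for x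
  have m: "\<phi> \<in> borel_measurable borel" unfolding \<phi>_def by measurable
  have g: "ennreal ((geom lam \<sigma> t \<omega>)\<^sup>2) = \<phi> (B t \<omega> - B 0 \<omega>)" if "\<omega> \<in> space M" for \<omega>
    using B_zero[OF that] by (simp add: geom_def \<phi>_def)
  have "(\<integral>\<^sup>+\<omega>. f \<omega> * ennreal ((geom lam \<sigma> t \<omega>)\<^sup>2) \<partial>M) = (\<integral>\<^sup>+\<omega>. f \<omega> * \<phi> (B t \<omega> - B 0 \<omega>) \<partial>M)"
    by (intro nn_integral_cong) (simp add: g)
  also have "\<dots> = (\<integral>\<^sup>+\<omega>. f \<omega> \<partial>M) * (\<integral>\<^sup>+\<omega>. \<phi> (B t \<omega> - B 0 \<omega>) \<partial>M)"
    by (rule nn_integral_indep_increment[OF order_refl t f m])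
  also have "(\<integral>\<^sup>+\<omega>. \<phi> (B t \<omega> - B 0 \<omega>) \<partial>M) = (\<integral>\<^sup>+\<omega>. ennreal ((geom lam \<sigma> t \<omega>)\<^sup>2) \<partial>M)"
    by (intro nn_integral_cong) (simp add: g)
  also have "\<dots> = ennreal (exp (- (2 * lam - \<sigma>\<^sup>2) * t))"
    using geom_second_moment[OF t, of lam \<sigma>]
    by (subst nn_integral_eq_integral) (simp_all add: has_bochner_integral_iff)
  finally show ?thesis by (simp add: mult.commute)
qed

text \<open>Over \<open>{real n..real n + 1}\<close> with \<open>n\<close> large, the drift moves
  \<open>Y\<close> by at most \<open>lam * (\<bar>C\<bar> * exp (- (lam / 2)) ^ n)\<close>, and the
  noise by at most \<open>\<bar>\<sigma>\<bar> * exp (- (lam / 2 / 4)) ^ n\<close> by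
  \<open>ito_oscillation\<close> with \<open>c = lam / 2\<close>. Both bounds are summable.\<close>

lemma linear_sde_convergent:
  assumes p: "ito_pair H J" and lam: "0 < lam"
    and dec: "AE \<omega> in M. \<exists>C. \<forall>\<^sub>F t in at_top. \<bar>H t \<omega>\<bar> \<le> C * exp (- (lam / 2) * t)"
    and eq: "AE \<omega> in M. \<forall>t\<ge>0. Y t \<omega> = Y 0 \<omega> - lam * integral {0..t} (\<lambda>s. H s \<omega>) + \<sigma> * J t \<omega>"
  shows "AE \<omega> in M. \<exists>l. ((\<lambda>t. Y t \<omega>) \<longlongrightarrow> l) at_top"
proof -
  have "AE \<omega> in M. \<forall>\<^sub>F n in sequentially. \<forall>t\<in>{real n..real n + 1}. \<bar>J t \<omega> - J (real n) \<omega>\<bar> \<le> exp (- (lam / 2 / 4)) ^ n"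
    by (rule ito_oscillation[OF p _ dec]) (use lam in simp)
  then show ?thesis using dec eq AE_space
  proof eventually_elim
    case (elim \<omega>)
    from elim(2) obtain C T where C: "\<And>t. T \<le> t \<Longrightarrow> \<bar>H t \<omega>\<bar> \<le> C * exp (- (lam / 2) * t)"
      unfolding eventually_at_top_linorder by blast
    note Hc = ito_pairD(2)[OF p elim(4)] and eqY = elim(3)
    let ?b = "\<lambda>n. lam * (\<bar>C\<bar> * exp (- (lam / 2)) ^ n) + \<bar>\<sigma>\<bar> * exp (- (lam / 2 / 4)) ^ n"
    show ?case
    proof (rule tendsto_at_top_if_summable_oscillation)
      show "summable ?b" using lam by (intro summable_add summable_mult summable_geometric) auto
      have "\<forall>\<^sub>F n in sequentially. T \<le> real n"
        using eventually_ge_at_top[of "nat \<lceil>T\<rceil>"] by eventually_elim linarith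
      with elim(1) show "\<forall>\<^sub>F n in sequentially. \<forall>t\<in>{real n..real n + 1}. norm (Y t \<omega> - Y (real n) \<omega>) \<le> ?b n"
      proof eventually_elim
        case (elim n)
        show ?case
        proof
          fix t assume t: "t \<in> {real n..real n + 1}"
          have i: "(\<lambda>s. H s \<omega>) integrable_on {a..b}" if "0 \<le> a" for a b
            using that by (intro integrable_continuous_real continuous_on_subset[OF Hc]) auto
          have "norm (integral {real n..t} (\<lambda>s. H s \<omega>)) \<le> (\<bar>C\<bar> * exp (- (lam / 2)) ^ n) * (t - real n)"
          proof (rule integral_bound)
            show "continuous_on {real n..t} (\<lambda>s. H s \<omega>)" by (rule continuous_on_subset[OF Hc]) auto
            fix s assume s: "s \<in> {real n..t}"
            have "\<bar>H s \<omega>\<bar> \<le> C * exp (- (lam / 2) * s)" using C[of s] elim(2) s by auto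
            also have "\<dots> \<le> \<bar>C\<bar> * exp (- (lam / 2)) ^ n"
            proof (intro mult_mono)
              have "exp (- (lam / 2)) ^ n = exp (- (lam / 2) * real n)" by (simp add: exp_of_nat_mult[symmetric] mult.commute)
              then show "exp (- (lam / 2) * s) \<le> exp (- (lam / 2)) ^ n" using s lam by simp
            qed auto
            finally show "norm (H s \<omega>) \<le> \<bar>C\<bar> * exp (- (lam / 2)) ^ n" by simp
          qed (use t in simp)
          also have "\<dots> \<le> (\<bar>C\<bar> * exp (- (lam / 2)) ^ n) * 1" using t by (intro mult_left_mono) auto
          finally have I: "lam * \<bar>integral {real n..t} (\<lambda>s. H s \<omega>)\<bar> \<le> lam * (\<bar>C\<bar> * exp (- (lam / 2)) ^ n)"
            using lam by (intro mult_left_mono) auto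
          have "integral {0..t} (\<lambda>s. H s \<omega>) = integral {0..real n} (\<lambda>s. H s \<omega>) + integral {real n..t} (\<lambda>s. H s \<omega>)"
            using t by (intro Henstock_Kurzweil_Integration.integral_combine[symmetric] i) auto
          moreover have "Y t \<omega> = Y 0 \<omega> - lam * integral {0..t} (\<lambda>s. H s \<omega>) + \<sigma> * J t \<omega>"
            "Y (real n) \<omega> = Y 0 \<omega> - lam * integral {0..real n} (\<lambda>s. H s \<omega>) + \<sigma> * J (real n) \<omega>"
            by (rule eqY[rule_format]; use t in simp)+
          ultimately have "Y t \<omega> - Y (real n) \<omega> = - lam * integral {real n..t} (\<lambda>s. H s \<omega>) + \<sigma> * (J t \<omega> - J (real n) \<omega>)"
            by (simp add: algebra_simps)
          also have "norm \<dots> \<le> \<bar>lam * integral {real n..t} (\<lambda>s. H s \<omega>)\<bar> + \<bar>\<sigma> * (J t \<omega> - J (real n) \<omega>)\<bar>" by simp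
          also have "\<dots> \<le> ?b n"
            using I elim(1) t lam by (intro add_mono) (auto simp: abs_mult intro!: mult_left_mono)
          finally show "norm (Y t \<omega> - Y (real n) \<omega>) \<le> ?b n" .
        qed
      qed
    qed
  qed
qed

end

theorem lemma4p2:
  fixes M :: "'w measure"
    and W :: "'d::finite \<Rightarrow> real \<Rightarrow> 'w \<Rightarrow> real"
    and X :: "'n::finite \<Rightarrow> real \<Rightarrow> 'w \<Rightarrow> real^'d"
    and L :: "real^'d \<Rightarrow> real"
    and lam \<sigma> \<beta> :: real
  assumes "prob_space M"
    and "lam > 0" and "\<sigma> \<ge> 0" and "\<beta> > 0"
    and "locally_lipschitz L"
    and "independent_brownian_motions M W"
    and "initial_data_independent M W (\<lambda>i. X i 0)"
    and "cbo_strong_solution M W lam \<sigma> \<beta> L X"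
  shows "(\<forall>t\<ge>0.
            ennreal (1 / real CARD('n)) *
              (\<Sum>i\<in>UNIV. \<integral>\<^sup>+\<omega>. ennreal ((norm (X i t \<omega> - consensus_point \<beta> L (\<lambda>k. X k t \<omega>)))\<^sup>2) \<partial>M)
            \<le> ennreal (2 * exp (- (2 * lam - \<sigma>\<^sup>2) * t)) *
              (\<Sum>l\<in>UNIV. \<integral>\<^sup>+\<omega>. ennreal (MAX i\<in>UNIV.
                 (X i 0 \<omega> $ l - (1 / real CARD('n)) * (\<Sum>j\<in>UNIV. X j 0 \<omega> $ l))\<^sup>2) \<partial>M))
       \<and> (2 * lam > \<sigma>\<^sup>2 \<longrightarrow>
            (\<exists>Xinf \<in> borel_measurable M. \<forall>i.
               AE \<omega> in M. ((\<lambda>t. X i t \<omega>) \<longlongrightarrow> Xinf \<omega>) at_top))"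
proof -
  interpret prob_space M by fact
  define F where "F = driving_filtration M W (\<lambda>i. X i 0)"
  define Xc where "Xc t \<omega> = consensus_point \<beta> L (\<lambda>k. X k t \<omega>)" for t \<omega>
  have bf: "brownian_filtration M F (W l)" for l
    unfolding F_def by (rule brownian_filtration_driving[OF assms(6,7)])
  obtain J where ad: "\<And>i. adapted F (X i)"
    and Xcont: "\<And>i \<omega>. \<omega> \<in> space M \<Longrightarrow> continuous_on {0..} (\<lambda>t. X i t \<omega>)"
    and J: "\<And>i l. ito_integral_process M F (W l) (\<lambda>t \<omega>. X i t \<omega> $ l - Xc t \<omega> $ l) (J i l)"
    and eq: "\<And>i. AE \<omega> in M. \<forall>t\<ge>0. X i t \<omega> = X i 0 \<omega> - lam *\<^sub>R integral {0..t} (\<lambda>s. X i s \<omega> - Xc s \<omega>)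
                 + \<sigma> *\<^sub>R (\<Sum>l\<in>UNIV. J i l t \<omega> *\<^sub>R axis l 1)"
    using assms(8) unfolding cbo_strong_solution_def Let_def F_def Xc_def by blast
  have Lc: "continuous_on UNIV L" by (rule locally_lipschitz_continuous) fact
  have Xm: "X i t \<in> borel_measurable M" if "0 \<le> t" for i t
    using ad[of i] that brownian_filtration.measurable_F[OF bf] by (auto simp: adapted_def)
  have Xcc: "continuous_on {0..} (\<lambda>t. Xc t \<omega>)" if "\<omega> \<in> space M" for \<omega>
    unfolding Xc_def by (rule consensus_point_continuous[OF Lc Xcont[OF that]])
  have Xcm: "Xc t \<in> borel_measurable M" if "0 \<le> t" for t
    unfolding Xc_def by (rule consensus_point_measurable[OF Lc Xm[OF that]])

  \<comment> \<open>The system in coordinates\<close>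
  define H where "H i l t \<omega> = X i t \<omega> $ l - Xc t \<omega> $ l" for i l t \<omega>
  have Hm: "H i l t \<in> borel_measurable M" if "0 \<le> t" for i l t
    unfolding H_def[abs_def] using Xm[OF that, of i] Xcm[OF that] by measurable
  have Hc: "continuous_on {0..} (\<lambda>t. H i l t \<omega>)" if "\<omega> \<in> space M" for i l \<omega>
    unfolding H_def by (intro continuous_intros Xcont Xcc that)
  have pair: "brownian_filtration.ito_pair M F (W l) (H i l) (J i l)" for i l
    by (rule brownian_filtration.ito_pair_of_integral_process[OF bf])
      (use J[of l i] Hm Hc in \<open>simp_all add: H_def[abs_def]\<close>)
  have eqc: "AE \<omega> in M. \<forall>t\<ge>0. X i t \<omega> $ l = X i 0 \<omega> $ l - lam * integral {0..t} (\<lambda>s. H i l s \<omega>) + \<sigma> * J i l t \<omega>" for i l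
    using eq[of i] AE_space
  proof eventually_elim
    case (elim \<omega>)
    show ?case
    proof (intro allI impI)
      fix t :: real assume t: "0 \<le> t"
      have "continuous_on {0..t} (\<lambda>s. X i s \<omega> - Xc s \<omega>)"
        by (intro continuous_on_diff continuous_on_subset[OF Xcont[OF elim(2)]] continuous_on_subset[OF Xcc[OF elim(2)]]) auto
      then have I: "integral {0..t} (\<lambda>s. X i s \<omega> - Xc s \<omega>) $ l = integral {0..t} (\<lambda>s. H i l s \<omega>)"
        unfolding H_def by (subst integral_component_eq_cart[symmetric]) (auto intro: integrable_continuous_real)
      have S: "(\<Sum>k\<in>UNIV. J i k t \<omega> *\<^sub>R axis k 1) $ l = J i l t \<omega>"
        by (simp add: axis_def if_distrib cong: if_cong)
      have "X i t \<omega> $ l = (X i 0 \<omega> - lam *\<^sub>R integral {0..t} (\<lambda>s. X i s \<omega> - Xc s \<omega>)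
          + \<sigma> *\<^sub>R (\<Sum>l\<in>UNIV. J i l t \<omega> *\<^sub>R axis l 1)) $ l"
        by (rule arg_cong[where f="\<lambda>x. x $ l"]) (rule elim(1)[rule_format, OF t])
      then show "X i t \<omega> $ l = X i 0 \<omega> $ l - lam * integral {0..t} (\<lambda>s. H i l s \<omega>) + \<sigma> * J i l t \<omega>"
        unfolding vector_add_component vector_minus_component vector_scaleR_component I S real_scaleR_def .
    qed
  qed
  define G where "G l t \<omega> = brownian_filtration.geom (W l) lam \<sigma> t \<omega>" for l t \<omega>
  have Gnn: "0 \<le> G l t \<omega>" for l t \<omega> by (simp add: G_def brownian_filtration.geom_def[OF bf])
  have X0F: "(\<lambda>\<omega>. X i 0 \<omega> $ l) \<in> borel_measurable (F 0)" for i l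
  proof -
    have "X i 0 \<in> borel_measurable (F 0)"
      unfolding F_def by (rule initial_data_driving_filtration)
    then show ?thesis by measurable
  qed
  have diff1: "AE \<omega> in M. \<forall>t\<ge>0. X i t \<omega> $ l - X j t \<omega> $ l = (X i 0 \<omega> $ l - X j 0 \<omega> $ l) * G l t \<omega>" for i j l
  proof -
    let ?D = "\<lambda>t \<omega>. X i t \<omega> $ l - X j t \<omega> $ l"
    \<comment> \<open>The two stochastic integrals can be combined into one because both particles
      are driven by the same \<open>W l\<close>; the remaining integrand is \<open>\<sigma>\<close>
      times the difference, which closes the equation.\<close>
    have "brownian_filtration.ito_pair M F (W l) (\<lambda>t \<omega>. \<sigma> * H i l t \<omega> + (- \<sigma>) * H j l t \<omega>) (\<lambda>t \<omega>. \<sigma> * J i l t \<omega> + (- \<sigma>) * J j l t \<omega>)"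
      by (rule brownian_filtration.ito_pair_add_mult[OF bf pair pair]) auto
    also have "(\<lambda>t \<omega>. \<sigma> * H i l t \<omega> + (- \<sigma>) * H j l t \<omega>) = (\<lambda>t \<omega>. \<sigma> * ?D t \<omega>)"
      by (auto simp: H_def algebra_simps)
    finally have p: "brownian_filtration.ito_pair M F (W l) (\<lambda>t \<omega>. \<sigma> * ?D t \<omega>) (\<lambda>t \<omega>. \<sigma> * J i l t \<omega> + (- \<sigma>) * J j l t \<omega>)" .
    show ?thesis
      unfolding G_def
    proof (rule brownian_filtration.linear_sde_solution[OF bf p])
      show "0 \<le> lam" using assms by simp
      show "continuous_on {0..} (\<lambda>t. ?D t \<omega>)" if "\<omega> \<in> space M" for \<omega>
        by (intro continuous_intros Xcont that)
      show "(\<lambda>\<omega>. X i 0 \<omega> $ l - X j 0 \<omega> $ l) \<in> borel_measurable (F 0)"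
        using X0F by (intro borel_measurable_diff)
      show "AE \<omega> in M. \<forall>t\<ge>0. ?D t \<omega> = ?D 0 \<omega> - lam * integral {0..t} (\<lambda>s. ?D s \<omega>) + (\<sigma> * J i l t \<omega> + - \<sigma> * J j l t \<omega>)"
        using eqc[of i l] eqc[of j l] AE_space
      proof eventually_elim
        case (elim \<omega>)
        show ?case
        proof (intro allI impI)
          fix t :: real assume t: "0 \<le> t"
          have int: "(\<lambda>s. H k l s \<omega>) integrable_on {0..t}" for k
            by (intro integrable_continuous_real continuous_on_subset[OF Hc[OF elim(3)]]) auto
          have "integral {0..t} (\<lambda>s. ?D s \<omega>) = integral {0..t} (\<lambda>s. H i l s \<omega> - H j l s \<omega>)" by (simp add: H_def)
          also have "\<dots> = integral {0..t} (\<lambda>s. H i l s \<omega>) - integral {0..t} (\<lambda>s. H j l s \<omega>)"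
            by (rule Henstock_Kurzweil_Integration.integral_diff[OF int int])
          finally have I: "integral {0..t} (\<lambda>s. ?D s \<omega>) = integral {0..t} (\<lambda>s. H i l s \<omega>) - integral {0..t} (\<lambda>s. H j l s \<omega>)" .
          have "X i t \<omega> $ l = X i 0 \<omega> $ l - lam * integral {0..t} (\<lambda>s. H i l s \<omega>) + \<sigma> * J i l t \<omega>"
            "X j t \<omega> $ l = X j 0 \<omega> $ l - lam * integral {0..t} (\<lambda>s. H j l s \<omega>) + \<sigma> * J j l t \<omega>"
            using elim(1,2) t by blast+
          then show "?D t \<omega> = ?D 0 \<omega> - lam * integral {0..t} (\<lambda>s. ?D s \<omega>) + (\<sigma> * J i l t \<omega> + - \<sigma> * J j l t \<omega>)"
            unfolding I by (simp add: right_diff_distrib)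
        qed
      qed
    qed
  qed
  have diff: "AE \<omega> in M. \<forall>i j l. \<forall>t\<ge>0. X i t \<omega> $ l - X j t \<omega> $ l = (X i 0 \<omega> $ l - X j 0 \<omega> $ l) * G l t \<omega>"
  proof -
    have "AE \<omega> in M. \<forall>i\<in>UNIV. \<forall>j\<in>UNIV. \<forall>l\<in>UNIV. \<forall>t\<ge>0. X i t \<omega> $ l - X j t \<omega> $ l = (X i 0 \<omega> $ l - X j 0 \<omega> $ l) * G l t \<omega>"
      by (intro AE_finite_allI finite ballI diff1) 
    then show ?thesis by simp
  qed
  \<comment> \<open>\<open>H i l\<close> is the deviation of a particle from a convex combination,
    so it is bounded by differences of particles, which all carry the factor \<open>G l\<close>. The
    constant may depend on the outcome.\<close>
  have dec: "AE \<omega> in M. \<exists>C. \<forall>\<^sub>F t in at_top. \<bar>H i l t \<omega>\<bar> \<le> C * exp (- (lam / 2) * t)" for i l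
    using diff brownian_filtration.geom_decay[OF bf assms(2,3), of l, folded G_def]
  proof eventually_elim
    case (elim \<omega>)
    let ?C = "\<Sum>k\<in>UNIV. \<bar>X i 0 \<omega> $ l - X k 0 \<omega> $ l\<bar>"
    have "\<forall>\<^sub>F t in at_top. \<bar>H i l t \<omega>\<bar> \<le> ?C * exp (- (lam / 2) * t)"
      using elim(2) eventually_ge_at_top[of 0]
    proof eventually_elim
      case (elim t)
      let ?w = "consensus_weight \<beta> L (\<lambda>k. X k t \<omega>)"
      have "\<bar>H i l t \<omega>\<bar> \<le> (\<Sum>k\<in>UNIV. ?w k * \<bar>X i t \<omega> $ l - X k t \<omega> $ l\<bar>)"
        unfolding H_def Xc_def consensus_point_nth
        by (rule weighted_mean_deviation[OF consensus_weight_nonneg consensus_weight_sum])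
      also have "\<dots> \<le> (\<Sum>k\<in>UNIV. \<bar>X i 0 \<omega> $ l - X k 0 \<omega> $ l\<bar> * exp (- (lam / 2) * t))"
      proof (rule sum_mono)
        fix k
        have "?w k \<le> (\<Sum>k\<in>UNIV. ?w k)" by (rule member_le_sum) (auto simp: consensus_weight_nonneg)
        then have w1: "?w k \<le> 1" by (simp add: consensus_weight_sum)
        have "X i t \<omega> $ l - X k t \<omega> $ l = (X i 0 \<omega> $ l - X k 0 \<omega> $ l) * G l t \<omega>"
          using \<open>\<forall>i j l. \<forall>t\<ge>0. X i t \<omega> $ l - X j t \<omega> $ l = (X i 0 \<omega> $ l - X j 0 \<omega> $ l) * G l t \<omega>\<close> elim(2) by blast
        then have "\<bar>X i t \<omega> $ l - X k t \<omega> $ l\<bar> \<le> \<bar>X i 0 \<omega> $ l - X k 0 \<omega> $ l\<bar> * exp (- (lam / 2) * t)"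
          using elim(1) Gnn[of l t \<omega>] by (auto simp: abs_mult intro!: mult_left_mono)
        then have "?w k * \<bar>X i t \<omega> $ l - X k t \<omega> $ l\<bar> \<le> 1 * (\<bar>X i 0 \<omega> $ l - X k 0 \<omega> $ l\<bar> * exp (- (lam / 2) * t))"
          using w1 by (intro mult_mono) auto
        then show "?w k * \<bar>X i t \<omega> $ l - X k t \<omega> $ l\<bar> \<le> \<bar>X i 0 \<omega> $ l - X k 0 \<omega> $ l\<bar> * exp (- (lam / 2) * t)" by simp
      qed
      finally show ?case by (simp add: sum_distrib_right)
    qed
    then show ?case by blast
  qed
  show ?thesis
  proof (intro conjI allI impI)

    \<comment> \<open>The mean square estimate (i)\<close>
    fix t :: real assume t: "0 \<le> t"
    define m where "m l \<omega> = (MAX i\<in>UNIV. (X i 0 \<omega> $ l - (1 / real CARD('n)) * (\<Sum>j\<in>UNIV. X j 0 \<omega> $ l))\<^sup>2)" for l \<omega>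
    have mF: "m l \<in> borel_measurable (F 0)" for l
      unfolding m_def[abs_def] using X0F
      by (intro borel_measurable_Max borel_measurable_power borel_measurable_diff borel_measurable_times borel_measurable_sum) auto
    have mle: "(X i 0 \<omega> $ l - (1 / real CARD('n)) * (\<Sum>j\<in>UNIV. X j 0 \<omega> $ l))\<^sup>2 \<le> m l \<omega>" for i l \<omega>
      unfolding m_def by (rule Max_ge) auto
    have mnn: "0 \<le> m l \<omega>" for l \<omega> using mle zero_le_power2 order_trans by blast
    have mM: "m l \<in> borel_measurable M" for l using mF brownian_filtration.measurable_F[OF bf] by blast
    have GM: "G l t \<in> borel_measurable M" for l
      unfolding G_def using brownian_filtration.geom_measurable[OF bf t] by simp
    have me: "(\<lambda>\<omega>. ennreal (m l \<omega>)) \<in> borel_measurable M"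
      and Ge: "(\<lambda>\<omega>. ennreal ((G l t \<omega>)\<^sup>2)) \<in> borel_measurable M" for l
      using mM[of l] GM[of l] by (auto intro!: measurable_compose[OF _ measurable_ennreal] borel_measurable_power)
    let ?f = "\<lambda>i \<omega>. (norm (X i t \<omega> - Xc t \<omega>))\<^sup>2"
    have fm: "?f i \<in> borel_measurable M" for i using Xm[OF t, of i] Xcm[OF t] by measurable
    have "ennreal (1 / real CARD('n)) * (\<Sum>i\<in>UNIV. \<integral>\<^sup>+\<omega>. ennreal (?f i \<omega>) \<partial>M)
        = (\<integral>\<^sup>+\<omega>. ennreal (1 / real CARD('n)) * (\<Sum>i\<in>UNIV. ennreal (?f i \<omega>)) \<partial>M)"
    proof -
      have fe: "(\<lambda>\<omega>. ennreal (?f i \<omega>)) \<in> borel_measurable M" for i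
        by (rule measurable_compose[OF fm measurable_ennreal])
      then have "(\<Sum>i\<in>UNIV. \<integral>\<^sup>+\<omega>. ennreal (?f i \<omega>) \<partial>M) = (\<integral>\<^sup>+\<omega>. (\<Sum>i\<in>UNIV. ennreal (?f i \<omega>)) \<partial>M)"
        by (intro nn_integral_sum[symmetric])
      then show ?thesis using fe by (simp only: nn_integral_cmult borel_measurable_sum)
    qed
    also have "\<dots> = (\<integral>\<^sup>+\<omega>. ennreal ((1 / real CARD('n)) * (\<Sum>i\<in>UNIV. ?f i \<omega>)) \<partial>M)"
      by (intro nn_integral_cong, subst ennreal_mult) (auto intro: sum_nonneg)
    also have "\<dots> \<le> (\<integral>\<^sup>+\<omega>. (\<Sum>l\<in>UNIV. 2 * (ennreal (m l \<omega>) * ennreal ((G l t \<omega>)\<^sup>2))) \<partial>M)"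
    proof (rule nn_integral_mono_AE, use diff in eventually_elim)
      case (elim \<omega>)
      let ?w = "consensus_weight \<beta> L (\<lambda>k. X k t \<omega>)"
      have coord: "(1 / real CARD('n)) * (\<Sum>i\<in>UNIV. (X i t \<omega> $ l - Xc t \<omega> $ l)\<^sup>2) \<le> 2 * (m l \<omega> * (G l t \<omega>)\<^sup>2)" for l
        unfolding Xc_def consensus_point_nth
      proof (rule variance_about_weighted_mean[OF consensus_weight_nonneg consensus_weight_sum])
        fix k
        \<comment> \<open>A deviation from the mean is an average of differences, which transfers
          the factor \<open>G l t\<close> from the differences to the deviations.\<close>
        have dev: "y k - (1 / real CARD('n)) * (\<Sum>j\<in>UNIV. y j) = (1 / real CARD('n)) * (\<Sum>j\<in>UNIV. y k - y j)" for y :: "'n \<Rightarrow> real"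
          by (simp add: sum_subtractf field_simps)
        have "X k t \<omega> $ l - (1 / real CARD('n)) * (\<Sum>j\<in>UNIV. X j t \<omega> $ l) = (1 / real CARD('n)) * (\<Sum>j\<in>UNIV. X k t \<omega> $ l - X j t \<omega> $ l)"
          by (rule dev)
        also have "\<dots> = (1 / real CARD('n)) * (\<Sum>j\<in>UNIV. (X k 0 \<omega> $ l - X j 0 \<omega> $ l) * G l t \<omega>)"
          by (intro arg_cong2[where f="(*)"] refl sum.cong) (rule elim[rule_format, OF t])
        also have "\<dots> = (X k 0 \<omega> $ l - (1 / real CARD('n)) * (\<Sum>j\<in>UNIV. X j 0 \<omega> $ l)) * G l t \<omega>"
          unfolding dev[of "\<lambda>j. X j 0 \<omega> $ l"] by (simp add: sum_distrib_right)
        finally have "(X k t \<omega> $ l - (1 / real CARD('n)) * (\<Sum>j\<in>UNIV. X j t \<omega> $ l))\<^sup>2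
            = (X k 0 \<omega> $ l - (1 / real CARD('n)) * (\<Sum>j\<in>UNIV. X j 0 \<omega> $ l))\<^sup>2 * (G l t \<omega>)\<^sup>2"
          by (simp add: power_mult_distrib)
        also have "\<dots> \<le> m l \<omega> * (G l t \<omega>)\<^sup>2" by (intro mult_right_mono mle) simp
        finally show "(X k t \<omega> $ l - (1 / real CARD('n)) * (\<Sum>j\<in>UNIV. X j t \<omega> $ l))\<^sup>2 \<le> m l \<omega> * (G l t \<omega>)\<^sup>2" .
      qed
      have "(1 / real CARD('n)) * (\<Sum>i\<in>UNIV. ?f i \<omega>) = (1 / real CARD('n)) * (\<Sum>i\<in>UNIV. \<Sum>l\<in>UNIV. (X i t \<omega> $ l - Xc t \<omega> $ l)\<^sup>2)"
        by (simp add: norm_vec_def L2_set_def sum_nonneg)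
      also have "\<dots> = (\<Sum>l\<in>UNIV. (1 / real CARD('n)) * (\<Sum>i\<in>UNIV. (X i t \<omega> $ l - Xc t \<omega> $ l)\<^sup>2))"
        by (subst sum.swap) (rule sum_distrib_left)
      also have "\<dots> \<le> (\<Sum>l\<in>UNIV. 2 * (m l \<omega> * (G l t \<omega>)\<^sup>2))" by (intro sum_mono coord)
      finally have "ennreal ((1 / real CARD('n)) * (\<Sum>i\<in>UNIV. ?f i \<omega>)) \<le> ennreal (\<Sum>l\<in>UNIV. 2 * (m l \<omega> * (G l t \<omega>)\<^sup>2))"
        by (rule ennreal_leI)
      also have "\<dots> = (\<Sum>l\<in>UNIV. 2 * (ennreal (m l \<omega>) * ennreal ((G l t \<omega>)\<^sup>2)))"
        using mnn by (subst sum_ennreal[symmetric]) (auto simp: ennreal_mult)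
      finally show ?case .
    qed
    also have "\<dots> = (\<Sum>l\<in>UNIV. \<integral>\<^sup>+\<omega>. 2 * (ennreal (m l \<omega>) * ennreal ((G l t \<omega>)\<^sup>2)) \<partial>M)"
      by (intro nn_integral_sum borel_measurable_times_ennreal borel_measurable_const me Ge)
    also have "\<dots> = (\<Sum>l\<in>UNIV. 2 * (ennreal (exp (- (2 * lam - \<sigma>\<^sup>2) * t)) * (\<integral>\<^sup>+\<omega>. ennreal (m l \<omega>) \<partial>M)))"
    proof (intro sum.cong refl)
      fix l
      have "(\<integral>\<^sup>+\<omega>. 2 * (ennreal (m l \<omega>) * ennreal ((G l t \<omega>)\<^sup>2)) \<partial>M) = 2 * (\<integral>\<^sup>+\<omega>. ennreal (m l \<omega>) * ennreal ((G l t \<omega>)\<^sup>2) \<partial>M)"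
        by (intro nn_integral_cmult borel_measurable_times_ennreal me Ge)
      also have "(\<integral>\<^sup>+\<omega>. ennreal (m l \<omega>) * ennreal ((G l t \<omega>)\<^sup>2) \<partial>M) = ennreal (exp (- (2 * lam - \<sigma>\<^sup>2) * t)) * (\<integral>\<^sup>+\<omega>. ennreal (m l \<omega>) \<partial>M)"
        unfolding G_def using mF[of l]
        by (intro brownian_filtration.nn_integral_geom_square[OF bf t]) measurable
      finally show "(\<integral>\<^sup>+\<omega>. 2 * (ennreal (m l \<omega>) * ennreal ((G l t \<omega>)\<^sup>2)) \<partial>M)
          = 2 * (ennreal (exp (- (2 * lam - \<sigma>\<^sup>2) * t)) * (\<integral>\<^sup>+\<omega>. ennreal (m l \<omega>) \<partial>M))" .
    qed
    also have "\<dots> = ennreal (2 * exp (- (2 * lam - \<sigma>\<^sup>2) * t)) * (\<Sum>l\<in>UNIV. \<integral>\<^sup>+\<omega>. ennreal (m l \<omega>) \<partial>M)"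
      by (simp add: sum_distrib_left ennreal_mult mult.assoc)
    finally show "ennreal (1 / real CARD('n)) *
              (\<Sum>i\<in>UNIV. \<integral>\<^sup>+\<omega>. ennreal ((norm (X i t \<omega> - consensus_point \<beta> L (\<lambda>k. X k t \<omega>)))\<^sup>2) \<partial>M)
            \<le> ennreal (2 * exp (- (2 * lam - \<sigma>\<^sup>2) * t)) *
              (\<Sum>l\<in>UNIV. \<integral>\<^sup>+\<omega>. ennreal (MAX i\<in>UNIV.
                 (X i 0 \<omega> $ l - (1 / real CARD('n)) * (\<Sum>j\<in>UNIV. X j 0 \<omega> $ l))\<^sup>2) \<partial>M)"
      unfolding Xc_def m_def .
  next

    \<comment> \<open>The common limit in (ii)\<close>
    have conv: "AE \<omega> in M. \<exists>x. ((\<lambda>t. X i t \<omega> $ l) \<longlongrightarrow> x) at_top" for i l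
      by (rule brownian_filtration.linear_sde_convergent[OF bf pair assms(2) dec eqc])
    fix i0 :: 'n
    \<comment> \<open>Taking the limit of one reference particle along the integers defines
      \<open>Xinf\<close> for every outcome and makes it Borel measurable; almost surely it is the
      limit in continuous time.\<close>
    define Xinf where "Xinf \<omega> = lim (\<lambda>n. X i0 (real n) \<omega>)" for \<omega>
    have Xinfm: "Xinf \<in> borel_measurable M"
      unfolding Xinf_def[abs_def] by (rule borel_measurable_lim_metric) (simp add: Xm)
    have "AE \<omega> in M. \<forall>l\<in>UNIV. \<exists>x. ((\<lambda>t. X i0 t \<omega> $ l) \<longlongrightarrow> x) at_top"
      by (intro AE_finite_allI finite conv)
    then have lim0: "AE \<omega> in M. ((\<lambda>t. X i0 t \<omega>) \<longlongrightarrow> Xinf \<omega>) at_top"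
    proof eventually_elim
      case (elim \<omega>)
      then have "\<forall>l. \<exists>x. ((\<lambda>t. X i0 t \<omega> $ l) \<longlongrightarrow> x) at_top" by simp
      from choice[OF this] obtain x where x: "\<forall>l. ((\<lambda>t. X i0 t \<omega> $ l) \<longlongrightarrow> x l) at_top" ..
      have l: "((\<lambda>t. X i0 t \<omega>) \<longlongrightarrow> (\<chi> l. x l)) at_top"
        by (rule vec_tendstoI) (simp add: x)
      have "(\<lambda>n. X i0 (real n) \<omega>) \<longlonglongrightarrow> (\<chi> l. x l)"
        by (rule filterlim_compose[OF l filterlim_real_sequentially])
      then have "Xinf \<omega> = (\<chi> l. x l)" unfolding Xinf_def by (rule limI)
      then show ?case using l by simp
    qed
    have "AE \<omega> in M. \<forall>l\<in>UNIV. \<forall>\<^sub>F t in at_top. G l t \<omega> \<le> exp (- (lam / 2) * t)"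
      by (intro AE_finite_allI finite) (use brownian_filtration.geom_decay[OF bf assms(2,3)] in \<open>simp add: G_def\<close>)
    \<comment> \<open>The other particles share this limit, since their differences from the
      reference particle carry the factor \<open>G l\<close>, which tends to 0.\<close>
    then have lim: "AE \<omega> in M. ((\<lambda>t. X i t \<omega>) \<longlongrightarrow> Xinf \<omega>) at_top" for i
      using diff lim0
    proof eventually_elim
      case (elim \<omega>)
      have e0: "((\<lambda>t. exp (- (lam / 2) * t)) \<longlongrightarrow> 0) at_top"
      proof (rule filterlim_compose[OF exp_at_bot])
        show "LIM t at_top. - (lam / 2) * t :> at_bot"
          using assms(2) by (intro filterlim_tendsto_neg_mult_at_bot[OF tendsto_const]) (auto simp: filterlim_ident)
      qed
      have "((\<lambda>t. X i t \<omega> - X i0 t \<omega>) \<longlongrightarrow> 0) at_top"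
      proof (rule vec_tendstoI)
        fix l
        have "((\<lambda>t. G l t \<omega>) \<longlongrightarrow> 0) at_top"
          by (rule tendsto_sandwich[OF _ _ tendsto_const e0]) (use elim(1) Gnn in auto)
        then have "((\<lambda>t. (X i 0 \<omega> $ l - X i0 0 \<omega> $ l) * G l t \<omega>) \<longlongrightarrow> (X i 0 \<omega> $ l - X i0 0 \<omega> $ l) * 0) at_top"
          by (intro tendsto_mult tendsto_const)
        moreover have "\<forall>\<^sub>F t in at_top. (X i 0 \<omega> $ l - X i0 0 \<omega> $ l) * G l t \<omega> = (X i t \<omega> - X i0 t \<omega>) $ l"
          using eventually_ge_at_top[of 0]
          by eventually_elim (unfold vector_minus_component, rule elim(2)[rule_format, symmetric])
        ultimately have "((\<lambda>t. (X i t \<omega> - X i0 t \<omega>) $ l) \<longlongrightarrow> (X i 0 \<omega> $ l - X i0 0 \<omega> $ l) * 0) at_top"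
          by (rule Lim_transform_eventually)
        then show "((\<lambda>t. (X i t \<omega> - X i0 t \<omega>) $ l) \<longlongrightarrow> 0 $ l) at_top"
          by (simp only: mult_zero_right zero_index)
      qed
      from tendsto_add[OF this elim(3)] show ?case by simp
    qed
    then show "\<exists>Xinf\<in>borel_measurable M. \<forall>i. AE \<omega> in M. ((\<lambda>t. X i t \<omega>) \<longlongrightarrow> Xinf \<omega>) at_top"
      using Xinfm by blast
  qed
qed

end
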